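(* Let $R=R_1\times R_2\times\cdots\times R_n$ ($n\ge 1$) be a commutative ring with identity such that each $R_i$ is a local ring with finitely many ideals. Then: (A) $\mathbb{CG}^*(R)=\mathbb{CAG}^*(R)=\mathbb{AG}^{*c}(R)$. (B) $\mathbb{CG}^*(R)=\mathbb{CAG}^*(R)=\mathbb{AG}^{*c}(R)$ is chordal if and only if one of the following holds: (1) $n=1$; (2) $n=2$ and $R_i$ is a field for some $i\in\{1,2\}$; (3) $n=3$ and $R_i$ is a field for all $i\in\{1,2,3\}$. (C) $\mathbb{CG}^{*c}(R)=\mathbb{CAG}^{*c}(R)=\mathbb{AG}^{*}(R)$ is chordal if and only if $n\le 3$. (D) $\mathbb{CG}^*(R)=\mathbb{CAG}^*(R)=\mathbb{AG}^{*c}(R)$ is perfect if and only if $n\le 4$. (E) $\mathbb{CG}^*(R)$ and $\mathbb{CG}^{*c}(R)$ satisfy the Total Coloring Conjecture. Moreover, $\chi'(\mathbb{CG}^*(R))=\Delta(\mathbb{CG}^*(R))$. (F) If moreover each $R_i$ is a local Artinian principal ideal ring, then statements (B), (C), (D) and (E) remain true when $\mathbb{CG}^*(R)$ is replaced by the complement $\mathbb{IG}^c(R)$ of the intersection graph of ideals of $R$; that is: $\mathbb{IG}^c(R)$ is chordal iff one of (1), (2), (3) in (B) holds; $\mathbb{IG}(R)$ is chordal iff $n\le3$; $\mathbb{IG}^c(R)$ is perfect iff $n\le 4$; and $\mathbb{IG}^c(R)$ and $\mathbb{IG}(R)$ satisfy the Total Coloring Conjecture, with $\chi'(\mathbb{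IG}^c(R))=\Delta(\mathbb{IG}^c(R))$.
   Context: All four graphs are simple graphs whose vertices are the nonzero proper ideals of $R$; two distinct vertices $I,J$ are adjacent: in $\mathbb{CG}^*(R)$ (comaximal graph) iff $I+J=R$; in $\mathbb{CAG}^*(R)$ (co-annihilating ideal graph) iff $\mathrm{Ann}(I)\cap\mathrm{Ann}(J)=(0)$; in $\mathbb{AG}^*(R)$ (annihilating ideal graph) iff $I+J$ is an annihilating ideal, i.e. there is a nonzero $r\in R$ with $r(I+J)=(0)$; in $\mathbb{IG}(R)$ (intersection graph) iff $I\cap J\neq(0)$. A superscript $c$ denotes graph complement. A graph is chordal if it has no induced cycle of length at least $4$. A finite graph is perfect if every induced subgraph has chromatic number equal to its clique number. $\Delta$ is maximum degree; $\chi'$ is the edge chromatic number; $\chi''$ is the total chromatic number, i.e. the least number of colors in a coloring of vertices and edges in which adjacent vertices, edges sharing an endpoint, and incident vertex–edge pairs get different colors. A graph $G$ satisfies the Total Coloring Conjecture if $\chi''(G)\in\{\Delta(G)+1,\Delta(G)+2\}$. The null graph (no vertices) is regarded as chordal, perfect, trivially satisfying the Total Coloring Conjecture, and having $\chi'=\Delta=0$. *)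

theory Defs
  imports "HOL-Algebra.Chinese_Remainder" "HOL-Library.Ramsey"
begin

section \<open>Simple graphs\<close>

text \<open>Undirected graphs without loops or parallel edges: an edge is a two-element set of vertices.\<close>

record 'v ugraph =
  verts :: "'v set"
  edges :: "'v set set"

definition simple_graph :: "'v ugraph \<Rightarrow> bool" where
  "simple_graph G \<longleftrightarrow> edges G \<subseteq> nsets (verts G) 2"

definition graph_complement :: "'v ugraph \<Rightarrow> 'v ugraph" where
  "graph_complement G = \<lparr>verts = verts G, edges = nsets (verts G) 2 - edges G\<rparr>"

definition induced_subgraph :: "'v ugraph \<Rightarrow> 'v set \<Rightarrow> 'v ugraph" where
  "induced_subgraph G W = \<lparr>verts = W, edges = {e \<in> edges G. e \<subseteq> W}\<rparr>"

text \<open>The list enumerates the vertices of the cycle in cyclic order; the equivalence excludes chords.\<close>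

definition induced_cycle :: "'v ugraph \<Rightarrow> 'v list \<Rightarrow> bool" where
  "induced_cycle G vs \<longleftrightarrow>
     length vs \<ge> 3 \<and> distinct vs \<and> set vs \<subseteq> verts G \<and>
     (\<forall>i<length vs. \<forall>j<length vs.
        {vs ! i, vs ! j} \<in> edges G \<longleftrightarrow>
          j = Suc i mod length vs \<or> i = Suc j mod length vs)"

definition chordal :: "'v ugraph \<Rightarrow> bool" where
  "chordal G \<longleftrightarrow> \<not> (\<exists>vs. induced_cycle G vs \<and> length vs \<ge> 4)"

text \<open>
  In the colouring predicates below \<open>k\<close> is the number of available colours, so the three
  chromatic numbers are attained minima for finite graphs.
\<close>

definition vertex_coloring :: "'v ugraph \<Rightarrow> nat \<Rightarrow> ('v \<Rightarrow> nat) \<Rightarrow> bool" where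
  "vertex_coloring G k c \<longleftrightarrow>
     c \<in> verts G \<rightarrow> {..<k} \<and> (\<forall>u v. {u, v} \<in> edges G \<longrightarrow> c u \<noteq> c v)"

definition edge_coloring :: "'v ugraph \<Rightarrow> nat \<Rightarrow> ('v set \<Rightarrow> nat) \<Rightarrow> bool" where
  "edge_coloring G k d \<longleftrightarrow>
     d \<in> edges G \<rightarrow> {..<k} \<and>
     (\<forall>e\<in>edges G. \<forall>f\<in>edges G. e \<noteq> f \<and> e \<inter> f \<noteq> {} \<longrightarrow> d e \<noteq> d f)"

definition total_coloring :: "'v ugraph \<Rightarrow> nat \<Rightarrow> ('v \<Rightarrow> nat) \<Rightarrow> ('v set \<Rightarrow> nat) \<Rightarrow> bool" where
  "total_coloring G k c d \<longleftrightarrow>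
     vertex_coloring G k c \<and> edge_coloring G k d \<and>
     (\<forall>v\<in>verts G. \<forall>e\<in>edges G. v \<in> e \<longrightarrow> c v \<noteq> d e)"

definition chromatic_number :: "'v ugraph \<Rightarrow> nat" where
  "chromatic_number G = (LEAST k. \<exists>c. vertex_coloring G k c)"

definition edge_chromatic_number :: "'v ugraph \<Rightarrow> nat" where
  "edge_chromatic_number G = (LEAST k. \<exists>d. edge_coloring G k d)"

definition total_chromatic_number :: "'v ugraph \<Rightarrow> nat" where
  "total_chromatic_number G = (LEAST k. \<exists>c d. total_coloring G k c d)"

definition clique_number :: "'v ugraph \<Rightarrow> nat" where
  "clique_number G = Max {card K |K. K \<subseteq> verts G \<and> clique K (edges G)}"

definition perfect_graph :: "'v ugraph \<Rightarrow> bool" where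
  "perfect_graph G \<longleftrightarrow> finite (verts G) \<and>
     (\<forall>W\<subseteq>verts G. chromatic_number (induced_subgraph G W) = clique_number (induced_subgraph G W))"

definition vertex_degree :: "'v ugraph \<Rightarrow> 'v \<Rightarrow> nat" where
  "vertex_degree G v = card {e \<in> edges G. v \<in> e}"

text \<open>Inserting \<open>0\<close> only matters for the null graph, whose maximum degree is \<open>0\<close> by convention.\<close>

definition max_degree :: "'v ugraph \<Rightarrow> nat" where
  "max_degree G = Max (insert 0 (vertex_degree G ` verts G))"

text \<open>The null graph satisfies the conjecture by convention.\<close>

definition total_coloring_conjecture :: "'v ugraph \<Rightarrow> bool" where
  "total_coloring_conjecture G \<longleftrightarrow>
     verts G = {} \<or> total_chromatic_number G \<in> {max_degree G + 1, max_degree G + 2}"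

lemma simple_graph_complement [simp]: "simple_graph (graph_complement G)"
  by (auto simp: simple_graph_def graph_complement_def)

lemma graph_complement_complement:
  "simple_graph G \<Longrightarrow> graph_complement (graph_complement G) = G"
  by (auto simp: simple_graph_def graph_complement_def double_diff)


section \<open>Classes of commutative rings\<close>

text \<open>A maximal ideal is proper, so the zero ring is not local.\<close>

locale local_ring = cring +
  assumes ex1_maximalideal: "\<exists>!M. maximalideal M R"

locale artinian_ring = cring +
  assumes descending_chain:
    "\<lbrakk>\<And>k::nat. ideal (I k) R; \<And>k. I (Suc k) \<subseteq> I k\<rbrakk> \<Longrightarrow> \<exists>m. \<forall>k\<ge>m. I k = I m"

locale principal_ideal_ring = cring +
  assumes principal: "ideal I R \<Longrightarrow> principalideal I R"


section \<open>Graphs on the nonzero proper ideals of a ring\<close>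

definition nontrivial_ideals :: "('a, 'm) ring_scheme \<Rightarrow> 'a set set" where
  "nontrivial_ideals R = {I. ideal I R \<and> I \<noteq> {\<zero>\<^bsub>R\<^esub>} \<and> I \<noteq> carrier R}"

definition annihilator :: "('a, 'm) ring_scheme \<Rightarrow> 'a set \<Rightarrow> 'a set" where
  "annihilator R I = {r \<in> carrier R. \<forall>x\<in>I. r \<otimes>\<^bsub>R\<^esub> x = \<zero>\<^bsub>R\<^esub>}"

definition ideal_graph ::
    "('a, 'm) ring_scheme \<Rightarrow> ('a set \<Rightarrow> 'a set \<Rightarrow> bool) \<Rightarrow> 'a set ugraph" where
  "ideal_graph R adj =
     \<lparr>verts = nontrivial_ideals R,
      edges = {{I, J} |I J. I \<in> nontrivial_ideals R \<and> J \<in> nontrivial_ideals R \<and> I \<noteq> J \<and> adj I J}\<rparr>"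

definition comaximal_graph :: "('a, 'm) ring_scheme \<Rightarrow> 'a set ugraph" where
  "comaximal_graph R = ideal_graph R (\<lambda>I J. I <+>\<^bsub>R\<^esub> J = carrier R)"

definition coannihilating_ideal_graph :: "('a, 'm) ring_scheme \<Rightarrow> 'a set ugraph" where
  "coannihilating_ideal_graph R =
     ideal_graph R (\<lambda>I J. annihilator R I \<inter> annihilator R J = {\<zero>\<^bsub>R\<^esub>})"

definition annihilating_ideal_graph :: "('a, 'm) ring_scheme \<Rightarrow> 'a set ugraph" where
  "annihilating_ideal_graph R =
     ideal_graph R (\<lambda>I J. \<exists>r\<in>carrier R. r \<noteq> \<zero>\<^bsub>R\<^esub> \<and> (\<forall>x\<in>I <+>\<^bsub>R\<^esub> J. r \<otimes>\<^bsub>R\<^esub> x = \<zero>\<^bsub>R\<^esub>))"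

definition intersection_graph :: "('a, 'm) ring_scheme \<Rightarrow> 'a set ugraph" where
  "intersection_graph R = ideal_graph R (\<lambda>I J. I \<inter> J \<noteq> {\<zero>\<^bsub>R\<^esub>})"

lemma simple_ideal_graph: "simple_graph (ideal_graph R adj)"
  by (auto simp: simple_graph_def ideal_graph_def nsets_def card_2_iff)

end

theory Submission
  imports Defs "HOL-Number_Theory.Cong"
begin

text \<open>
  All graphs in question are instances of one combinatorial model. An ideal of a finite
  product of rings is a vector of ideals of the factors. In a local ring a sum of two ideals
  is the whole ring only if one of them is. Hence two ideals of the product are comaximal if
  and only if, for every factor, one of the two has the whole factor as its component. If the
  local factors have finitely many ideals, all proper ideals of a factor share a nonzero
  annihilator (\<open>common_annihilator_of_proper_ideals\<close>), so comaximality also describes the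
  co-annihilating and annihilating ideal graphs (\<open>comaximal_iff\<close>). Calling the support of an
  ideal the set of factors in which its component is proper, adjacency is disjointness of
  supports. If the factors are moreover principal ideal rings, then \<open>I \<inter> J = 0\<close> in a factor
  forces \<open>I = 0\<close> or \<open>J = 0\<close>, and the complement of the intersection graph is described in the
  same way, the support now consisting of the factors with nonzero component. In both cases
  the components in factor \<open>i\<close> are numbered by \<open>0, \<dots>, K i\<close>, where \<open>K i + 1\<close> is the number of
  ideals of the factor and \<open>0\<close> means absence from the support; the factor is a field if and
  only if \<open>K i = 1\<close>. The locale \<open>disjointness_graph\<close> captures this model.

  Chordality and perfection only concern the supports, that is, small configurations of
  nonempty subsets of \<open>n\<close> points. Chordality fails by four-cycles as soon as there is room for
  them; perfection fails by a five-cycle for \<open>n \<ge> 5\<close>, and for \<open>n \<le> 4\<close> an optimal colouring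
  uses the points that occur as one-element supports as colours (\<open>perfect\<close>).

  The colourings are algebraic. Let \<open>p\<close> be a coordinate with minimal \<open>K p\<close>. The edge between
  vectors \<open>u\<close> and \<open>v\<close> is coloured by \<open>x = u + v\<close>, or rather by the differences \<open>x j - x p\<close> modulo
  \<open>K j + 1\<close> for \<open>j \<noteq> p\<close> (\<open>col\<close>). At a fixed vertex \<open>u\<close> the sum is known on the support of \<open>u\<close>, and
  from this \<open>v\<close> can be recovered. The number of these colours exceeds the maximal degree by
  one, and one further colour for all vertices with \<open>p\<close> in their support completes a total
  colouring. To get an edge colouring with as many colours as the maximal degree, the edges
  of colour zero are deleted. They form a matching of vertices with complementary supports,
  and are put back one by one with other colours: mostly some colour is free at both ends,
  and otherwise a fan of one step makes room (\<open>extend_edge_labelling_by_fan\<close>). This needs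
  three coordinates; two coordinates give a complete bipartite graph with isolated vertices,
  and a single one gives no edges at all.

  The complement graph has maximal degree close to the number of vertices, and a total
  colouring arises from labels in a cyclic group, an edge receiving the sum of the labels of
  its ends and a vertex the double of its label (\<open>total_coloring_conjecture_by_sums\<close>).
\<close>

section \<open>Graphs, cycles and colourings\<close>

lemma simple_graph_edgeD:
  assumes "simple_graph G" "{u, v} \<in> edges G"
  shows "u \<in> verts G" "v \<in> verts G" "u \<noteq> v"
proof -
  have "{u, v} \<in> nsets (verts G) 2"
    using assms unfolding simple_graph_def by blast
  then show "u \<in> verts G" "v \<in> verts G" "u \<noteq> v"
    unfolding doubleton_in_nsets_2 by blast+
qed

lemma simple_graph_edgeE:
  assumes "simple_graph G" "e \<in> edges G" "u \<in> e"
  obtains v where "e = {u, v}" "u \<noteq> v" "u \<in> verts G" "v \<in> verts G"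
proof -
  have "e \<in> nsets (verts G) 2"
    using assms by (auto simp: simple_graph_def)
  then show thesis
    by (rule nsets2_E) (use assms(3) that in \<open>auto simp: insert_commute\<close>)
qed

lemma finite_edges: "simple_graph G \<Longrightarrow> finite (verts G) \<Longrightarrow> finite (edges G)"
  using finite_subset finite_imp_finite_nsets unfolding simple_graph_def by blast

definition neighbours :: "'v ugraph \<Rightarrow> 'v \<Rightarrow> 'v set" where
  "neighbours G v = {w. {v, w} \<in> edges G}"

lemma neighbours_subset: "simple_graph G \<Longrightarrow> neighbours G v \<subseteq> verts G - {v}"
  by (auto simp: neighbours_def dest: simple_graph_edgeD)

lemma vertex_degree_eq_card_neighbours:
  assumes "simple_graph G"
  shows "vertex_degree G v = card (neighbours G v)"
proof -
  have "{e \<in> edges G. v \<in> e} = (\<lambda>w. {v, w}) ` neighbours G v"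
    using assms by (auto simp: neighbours_def elim: simple_graph_edgeE)
  moreover have "inj_on (\<lambda>w. {v, w}) (neighbours G v)"
    by (auto simp: inj_on_def doubleton_eq_iff)
  ultimately show ?thesis
    by (simp add: vertex_degree_def card_image)
qed

lemma vertex_degree_complement:
  assumes "simple_graph G" "finite (verts G)" "v \<in> verts G"
  shows "vertex_degree (graph_complement G) v + vertex_degree G v = card (verts G) - 1"
proof -
  have eq: "neighbours (graph_complement G) v = verts G - {v} - neighbours G v"
    using assms(3) by (auto simp: neighbours_def graph_complement_def)
  have sub: "neighbours G v \<subseteq> verts G - {v}"
    by (rule neighbours_subset[OF assms(1)])
  show ?thesis
    unfolding vertex_degree_eq_card_neighbours[OF assms(1)]
      vertex_degree_eq_card_neighbours[OF simple_graph_complement] eq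
    using card_mono[OF _ sub] card_Diff_subset[OF finite_subset[OF sub] sub] assms(2,3)
    by simp
qed

lemma vertex_degree_le_max_degree:
  assumes "finite (verts G)" "v \<in> verts G"
  shows "vertex_degree G v \<le> max_degree G"
  using assms by (auto simp: max_degree_def)

lemma max_degree_attained:
  assumes "finite (verts G)" "verts G \<noteq> {}"
  obtains v where "v \<in> verts G" "vertex_degree G v = max_degree G"
proof -
  have "max_degree G \<in> insert 0 (vertex_degree G ` verts G)"
    unfolding max_degree_def by (rule Max_in) (use assms in auto)
  then consider "max_degree G = 0" | v where "v \<in> verts G" "vertex_degree G v = max_degree G"
    by auto
  then show thesis
  proof cases
    case 1
    with assms vertex_degree_le_max_degree[OF assms(1)] that show thesis by fastforce
  qed (rule that)
qed

text \<open>
  A walk of five vertices along a long induced cycle. On a four-cycle \<open>z\<close> and \<open>d\<close>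
  coincide; the stated non-edges hold for every length.
\<close>

lemma not_chordalE:
  assumes "\<not> chordal G"
  obtains z a b c d where "{z, a, b, c, d} \<subseteq> verts G"
    "{z, a} \<in> edges G" "{a, b} \<in> edges G" "{b, c} \<in> edges G" "{c, d} \<in> edges G"
    "{z, b} \<notin> edges G" "{a, c} \<notin> edges G" "{b, d} \<notin> edges G"
    "z \<noteq> b" "a \<noteq> c" "b \<noteq> d"
proof -
  obtain vs where vs: "induced_cycle G vs" and len: "length vs \<ge> 4"
    using assms by (auto simp: chordal_def)
  define l where "l = length vs"
  have l: "l \<ge> 4" and V: "set vs \<subseteq> verts G" and dist: "distinct vs"
    using vs len by (auto simp: induced_cycle_def l_def)
  have E: "{vs ! i, vs ! j} \<in> edges G \<longleftrightarrow> j = Suc i mod l \<or> i = Suc j mod l"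
    if "i < l" "j < l" for i j
    using vs that by (auto simp: induced_cycle_def l_def)
  have Suc_last: "Suc (l - 1) mod l = 0" and small: "Suc 0 mod l = 1" "Suc 1 mod l = 2"
    "Suc 2 mod l = 3"
    using l by auto
  have three: "Suc 3 mod l \<noteq> 1"
    using l by (cases "l = 4") auto
  show thesis
  proof (rule that[of "vs ! (l - 1)" "vs ! 0" "vs ! 1" "vs ! 2" "vs ! 3"])
    have "vs ! i \<in> verts G" if "i < l" for i
      using V that nth_mem[of i vs] by (auto simp: l_def)
    then show "{vs ! (l - 1), vs ! 0, vs ! 1, vs ! 2, vs ! 3} \<subseteq> verts G"
      using l by simp
    show "{vs ! (l - 1), vs ! 0} \<in> edges G"
      using l Suc_last by (subst E) auto
    show "{vs ! 0, vs ! 1} \<in> edges G" "{vs ! 1, vs ! 2} \<in> edges G" "{vs ! 2, vs ! 3} \<in> edges G"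
      using l by (subst E; simp)+
    show "{vs ! (l - 1), vs ! 1} \<notin> edges G"
      using l Suc_last small(2) by (subst E) auto
    show "{vs ! 0, vs ! 2} \<notin> edges G"
      using l small by (subst E) (auto simp: numeral_2_eq_2[symmetric])
    show "{vs ! 1, vs ! 3} \<notin> edges G"
      using l small three by (subst E) auto
    have "vs ! i \<noteq> vs ! j" if "i < l" "j < l" "i \<noteq> j" for i j
      using dist that by (simp add: nth_eq_iff_index_eq l_def)
    then show "vs ! (l - 1) \<noteq> vs ! 1" "vs ! 0 \<noteq> vs ! 2" "vs ! 1 \<noteq> vs ! 3"
      using l by auto
  qed
qed

lemma not_chordal_if_induced_four_cycle:
  assumes G: "simple_graph G"
    and E: "{a, b} \<in> edges G" "{b, c} \<in> edges G" "{c, d} \<in> edges G" "{d, a} \<in> edges G"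
    and N: "{a, c} \<notin> edges G" "{b, d} \<notin> edges G" and ne: "a \<noteq> c" "b \<noteq> d"
  shows "\<not> chordal G"
proof -
  have loop: "{v} \<notin> edges G" for v
    using simple_graph_edgeD(3)[OF G, of v v] by auto
  have sym: "{b, a} \<in> edges G" "{c, b} \<in> edges G" "{d, c} \<in> edges G" "{a, d} \<in> edges G"
    "{c, a} \<notin> edges G" "{d, b} \<notin> edges G"
    using E N by (simp_all add: insert_commute)
  have "distinct [a, b, c, d]" "set [a, b, c, d] \<subseteq> verts G"
    using E[THEN simple_graph_edgeD(3)[OF G]] E[THEN simple_graph_edgeD(1)[OF G]] ne by auto
  moreover have "{[a, b, c, d] ! i, [a, b, c, d] ! j} \<in> edges G \<longleftrightarrow>
      j = Suc i mod 4 \<or> i = Suc j mod 4" if "i < 4" "j < 4" for i j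
  proof -
    have "i = 0 \<or> i = 1 \<or> i = 2 \<or> i = 3" "j = 0 \<or> j = 1 \<or> j = 2 \<or> j = 3"
      using that by auto
    then show ?thesis
      by (elim disjE) (simp_all add: E N sym loop)
  qed
  ultimately have "induced_cycle G [a, b, c, d]"
    unfolding induced_cycle_def by simp
  then show ?thesis
    by (auto simp: chordal_def intro!: exI[of _ "[a, b, c, d]"])
qed

lemma finite_graph_vertex_coloring:
  assumes "simple_graph G" "finite (verts G)"
  obtains k c where "vertex_coloring G k c"
proof -
  obtain h where "bij_betw h (verts G) {0..<card (verts G)}"
    using ex_bij_betw_finite_nat[OF assms(2)] by blast
  then have inj: "h x = h y \<longleftrightarrow> x = y" and range: "h x < card (verts G)"
    if "x \<in> verts G" "y \<in> verts G" for x y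
    using that by (auto simp: bij_betw_def inj_on_def)
  have "h u \<noteq> h v" if "{u, v} \<in> edges G" for u v
    using simple_graph_edgeD[OF assms(1) that] inj by simp
  then have "vertex_coloring G (card (verts G)) h"
    using range by (simp add: vertex_coloring_def)
  then show thesis by (rule that)
qed

lemma chromatic_number_coloring:
  assumes "simple_graph G" "finite (verts G)"
  obtains c where "vertex_coloring G (chromatic_number G) c"
proof -
  have "\<exists>k c. vertex_coloring G k c"
    using finite_graph_vertex_coloring[OF assms] by blast
  then have "\<exists>c. vertex_coloring G (chromatic_number G) c"
    unfolding chromatic_number_def by (rule LeastI_ex)
  then show thesis using that by blast
qed

lemma
  assumes "finite (verts G)"
  shows card_le_clique_number: "K \<subseteq> verts G \<Longrightarrow> clique K (edges G) \<Longrightarrow> card K \<le> clique_number G"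
    and clique_number_attained:
      "\<exists>K\<subseteq>verts G. clique K (edges G) \<and> card K = clique_number G"
proof -
  let ?S = "{card K |K. K \<subseteq> verts G \<and> clique K (edges G)}"
  have fin: "finite ?S"
    by (rule finite_subset[of _ "card ` Pow (verts G)"]) (use assms in auto)
  show "K \<subseteq> verts G \<Longrightarrow> clique K (edges G) \<Longrightarrow> card K \<le> clique_number G"
    unfolding clique_number_def by (rule Max_ge[OF fin]) auto
  have "card ({} :: 'a set) \<in> ?S"
    by (intro CollectI exI[of _ "{}"]) (auto simp: clique_def)
  then have "clique_number G \<in> ?S"
    unfolding clique_number_def by (intro Max_in fin) blast
  then show "\<exists>K\<subseteq>verts G. clique K (edges G) \<and> card K = clique_number G"
    by auto
qed

lemma clique_number_le_chromatic_number:
  assumes "simple_graph G" "finite (verts G)"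
  shows "clique_number G \<le> chromatic_number G"
proof -
  obtain K where K: "K \<subseteq> verts G" "clique K (edges G)" "card K = clique_number G"
    using clique_number_attained[OF assms(2)] by blast
  obtain c where c: "vertex_coloring G (chromatic_number G) c"
    by (rule chromatic_number_coloring[OF assms])
  have "inj_on c K"
    using K c unfolding vertex_coloring_def clique_def inj_on_def by metis
  moreover have "c ` K \<subseteq> {..<chromatic_number G}"
    using K c by (auto simp: vertex_coloring_def)
  ultimately have "card K \<le> card {..<chromatic_number G}"
    by (intro card_inj_on_le) auto
  with K show ?thesis by simp
qed

lemma chromatic_eq_clique_numberI:
  assumes "simple_graph G" "finite (verts G)" "vertex_coloring G k c"
    and "K \<subseteq> verts G" "clique K (edges G)" "card K = k"
  shows "chromatic_number G = clique_number G"
proof (rule antisym)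
  have "chromatic_number G \<le> k"
    unfolding chromatic_number_def by (rule Least_le) (use assms in blast)
  also have "k \<le> clique_number G"
    using card_le_clique_number assms by blast
  finally show "chromatic_number G \<le> clique_number G" .
qed (rule clique_number_le_chromatic_number[OF assms(1,2)])

lemma simple_induced_subgraph:
  assumes "simple_graph G"
  shows "simple_graph (induced_subgraph G W)"
proof (unfold simple_graph_def, intro subsetI)
  fix e assume "e \<in> edges (induced_subgraph G W)"
  with assms show "e \<in> nsets (verts (induced_subgraph G W)) 2"
    by (auto simp: simple_graph_def induced_subgraph_def nsets_def)
qed

text \<open>A five-cycle needs three colours although it has no triangle.\<close>

lemma not_perfect_if_induced_five_cycle:
  assumes G: "simple_graph G" and V: "set vs \<subseteq> verts G" and vs: "distinct vs" "length vs = 5"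
    and E: "\<And>i j. i < 5 \<Longrightarrow> j < 5 \<Longrightarrow>
      {vs ! i, vs ! j} \<in> edges G \<longleftrightarrow> j = Suc i mod 5 \<or> i = Suc j mod 5"
  shows "\<not> perfect_graph G"
proof
  assume "perfect_graph G"
  define H where "H = induced_subgraph G (set vs)"
  have H: "simple_graph H" "finite (verts H)"
    unfolding H_def by (rule simple_induced_subgraph[OF G]) (simp add: induced_subgraph_def)
  have eq: "chromatic_number H = clique_number H"
    using \<open>perfect_graph G\<close> V by (simp add: perfect_graph_def H_def)
  have EH: "{vs ! i, vs ! j} \<in> edges H \<longleftrightarrow> j = Suc i mod 5 \<or> i = Suc j mod 5"
    if "i < 5" "j < 5" for i j
    using E[OF that] that vs(2) by (auto simp: H_def induced_subgraph_def)
  have "clique_number H \<le> 2"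
  proof (rule ccontr)
    assume "\<not> clique_number H \<le> 2"
    then obtain K where K: "K \<subseteq> set vs" "clique K (edges H)" "card K \<ge> 3"
      using clique_number_attained[OF H(2)] by (force simp: H_def induced_subgraph_def)
    obtain I where I: "I \<subseteq> {..<5}" "inj_on ((!) vs) I" "K = (!) vs ` I"
    proof (rule that[of "{i. i < 5 \<and> vs ! i \<in> K}"])
      show "inj_on ((!) vs) {i. i < 5 \<and> vs ! i \<in> K}"
        using vs by (auto simp: inj_on_def nth_eq_iff_index_eq)
      show "K = (!) vs ` {i. i < 5 \<and> vs ! i \<in> K}"
        using K(1) vs(2) by (force simp: in_set_conv_nth subset_iff)
    qed auto
    have adj: "j = i + 1 \<or> i = j + 1 \<or> i = 0 \<and> j = 4 \<or> i = 4 \<and> j = 0"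
      if "i \<in> I" "j \<in> I" "i \<noteq> j" for i j
    proof -
      have ij: "i < 5" "j < 5" using that I by auto
      then have "vs ! i \<noteq> vs ! j"
        using vs that by (simp add: nth_eq_iff_index_eq)
      then have "{vs ! i, vs ! j} \<in> edges H"
        using K(2) I that by (auto simp: clique_def)
      then have "j = Suc i mod 5 \<or> i = Suc j mod 5"
        using EH ij by blast
      with ij show ?thesis
        by (auto simp: mod_Suc split: if_splits)
    qed
    have "card I \<ge> 3"
      using K(3) I by (simp add: card_image)
    then obtain T where "T \<subseteq> I" "card T = 3"
      by (meson obtain_subset_with_card_n)
    then obtain i j k where "i \<in> I" "j \<in> I" "k \<in> I" "i \<noteq> j" "j \<noteq> k" "i \<noteq> k"
      by (auto simp: card_3_iff)
    moreover have "i < 5" "j < 5" "k < 5"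
      using calculation I by auto
    ultimately show False
      using adj[of i j] adj[of j k] adj[of i k] by auto
  qed
  then have le: "chromatic_number H \<le> 2" using eq by simp
  obtain c where c: "vertex_coloring H (chromatic_number H) c"
    by (rule chromatic_number_coloring[OF H])
  have lt: "c (vs ! i) < 2" if "i < 5" for i
  proof -
    have "vs ! i \<in> verts H"
      using that vs by (simp add: H_def induced_subgraph_def)
    then have "c (vs ! i) < chromatic_number H"
      using c by (auto simp: vertex_coloring_def)
    with le show ?thesis by simp
  qed
  have ne: "c (vs ! i) \<noteq> c (vs ! j)" if "i < 5" "j < 5" "j = Suc i mod 5" for i j
    using c EH[OF that(1,2)] that(3) by (auto simp: vertex_coloring_def)
  have "c (vs ! 0) \<noteq> c (vs ! 1)" "c (vs ! 1) \<noteq> c (vs ! 2)" "c (vs ! 2) \<noteq> c (vs ! 3)"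
    "c (vs ! 3) \<noteq> c (vs ! 4)" "c (vs ! 4) \<noteq> c (vs ! 0)"
    by (rule ne; simp)+
  moreover have "c (vs ! 0) < 2" "c (vs ! 1) < 2" "c (vs ! 2) < 2" "c (vs ! 3) < 2" "c (vs ! 4) < 2"
    by (rule lt; simp)+
  ultimately show False by linarith
qed

text \<open>Colourings are easiest to describe with algebraic palettes; only their size matters.\<close>

definition proper_edge_labelling :: "'v set set \<Rightarrow> 'c set \<Rightarrow> ('v set \<Rightarrow> 'c) \<Rightarrow> bool" where
  "proper_edge_labelling E C d \<longleftrightarrow>
     d \<in> E \<rightarrow> C \<and> (\<forall>e\<in>E. \<forall>f\<in>E. e \<noteq> f \<and> e \<inter> f \<noteq> {} \<longrightarrow> d e \<noteq> d f)"

lemma edge_chromatic_number_eq_max_degreeI: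
  assumes "finite (verts G)" "finite C"
    and d: "proper_edge_labelling (edges G) C d" and C: "card C \<le> max_degree G"
  shows "edge_chromatic_number G = max_degree G"
proof (rule antisym)
  obtain h where h: "bij_betw h C {0..<card C}"
    using ex_bij_betw_finite_nat[OF assms(2)] by blast
  then have inj: "h x = h y \<longleftrightarrow> x = y" and range: "h x < card C" if "x \<in> C" "y \<in> C" for x y
    using that by (auto simp: bij_betw_def inj_on_def)
  have "edge_coloring G (card C) (h \<circ> d)"
    using d by (auto simp: edge_coloring_def proper_edge_labelling_def inj range Pi_iff)
  then have ex: "\<exists>d. edge_coloring G (card C) d" by blast
  then have "edge_chromatic_number G \<le> card C"
    unfolding edge_chromatic_number_def by (rule Least_le)
  with C show "edge_chromatic_number G \<le> max_degree G" by simp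
  obtain d' where d': "edge_coloring G (edge_chromatic_number G) d'"
    using LeastI[of "\<lambda>k. \<exists>d. edge_coloring G k d", OF ex]
    unfolding edge_chromatic_number_def by blast
  have "vertex_degree G v \<le> edge_chromatic_number G" for v
  proof -
    have "card {e \<in> edges G. v \<in> e} \<le> card {..<edge_chromatic_number G}"
      by (rule card_inj_on_le[of d']) (use d' in \<open>auto simp: edge_coloring_def inj_on_def\<close>)
    then show ?thesis by (simp add: vertex_degree_def)
  qed
  then show "max_degree G \<le> edge_chromatic_number G"
    using assms(1) by (auto simp: max_degree_def)
qed

lemma total_coloring_conjectureI:
  assumes G: "simple_graph G" "finite (verts G)" and C: "finite C" "card C \<le> max_degree G + 2"
    and c: "c \<in> verts G \<rightarrow> C" "\<And>u v. {u, v} \<in> edges G \<Longrightarrow> c u \<noteq> c v"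
    and d: "proper_edge_labelling (edges G) C d"
    and cd: "\<And>v e. e \<in> edges G \<Longrightarrow> v \<in> e \<Longrightarrow> c v \<noteq> d e"
  shows "total_coloring_conjecture G"
proof (cases "verts G = {}")
  case False
  obtain h where h: "bij_betw h C {0..<card C}"
    using ex_bij_betw_finite_nat[OF C(1)] by blast
  have inj: "h x = h y \<longleftrightarrow> x = y" if "x \<in> C" "y \<in> C" for x y
    using h that by (auto simp: bij_betw_def inj_on_def)
  have range: "h x < card C" if "x \<in> C" for x
    using h that by (auto simp: bij_betw_def)
  have "total_coloring G (card C) (h \<circ> c) (h \<circ> d)"
    using c d cd simple_graph_edgeD[OF G(1)]
    by (auto simp: total_coloring_def vertex_coloring_def edge_coloring_def
        proper_edge_labelling_def inj range Pi_iff)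
  then have ex: "\<exists>c d. total_coloring G (card C) c d" by blast
  then have upper: "total_chromatic_number G \<le> card C"
    unfolding total_chromatic_number_def by (rule Least_le)
  obtain c' d' where cd': "total_coloring G (total_chromatic_number G) c' d'"
    using LeastI[of "\<lambda>k. \<exists>c d. total_coloring G k c d", OF ex]
    unfolding total_chromatic_number_def by blast
  obtain v where v: "v \<in> verts G" "vertex_degree G v = max_degree G"
    by (rule max_degree_attained[OF G(2) False])
  let ?I = "{e \<in> edges G. v \<in> e}"
  have "inj_on d' ?I"
    using cd' by (auto simp: total_coloring_def edge_coloring_def inj_on_def)
  moreover have "c' v \<notin> d' ` ?I"
    using cd' v(1) by (auto simp: total_coloring_def)
  moreover have "finite ?I"
    using finite_edges[OF G] by simp
  ultimately have "card (insert (c' v) (d' ` ?I)) = max_degree G + 1"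
    using v(2) by (simp add: card_image vertex_degree_def)
  moreover have "insert (c' v) (d' ` ?I) \<subseteq> {..<total_chromatic_number G}"
    using cd' v(1) by (auto simp: total_coloring_def vertex_coloring_def edge_coloring_def)
  then have "card (insert (c' v) (d' ` ?I)) \<le> card {..<total_chromatic_number G}"
    by (intro card_mono) auto
  ultimately show ?thesis
    using upper C(2) by (auto simp: total_coloring_conjecture_def)
qed (simp add: total_coloring_conjecture_def)

text \<open>
  Colouring the edge \<open>uv\<close> by \<open>\<psi> u + \<psi> v\<close> in the integers modulo \<open>m\<close> is proper and leaves the
  colour \<open>2 \<psi> u\<close> unused at \<open>u\<close>; that colour is given to \<open>u\<close>.
\<close>

lemma total_coloring_conjecture_by_sums:
  fixes \<psi> :: "'v \<Rightarrow> nat"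
  assumes G: "simple_graph G" "finite (verts G)" and m: "m \<le> max_degree G + 2"
    and \<psi>: "inj_on \<psi> (verts G)" "\<psi> ` verts G \<subseteq> {..<m}"
    and dbl: "\<And>u v. {u, v} \<in> edges G \<Longrightarrow> (2 * \<psi> u) mod m \<noteq> (2 * \<psi> v) mod m"
  shows "total_coloring_conjecture G"
proof (cases "verts G = {}")
  case False
  have "m > 0" using \<psi>(2) False by auto
  let ?d = "\<lambda>e. (\<Sum>u\<in>e. \<psi> u) mod m"
  let ?c = "\<lambda>u. (2 * \<psi> u) mod m"
  have sum: "?d {u, v} = (\<psi> u + \<psi> v) mod m" if "u \<noteq> v" for u v
    using that by simp
  have cancel: "u = v" if "u \<in> verts G" "v \<in> verts G" "(x + \<psi> u) mod m = (x + \<psi> v) mod m" for u v x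
  proof -
    have "\<psi> u mod m = \<psi> v mod m"
      using that(3) by (metis cong_add_lcancel_nat cong_def)
    moreover have "\<psi> u < m" "\<psi> v < m" using that \<psi>(2) by auto
    ultimately show ?thesis
      using that \<psi>(1) by (simp add: inj_on_def)
  qed
  have "proper_edge_labelling (edges G) {..<m} ?d"
    unfolding proper_edge_labelling_def
  proof (intro conjI ballI impI)
    fix e f assume ef: "e \<in> edges G" "f \<in> edges G" "e \<noteq> f \<and> e \<inter> f \<noteq> {}"
    then obtain u where u: "u \<in> e" "u \<in> f" by auto
    obtain v where v: "e = {u, v}" "u \<noteq> v" "u \<in> verts G" "v \<in> verts G"
      by (rule simple_graph_edgeE[OF G(1) ef(1) u(1)])
    obtain w where w: "f = {u, w}" "u \<noteq> w" "u \<in> verts G" "w \<in> verts G"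
      by (rule simple_graph_edgeE[OF G(1) ef(2) u(2)])
    show "?d e \<noteq> ?d f"
      using ef(3) v w cancel[of v w "\<psi> u"] by (auto simp: sum)
  qed (use \<open>m > 0\<close> in auto)
  moreover have "?c v \<noteq> ?d e" if e: "e \<in> edges G" "v \<in> e" for v e
  proof -
    obtain w where w: "e = {v, w}" "v \<noteq> w" "v \<in> verts G" "w \<in> verts G"
      by (rule simple_graph_edgeE[OF G(1) e])
    show ?thesis
      using cancel[of v w "\<psi> v"] w by (auto simp: sum mult_2)
  qed
  ultimately show ?thesis
    using G m dbl \<open>m > 0\<close>
    by (intro total_coloring_conjectureI[where C = "{..<m}" and c = ?c and d = ?d]) auto
qed (simp add: total_coloring_conjecture_def)

text \<open>
  For a nonempty graph the condition on the degree means that some vertex is adjacent to all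
  others. Every other edge may then be added as well, and the complete graph is coloured by
  sums modulo an odd number, where doubling is injective.
\<close>

lemma total_coloring_conjecture_if_dominating:
  assumes G: "simple_graph G" "finite (verts G)" and deg: "card (verts G) \<le> max_degree G + 1"
  shows "total_coloring_conjecture G"
proof -
  let ?N = "card (verts G)"
  define m where "m = (if odd ?N then ?N else ?N + 1)"
  have m: "odd m" "?N \<le> m" "m \<le> max_degree G + 2"
    using deg by (auto simp: m_def)
  obtain \<psi> where "bij_betw \<psi> (verts G) {0..<?N}"
    using ex_bij_betw_finite_nat[OF G(2)] by blast
  then have \<psi>: "inj_on \<psi> (verts G)" "\<psi> ` verts G \<subseteq> {..<m}"
    using m(2) by (auto simp: bij_betw_def)
  show ?thesis
  proof (rule total_coloring_conjecture_by_sums[OF G m(3) \<psi>])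
    fix u v assume uv: "{u, v} \<in> edges G"
    then have "\<psi> u \<noteq> \<psi> v" "\<psi> u < m" "\<psi> v < m"
      using \<psi> simple_graph_edgeD[OF G(1) uv] by (auto simp: inj_on_def)
    moreover have "a = b" if "(2 * a) mod m = (2 * b) mod m" "a < m" "b < m" for a b :: nat
    proof -
      have "coprime 2 m" using m(1) by simp
      then have "a mod m = b mod m"
        using that(1) cong_mult_lcancel_nat[of 2 m a b] by (simp add: cong_def)
      with that show ?thesis by simp
    qed
    ultimately show "(2 * \<psi> u) mod m \<noteq> (2 * \<psi> v) mod m" by blast
  qed
qed


section \<open>Extending a partial edge colouring\<close>

lemma proper_edge_labelling_insert:
  assumes d: "proper_edge_labelling E C d" and c: "c \<in> C"
    and uv: "{u, v} \<notin> E" "c \<notin> d ` {e \<in> E. u \<in> e}" "c \<notin> d ` {e \<in> E. v \<in> e}"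
  shows "proper_edge_labelling (insert {u, v} E) C (d({u, v} := c))"
proof -
  have new: "d e \<noteq> c" if "e \<in> E" "e \<inter> {u, v} \<noteq> {}" for e
    using that uv by auto
  have old: "d e \<noteq> d g" if "e \<in> E" "g \<in> E" "e \<noteq> g" "e \<inter> g \<noteq> {}" for e g
    using d that unfolding proper_edge_labelling_def by blast
  show ?thesis
    unfolding proper_edge_labelling_def
  proof (intro conjI ballI impI)
    show "d({u, v} := c) \<in> insert {u, v} E \<rightarrow> C"
      using d c by (auto simp: proper_edge_labelling_def)
    fix e g assume eg: "e \<in> insert {u, v} E" "g \<in> insert {u, v} E" "e \<noteq> g \<and> e \<inter> g \<noteq> {}"
    then consider "e = {u, v}" "g \<in> E" "g \<noteq> {u, v}" "g \<inter> {u, v} \<noteq> {}"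
      | "g = {u, v}" "e \<in> E" "e \<noteq> {u, v}" "e \<inter> {u, v} \<noteq> {}"
      | "e \<in> E" "g \<in> E" "e \<noteq> {u, v}" "g \<noteq> {u, v}"
      by blast
    then show "(d({u, v} := c)) e \<noteq> (d({u, v} := c)) g"
    proof cases
      case 1 with new[of g] show ?thesis by simp
    next
      case 2 with new[of e] show ?thesis by simp
    next
      case 3 with old[of e g] eg(3) show ?thesis by simp
    qed
  qed
qed

lemma extend_edge_labelling_greedily:
  assumes d: "proper_edge_labelling E C d" and fin: "finite C" "finite E"
    and few: "card {e \<in> E. u \<in> e} + card {e \<in> E. v \<in> e} < card C"
  shows "\<exists>d'. proper_edge_labelling (insert {u, v} E) C d'"
proof (cases "{u, v} \<in> E")
  case True
  with d show ?thesis by (auto simp: insert_absorb)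
next
  case False
  let ?U = "d ` {e \<in> E. u \<in> e}" and ?V = "d ` {e \<in> E. v \<in> e}"
  have "card (?U \<union> ?V) \<le> card ?U + card ?V"
    by (rule card_Un_le)
  also have "\<dots> \<le> card {e \<in> E. u \<in> e} + card {e \<in> E. v \<in> e}"
    using fin by (intro add_mono card_image_le) auto
  finally have "card (?U \<union> ?V) < card C"
    using few by simp
  then have "\<not> C \<subseteq> ?U \<union> ?V"
    using card_mono[of "?U \<union> ?V" C] fin by auto
  then obtain c where "c \<in> C" "c \<notin> ?U" "c \<notin> ?V" by blast
  with proper_edge_labelling_insert[OF d _ False] show ?thesis by blast
qed

text \<open>
  A fan with a single step. Let \<open>\<alpha>\<close> be unused at \<open>u\<close>. If some neighbour \<open>y\<close> of \<open>u\<close> also lacks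
  \<open>\<alpha>\<close>, and the colour of \<open>uy\<close> is unused at \<open>v\<close>, then \<open>uy\<close> can switch to \<open>\<alpha>\<close> and \<open>uv\<close> inherit its
  old colour. Vertices of \<open>Y\<close> only have neighbours in \<open>X\<close>, so at most \<open>card X - 1\<close> of them see
  \<open>\<alpha>\<close>, and at most \<open>card X - 1\<close> colours occur at \<open>v\<close>: if \<open>Y\<close> is large, a suitable \<open>y\<close> is left over.
\<close>

lemma extend_edge_labelling_by_fan:
  assumes d: "proper_edge_labelling E C d" and fin: "finite C" "finite E" "finite X" "finite Y"
    and few: "card {e \<in> E. u \<in> e} < card C"
    and uv: "u \<in> X" "v \<in> Y" "u \<noteq> v" "{u, v} \<notin> E"
    and toX: "\<And>y e. y \<in> Y \<Longrightarrow> e \<in> E \<Longrightarrow> y \<in> e \<Longrightarrow> \<exists>x\<in>X. e = {x, y}"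
    and full: "\<And>y. y \<in> Y \<Longrightarrow> y \<noteq> v \<Longrightarrow> {u, y} \<in> E"
    and large: "2 * card X \<le> card Y + 1"
  shows "\<exists>d'. proper_edge_labelling (insert {u, v} E) C d'"
proof -
  let ?at = "\<lambda>x. {e \<in> E. x \<in> e}"
  have proper: "d e \<noteq> d g" if "e \<in> E" "g \<in> E" "e \<noteq> g" "x \<in> e" "x \<in> g" for e g x
    using d that unfolding proper_edge_labelling_def by blast
  have "card (d ` ?at u) < card C"
    using few fin by (intro le_less_trans[OF card_image_le]) auto
  then have "\<not> C \<subseteq> d ` ?at u"
    using card_mono[of "d ` ?at u" C] fin by auto
  then obtain \<alpha> where \<alpha>: "\<alpha> \<in> C" "\<alpha> \<notin> d ` ?at u" by blast
  show ?thesis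
  proof (cases "\<alpha> \<in> d ` ?at v")
    case False
    with proper_edge_labelling_insert[OF d \<alpha>(1) uv(4) \<alpha>(2)] show ?thesis by blast
  next
    case True
    define B where "B = {y \<in> Y. \<alpha> \<in> d ` ?at y}"
    define D where "D = {y \<in> Y - {v}. d {u, y} \<in> d ` ?at v}"
    have pos: "card X > 0" using uv(1) fin by (auto simp: card_gt_0_iff)
    have "\<exists>x\<in>X - {u}. {x, y} \<in> E \<and> d {x, y} = \<alpha>" if y: "y \<in> B" for y
    proof -
      obtain e where e: "e \<in> E" "y \<in> e" "d e = \<alpha>" "y \<in> Y"
        using y unfolding B_def by blast
      moreover obtain x where "x \<in> X" "e = {x, y}"
        using toX[OF e(4,1,2)] by blast
      moreover have "x \<noteq> u"
        using calculation \<alpha>(2) by auto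
      ultimately show ?thesis by blast
    qed
    then obtain g where g: "g y \<in> X - {u}" "{g y, y} \<in> E" "d {g y, y} = \<alpha>" if "y \<in> B" for y
      by metis
    have "inj_on g B"
    proof (rule inj_onI)
      fix y z assume yz: "y \<in> B" "z \<in> B" "g y = g z"
      show "y = z"
      proof (rule ccontr)
        assume "y \<noteq> z"
        then have "{g y, y} \<noteq> {g y, z}"
          by (auto simp: doubleton_eq_iff)
        moreover have "{g y, z} \<in> E" "d {g y, z} = \<alpha>"
          using g(2,3)[OF yz(2)] yz(3) by simp_all
        ultimately show False
          using proper[of "{g y, y}" "{g y, z}" "g y"] g(2,3)[OF yz(1)] by simp
      qed
    qed
    then have "card B \<le> card (X - {u})"
      by (rule card_inj_on_le) (use g fin in auto)
    then have B: "card B \<le> card X - 1"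
      using uv(1) fin by simp
    have "?at v \<subseteq> (\<lambda>x. {x, v}) ` (X - {u})"
      using toX[OF uv(2)] uv(4) by blast
    then have "card (?at v) \<le> card (X - {u})"
      using fin by (intro surj_card_le) auto
    then have "card (d ` ?at v) \<le> card X - 1"
      using card_image_le[of "?at v" d] fin uv(1) by simp
    moreover have "inj_on (\<lambda>y. d {u, y}) D"
    proof (rule inj_onI)
      fix y z assume yz: "y \<in> D" "z \<in> D" "d {u, y} = d {u, z}"
      show "y = z"
      proof (rule ccontr)
        assume "y \<noteq> z"
        then have "{u, y} \<noteq> {u, z}"
          by (auto simp: doubleton_eq_iff)
        then have "d {u, y} \<noteq> d {u, z}"
          using full yz by (intro proper[of _ _ u]) (auto simp: D_def)
        with yz(3) show False by simp
      qed
    qed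
    then have "card D \<le> card (d ` ?at v)"
      by (rule card_inj_on_le) (use fin in \<open>auto simp: D_def\<close>)
    ultimately have "card B + card D < card Y"
      using B large pos by linarith
    then have "card (B \<union> D) < card Y"
      using card_Un_le[of B D] by linarith
    then have "\<not> Y \<subseteq> B \<union> D"
      using card_mono[of "B \<union> D" Y] fin by (auto simp: B_def D_def)
    then obtain y where y: "y \<in> Y" "y \<notin> B" "y \<notin> D" by blast
    have "v \<in> B"
      using True uv(2) by (auto simp: B_def)
    with y have "y \<noteq> v" by auto
    then have uy: "{u, y} \<in> E" using full y by blast
    define d1 where "d1 = d({u, y} := \<alpha>)"
    have "proper_edge_labelling (insert {u, y} (E - {{u, y}})) C d1"
      unfolding d1_def
    proof (rule proper_edge_labelling_insert[OF _ \<alpha>(1)])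
      show "proper_edge_labelling (E - {{u, y}}) C d"
        using d unfolding proper_edge_labelling_def by blast
    qed (use \<alpha>(2) y in \<open>auto simp: B_def\<close>)
    then have d1: "proper_edge_labelling E C d1"
      using uy by (simp add: insert_absorb)
    have "d {u, y} \<in> C"
      using d uy by (auto simp: proper_edge_labelling_def)
    moreover have "d {u, y} \<notin> d1 ` ?at u"
    proof
      assume "d {u, y} \<in> d1 ` ?at u"
      then obtain e where e: "e \<in> E" "u \<in> e" "d {u, y} = d1 e" by auto
      show False
      proof (cases "e = {u, y}")
        case True
        with e(3) have "\<alpha> = d {u, y}" by (simp add: d1_def)
        with \<alpha>(2) uy show False by auto
      next
        case False
        with e proper[OF uy e(1) _ _ e(2)] show False by (auto simp: d1_def)
      qed
    qed
    moreover have "d {u, y} \<notin> d1 ` ?at v"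
    proof
      assume "d {u, y} \<in> d1 ` ?at v"
      then obtain e where e: "e \<in> E" "v \<in> e" "d {u, y} = d1 e" by auto
      moreover have "e \<noteq> {u, y}" using e(2) \<open>y \<noteq> v\<close> uv(3) by auto
      ultimately have "d {u, y} = d e" by (simp add: d1_def)
      then have "d {u, y} \<in> d ` ?at v" using e by auto
      with y \<open>y \<noteq> v\<close> show False by (auto simp: D_def)
    qed
    ultimately show ?thesis
      using proper_edge_labelling_insert[OF d1 _ uv(4)] by blast
  qed
qed


section \<open>Disjointness graphs of vectors\<close>

text \<open>
  The graph on all vectors with entries \<open>0, \<dots>, K i\<close>, except for the zero vector and one vector
  \<open>f\<close> of full support, in which vectors with disjoint supports are adjacent. The vertices may
  be of any type, as only their coordinates \<open>\<phi>\<close> matter. Loops cannot arise because supports of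
  vertices are nonempty.
\<close>

locale disjointness_graph =
  fixes G :: "'v ugraph" and n :: nat and K :: "nat \<Rightarrow> nat" and \<phi> :: "'v \<Rightarrow> nat \<Rightarrow> nat"
    and f :: "nat \<Rightarrow> nat"
  assumes n_pos: "n \<ge> 1"
    and K_pos: "i < n \<Longrightarrow> K i \<ge> 1"
    and f: "f \<in> (\<Pi>\<^sub>E i\<in>{..<n}. {1..K i})"
    and \<phi>: "bij_betw \<phi> (verts G) ((\<Pi>\<^sub>E i\<in>{..<n}. {..K i}) - {\<lambda>i\<in>{..<n}. 0, f})"
    and edges_eq: "edges G =
      {{u, v} |u v. u \<in> verts G \<and> v \<in> verts G \<and> (\<forall>i<n. \<phi> u i = 0 \<or> \<phi> v i = 0)}"
begin

definition supp :: "'v \<Rightarrow> nat set" where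
  "supp u = {i. i < n \<and> \<phi> u i \<noteq> 0}"

lemma supp_subset: "supp u \<subseteq> {..<n}" and finite_supp [simp]: "finite (supp u)"
  by (auto simp: supp_def)

lemma edge_iff: "{u, v} \<in> edges G \<longleftrightarrow> u \<in> verts G \<and> v \<in> verts G \<and> supp u \<inter> supp v = {}"
proof
  assume "{u, v} \<in> edges G"
  then show "u \<in> verts G \<and> v \<in> verts G \<and> supp u \<inter> supp v = {}"
    unfolding edges_eq supp_def by (auto simp: doubleton_eq_iff)
next
  assume "u \<in> verts G \<and> v \<in> verts G \<and> supp u \<inter> supp v = {}"
  then show "{u, v} \<in> edges G"
    unfolding edges_eq supp_def by (intro CollectI exI[of _ u] exI[of _ v]) auto
qed

lemma finite_verts: "finite (verts G)"
  using bij_betw_finite[OF \<phi>] by (simp add: finite_PiE)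

lemma coord_le: "u \<in> verts G \<Longrightarrow> i < n \<Longrightarrow> \<phi> u i \<le> K i"
  using bij_betwE[OF \<phi>] by (fastforce simp: PiE_iff)

lemma vertex_eqI:
  assumes "u \<in> verts G" "v \<in> verts G" "\<And>i. i < n \<Longrightarrow> \<phi> u i = \<phi> v i"
  shows "u = v"
proof -
  have "\<phi> u = \<phi> v"
    by (rule PiE_ext[of _ "{..<n}" "\<lambda>i. {..K i}"]) (use bij_betwE[OF \<phi>] assms in auto)
  then show ?thesis
    using \<phi> assms by (auto simp: bij_betw_def inj_on_def)
qed

lemma supp_nonempty: "u \<in> verts G \<Longrightarrow> supp u \<noteq> {}"
proof
  assume u: "u \<in> verts G" "supp u = {}"
  have "\<phi> u = (\<lambda>i\<in>{..<n}. 0)"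
    by (rule PiE_ext[of _ "{..<n}" "\<lambda>i. {..K i}"])
      (use bij_betwE[OF \<phi>] u in \<open>auto simp: supp_def\<close>)
  with bij_betwE[OF \<phi>] u(1) show False by blast
qed

lemma simple: "simple_graph G"
  unfolding simple_graph_def
proof
  fix e assume "e \<in> edges G"
  then obtain u v where "e = {u, v}" "{u, v} \<in> edges G"
    by (auto simp: edges_eq)
  with edge_iff supp_nonempty show "e \<in> nsets (verts G) 2"
    by fastforce
qed

lemma vertex_exists:
  assumes x: "\<And>i. i < n \<Longrightarrow> x i \<le> K i" and pos: "\<exists>i<n. x i \<noteq> 0" and ne: "\<exists>i<n. x i \<noteq> f i"
  obtains u where "u \<in> verts G" "\<forall>i<n. \<phi> u i = x i" "supp u = {i. i < n \<and> x i \<noteq> 0}"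
proof -
  have "restrict x {..<n} \<in> (\<Pi>\<^sub>E i\<in>{..<n}. {..K i}) - {\<lambda>i\<in>{..<n}. 0, f}"
  proof
    show "restrict x {..<n} \<in> (\<Pi>\<^sub>E i\<in>{..<n}. {..K i})"
      using x by auto
    show "restrict x {..<n} \<notin> {\<lambda>i\<in>{..<n}. 0, f}"
      using pos ne by (auto simp: fun_eq_iff restrict_def)
  qed
  then obtain u where u: "u \<in> verts G" "restrict x {..<n} = \<phi> u"
    using bij_betw_imp_surj_on[OF \<phi>] by (metis imageE)
  then have "\<phi> u i = x i" if "i < n" for i
    using that by (metis lessThan_iff restrict_apply')
  with u show thesis
    by (intro that) (auto simp: supp_def)
qed

lemma f_nonzero: "i < n \<Longrightarrow> f i \<noteq> 0"
  using PiE_mem[OF f, of i] by auto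

lemma vertex_of_type:
  assumes "S \<subseteq> {..<n}" "S \<noteq> {}" "S \<noteq> {..<n}" and a: "\<And>i. i \<in> S \<Longrightarrow> 1 \<le> a i \<and> a i \<le> K i"
  obtains u where "u \<in> verts G" "supp u = S" "\<And>i. i \<in> S \<Longrightarrow> \<phi> u i = a i"
proof -
  define x where "x = (\<lambda>i. if i \<in> S then a i else 0)"
  obtain i j where "i \<in> S" "j < n" "j \<notin> S"
    using assms(1-3) by blast
  then have pos: "\<exists>i<n. x i \<noteq> 0" and ne: "\<exists>i<n. x i \<noteq> f i"
    using assms(1) a[of i] f_nonzero[of j] by (auto simp: x_def)
  have le: "x i \<le> K i" if "i < n" for i
    using a by (simp add: x_def)
  obtain u where u: "u \<in> verts G" "\<forall>i<n. \<phi> u i = x i" "supp u = {i. i < n \<and> x i \<noteq> 0}"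
    by (rule vertex_exists[OF le pos ne])
  have "supp u = S"
    using u(3) assms(1) a by (force simp: x_def)
  then show thesis
    using assms(1) u(1,2) by (intro that) (auto simp: x_def)
qed

lemma vertex_of_supp:
  assumes "S \<subseteq> {..<n}" "S \<noteq> {}" "k < n" "k \<notin> S"
  obtains u where "u \<in> verts G" "supp u = S"
proof (rule vertex_of_type[OF assms(1,2), of "\<lambda>_. 1"])
  show "S \<noteq> {..<n}" using assms by auto
  show "1 \<le> (1 :: nat) \<and> 1 \<le> K i" if "i \<in> S" for i
    using K_pos[of i] assms(1) that by auto
qed (rule that)


subsection \<open>Chordality\<close>

lemma complement_edge_iff:
  "{u, v} \<in> edges (graph_complement G) \<longleftrightarrow>
     u \<in> verts G \<and> v \<in> verts G \<and> u \<noteq> v \<and> supp u \<inter> supp v \<noteq> {}"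
  unfolding graph_complement_def by (auto simp: edge_iff)

text \<open>
  A vertex whose support meets two disjoint supports has at least two points in its own. On a
  long induced cycle of the complement graph this applies to two vertices with disjoint
  supports, which therefore need four coordinates. Conversely, the pairs of cyclically
  consecutive coordinates out of four form an induced four-cycle.
\<close>

lemma chordal_complement_iff: "chordal (graph_complement G) \<longleftrightarrow> n \<le> 3"
proof
  assume n: "n \<le> 3"
  show "chordal (graph_complement G)"
  proof (rule ccontr)
    assume "\<not> chordal (graph_complement G)"
    then obtain z a b c d where V: "{z, a, b, c, d} \<subseteq> verts (graph_complement G)"
      and E: "{z, a} \<in> edges (graph_complement G)" "{a, b} \<in> edges (graph_complement G)"
        "{b, c} \<in> edges (graph_complement G)" "{c, d} \<in> edges (graph_complement G)"
      and N: "{z, b} \<notin> edges (graph_complement G)" "{a, c} \<notin> edges (graph_complement G)"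
        "{b, d} \<notin> edges (graph_complement G)" "z \<noteq> b" "a \<noteq> c" "b \<noteq> d"
      by (rule not_chordalE)
    have two: "card (supp x) \<ge> 2"
      if meet: "supp x \<inter> supp y \<noteq> {}" "supp x \<inter> supp w \<noteq> {}" "supp y \<inter> supp w = {}" for x y w
    proof -
      obtain i where i: "i \<in> supp x \<inter> supp y" using meet(1) by blast
      obtain j where j: "j \<in> supp x \<inter> supp w" using meet(2) by blast
      note ij = i j
      with meet(3) have "i \<noteq> j" by auto
      with ij have "card {i, j} = 2" "{i, j} \<subseteq> supp x" by auto
      then show ?thesis using card_mono[of "supp x" "{i, j}"] by simp
    qed
    have disj: "supp z \<inter> supp b = {}" "supp a \<inter> supp c = {}" "supp b \<inter> supp d = {}"
      using N V complement_edge_iff[of z b] complement_edge_iff[of a c] complement_edge_iff[of b d]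
      by (auto simp: graph_complement_def)
    have "card (supp a) \<ge> 2" "card (supp c) \<ge> 2"
      using E disj by (auto simp: complement_edge_iff Int_commute intro: two[of a z b] two[of c b d])
    moreover have "card (supp a) + card (supp c) = card (supp a \<union> supp c)"
      using disj(2) by (simp add: card_Un_disjoint)
    moreover have "card (supp a \<union> supp c) \<le> card {..<n}"
      using supp_subset[of a] supp_subset[of c] by (intro card_mono) auto
    ultimately show False using n by simp
  qed
next
  assume ch: "chordal (graph_complement G)"
  show "n \<le> 3"
  proof (rule ccontr)
    assume "\<not> n \<le> 3"
    then have n: "n \<ge> 4" by simp
    have ex: "\<exists>u\<in>verts G. supp u = {i, j}" if ij: "i < 4" "j < 4" for i j
    proof -
      obtain k where "k < 4" "k \<notin> {i, j}"
      proof -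
        have "\<not> {..<4} \<subseteq> {i, j}"
        proof
          assume "{..<4} \<subseteq> {i, j}"
          then have "card {..<4 :: nat} \<le> card {i, j}" by (intro card_mono) auto
          then show False by (simp add: card_insert_if split: if_splits)
        qed
        then show thesis using that by auto
      qed
      then show ?thesis
        using vertex_of_supp[of "{i, j}" k] ij n by auto
    qed
    obtain a where a: "a \<in> verts G" "supp a = {0, 1}" using ex[of 0 1] by auto
    obtain b where b: "b \<in> verts G" "supp b = {1, 2}" using ex[of 1 2] by auto
    obtain c where c: "c \<in> verts G" "supp c = {2, 3}" using ex[of 2 3] by auto
    obtain d where d: "d \<in> verts G" "supp d = {3, 0}" using ex[of 3 0] by auto
    have ne: "a \<noteq> b" "b \<noteq> c" "c \<noteq> d" "d \<noteq> a" "a \<noteq> c" "b \<noteq> d"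
      using a b c d by (auto simp: doubleton_eq_iff)
    have "\<not> chordal (graph_complement G)"
      by (rule not_chordal_if_induced_four_cycle[OF simple_graph_complement, of a b _ c d])
        (simp_all add: complement_edge_iff a b c d ne)
    with ch show False by simp
  qed
qed

text \<open>
  The obstructions to chordality: on both sides of a partition of the coordinates there are
  two different vertices whose supports meet.
\<close>

lemma not_chordal_if_square:
  assumes "{a, b, c, d} \<subseteq> verts G" "a \<noteq> c" "b \<noteq> d"
    and "supp a \<inter> supp c \<noteq> {}" "supp b \<inter> supp d \<noteq> {}"
    and "(supp a \<union> supp c) \<inter> (supp b \<union> supp d) = {}"
  shows "\<not> chordal G"
proof -
  have "supp a \<inter> supp b = {}" "supp b \<inter> supp c = {}" "supp c \<inter> supp d = {}" "supp d \<inter> supp a = {}"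
    using assms(6) by blast+
  then show ?thesis
    by (intro not_chordal_if_induced_four_cycle[OF simple, of a b c d])
      (use assms(1-5) in \<open>simp_all add: edge_iff\<close>)
qed

lemma two_vertices_of_supp:
  assumes "i < n" "K i \<ge> 2" "n \<ge> 2"
  obtains u v where "u \<in> verts G" "v \<in> verts G" "supp u = {i}" "supp v = {i}" "u \<noteq> v"
proof -
  have "{i} \<noteq> {..<n}"
  proof
    assume "{i} = {..<n}"
    then have "card {..<n} = card {i}" by simp
    with assms(3) show False by simp
  qed
  then have ex: "\<exists>u\<in>verts G. supp u = {i} \<and> \<phi> u i = k" if "1 \<le> k" "k \<le> K i" for k
    using vertex_of_type[of "{i}" "\<lambda>_. k"] assms(1) that by auto
  obtain u where u: "u \<in> verts G" "supp u = {i}" "\<phi> u i = 1"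
    using ex[of 1] assms(2) by auto
  obtain v where v: "v \<in> verts G" "supp v = {i}" "\<phi> v i = 2"
    using ex[of 2] assms(2) by auto
  show thesis
    by (rule that[OF u(1) v(1) u(2) v(2)]) (use u v in auto)
qed

text \<open>
  For three coordinates with all \<open>K i = 1\<close> a vertex is determined by its support. A vertex on a
  long induced cycle has two neighbours, whose supports differ and leave it only one point;
  but two different one-point supports are disjoint, so that vertices at distance two on the
  cycle would be adjacent.
\<close>

lemma chordal_iff:
  "chordal G \<longleftrightarrow> n = 1 \<or> n = 2 \<and> (\<exists>i<n. K i = 1) \<or> n = 3 \<and> (\<forall>i<n. K i = 1)"
proof
  assume ch: "chordal G"
  show "n = 1 \<or> n = 2 \<and> (\<exists>i<n. K i = 1) \<or> n = 3 \<and> (\<forall>i<n. K i = 1)"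
  proof (rule ccontr)
    assume neg: "\<not> ?thesis"
    consider "n = 2" "K 0 \<ge> 2" "K 1 \<ge> 2" | i where "n = 3" "i < 3" "K i \<ge> 2" | "n \<ge> 4"
    proof -
      have K: "K i = 1 \<or> K i \<ge> 2" if "i < n" for i
        using K_pos[OF that] by linarith
      have "n = 2 \<or> n = 3 \<or> n \<ge> 4"
        using neg n_pos by linarith
      then consider "n = 2" | "n = 3" | "n \<ge> 4" by blast
      then show thesis
      proof cases
        case 1
        with neg K[of 0] K[of 1] show thesis by (intro that(1)) auto
      next
        case 2
        with neg obtain i where "i < 3" "K i \<noteq> 1" by auto
        with 2 K[of i] show thesis by (intro that(2)) auto
      qed (rule that(3))
    qed
    then show False
    proof cases
      case 1
      obtain a c where "a \<in> verts G" "c \<in> verts G" "supp a = {0}" "supp c = {0}" "a \<noteq> c"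
        using two_vertices_of_supp[of 0] 1 by auto
      moreover obtain b d where "b \<in> verts G" "d \<in> verts G" "supp b = {1}" "supp d = {1}" "b \<noteq> d"
        using two_vertices_of_supp[of 1] 1 by auto
      ultimately show False
        using not_chordal_if_square[of a b c d] ch by auto
    next
      case 2
      obtain a c where ac: "a \<in> verts G" "c \<in> verts G" "supp a = {i}" "supp c = {i}" "a \<noteq> c"
        using two_vertices_of_supp[of i] 2 by auto
      obtain j k where jk: "j < 3" "k < 3" "j \<noteq> i" "k \<noteq> i" "j \<noteq> k"
      proof (rule that[of "(i + 1) mod 3" "(i + 2) mod 3"])
        have "i = 0 \<or> i = 1 \<or> i = 2" using 2(2) by auto
        then show "(i + 1) mod 3 \<noteq> i" "(i + 2) mod 3 \<noteq> i" "(i + 1) mod 3 \<noteq> (i + 2) mod 3"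
          by (elim disjE; simp)+
      qed simp_all
      obtain b where b: "b \<in> verts G" "supp b = {j}"
        by (rule vertex_of_supp[of "{j}" i]) (use jk 2 in auto)
      obtain d where d: "d \<in> verts G" "supp d = {j, k}"
        by (rule vertex_of_supp[of "{j, k}" i]) (use jk 2 in auto)
      have "b \<noteq> d" using b d jk by auto
      then show False
        using not_chordal_if_square[of a b c d] ac b d jk ch by auto
    next
      case 3
      have ex: "\<exists>u\<in>verts G. supp u = S" if S: "S \<subseteq> {..<4}" "S \<noteq> {}" "k < 4" "k \<notin> S" for S k
      proof -
        have "S \<subseteq> {..<n}" "k < n" using S 3 by auto
        then show ?thesis by (meson vertex_of_supp S(2,4))
      qed
      obtain a where a: "a \<in> verts G" "supp a = {0}"
        using ex[of "{0}" 1] by auto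
      obtain b where b: "b \<in> verts G" "supp b = {2}"
        using ex[of "{2}" 0] by auto
      obtain c where c: "c \<in> verts G" "supp c = {0, 1}"
        using ex[of "{0, 1}" 2] by auto
      obtain d where d: "d \<in> verts G" "supp d = {2, 3}"
        using ex[of "{2, 3}" 0] by auto
      have "a \<noteq> c" "b \<noteq> d" using a b c d by auto
      then show False
        using not_chordal_if_square[of a b c d] a b c d ch by auto
    qed
  qed
next
  assume n: "n = 1 \<or> n = 2 \<and> (\<exists>i<n. K i = 1) \<or> n = 3 \<and> (\<forall>i<n. K i = 1)"
  have unique: "u = v" if "u \<in> verts G" "v \<in> verts G" "supp u = supp v" "\<forall>i\<in>supp u. K i = 1" for u v
  proof (rule vertex_eqI[OF that(1,2)])
    fix i assume i: "i < n"
    show "\<phi> u i = \<phi> v i"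
    proof (cases "i \<in> supp u")
      case True
      then have "i \<in> supp v" "K i = 1" using that by auto
      with True have "\<phi> u i = 1" "\<phi> v i = 1"
        using coord_le[OF that(1) i] coord_le[OF that(2) i] by (auto simp: supp_def)
      then show ?thesis by simp
    next
      case False
      then have "i \<notin> supp v" using that(3) by simp
      with False i show ?thesis by (simp add: supp_def)
    qed
  qed
  show "chordal G"
  proof (rule ccontr)
    assume "\<not> chordal G"
    then obtain z a b c d where V: "{z, a, b, c, d} \<subseteq> verts G"
      and E: "{z, a} \<in> edges G" "{a, b} \<in> edges G" "{b, c} \<in> edges G" "{c, d} \<in> edges G"
      and N: "{z, b} \<notin> edges G" "{a, c} \<notin> edges G" "{b, d} \<notin> edges G" "z \<noteq> b" "a \<noteq> c" "b \<noteq> d"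
      by (rule not_chordalE)
    have meet: "supp a \<inter> supp c \<noteq> {}" "supp b \<inter> supp d \<noteq> {}"
      using N V by (auto simp: edge_iff)
    have disj: "supp z \<inter> supp a = {}" "supp a \<inter> supp b = {}" "supp b \<inter> supp c = {}"
        "supp c \<inter> supp d = {}"
      using E by (auto simp: edge_iff)
    have ne: "supp z \<noteq> {}" "supp a \<noteq> {}" "supp b \<noteq> {}" "supp c \<noteq> {}" "supp d \<noteq> {}"
      using V supp_nonempty by auto
    have card_disj: "card S + card T \<le> n" if "S \<inter> T = {}" "S \<subseteq> {..<n}" "T \<subseteq> {..<n}" for S T
      using card_mono[of "{..<n}" "S \<union> T"] that
      by (simp add: card_Un_disjoint finite_subset[of _ "{..<n}"])
    have pos: "card (supp u) \<ge> 1" if "supp u \<noteq> {}" for u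
      using that by (simp add: Suc_le_eq card_gt_0_iff)
    consider "n = 1" | i where "n = 2" "i < n" "K i = 1" | "n = 3" "\<forall>i<n. K i = 1"
      using n by blast
    then show False
    proof cases
      case 1
      then show False
        using card_disj[OF disj(2) supp_subset supp_subset] pos[of a] pos[of b] ne by simp
    next
      case 2
      have one: "card (supp a) = 1" "card (supp b) = 1" "card (supp c) = 1" "card (supp d) = 1"
        using card_disj[OF disj(2) supp_subset supp_subset]
          card_disj[OF disj(4) supp_subset supp_subset] pos[of a] pos[of b] pos[of c] pos[of d]
          ne 2 by auto
      then obtain i1 i2 i3 i4 where s: "supp a = {i1}" "supp b = {i2}" "supp c = {i3}" "supp d = {i4}"
        by (metis card_1_singletonE)
      with meet have s': "supp c = {i1}" "supp d = {i2}" by auto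
      have "i1 \<noteq> i2" "i1 < 2" "i2 < 2"
        using disj(2) s supp_subset[of a] supp_subset[of b] 2 by auto
      then have "i = i1 \<or> i = i2" using 2 by auto
      then have "a = c \<or> b = d"
        using unique[of a c] unique[of b d] V s s' 2 by auto
      with N show False by simp
    next
      case 3
      have one: "card (supp x) = 1"
        if "supp y \<noteq> supp w" "supp x \<inter> supp y = {}" "supp x \<inter> supp w = {}"
          "supp x \<noteq> {}" "supp y \<noteq> {}" "supp w \<noteq> {}" for x y w
      proof -
        have "card (supp y \<union> supp w) \<noteq> 1"
        proof
          assume "card (supp y \<union> supp w) = 1"
          then obtain i where i: "supp y \<union> supp w = {i}" by (rule card_1_singletonE)
          then have "supp y = {i}" "supp w = {i}" using that by auto
          with that(1) show False by simp
        qed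
        moreover have "card (supp y) \<le> card (supp y \<union> supp w)" by (intro card_mono) auto
        ultimately have "card (supp y \<union> supp w) \<ge> 2"
          using pos[OF that(5)] by linarith
        moreover have "card (supp x) + card (supp y \<union> supp w) \<le> n"
          using that(2,3) supp_subset by (intro card_disj) auto
        ultimately show ?thesis
          using pos[OF that(4)] 3(1) by linarith
      qed
      have uniq: "supp u \<noteq> supp v" if "u \<in> verts G" "v \<in> verts G" "u \<noteq> v" for u v
        using unique[OF that(1,2)] that(3) 3 supp_subset by blast
      have "card (supp a) = 1" "card (supp c) = 1"
        using one[of z b a] one[of b d c] uniq[of z b] uniq[of b d] disj ne N V
        by (auto simp: Int_commute)
      then obtain i j where "supp a = {i}" "supp c = {j}"
        by (metis card_1_singletonE)
      with meet have "supp a = supp c" by auto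
      with uniq[of a c] N V show False by auto
    qed
  qed
qed

end


context disjointness_graph
begin

subsection \<open>Perfection\<close>

text \<open>
  The five pairs of cyclically consecutive coordinates, visited in steps of two, form an
  induced five-cycle.
\<close>

lemma not_perfect:
  assumes n: "n \<ge> 5"
  shows "\<not> perfect_graph G"
proof -
  have ex: "\<exists>u\<in>verts G. supp u = {i, j}" if ij: "k < 5" "k \<notin> {i, j}" "i < 5" "j < 5" for i j k
    using vertex_of_supp[of "{i, j}" k] ij n by auto
  obtain a where a: "a \<in> verts G" "supp a = {0, 1}" using ex[of 2 0 1] by auto
  obtain b where b: "b \<in> verts G" "supp b = {2, 3}" using ex[of 0 2 3] by auto
  obtain c where c: "c \<in> verts G" "supp c = {4, 0}" using ex[of 1 4 0] by auto
  obtain d where d: "d \<in> verts G" "supp d = {1, 2}" using ex[of 0 1 2] by auto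
  obtain e where e: "e \<in> verts G" "supp e = {3, 4}" using ex[of 0 3 4] by auto
  let ?vs = "[a, b, c, d, e]"
  have dist: "distinct ?vs"
    using a b c d e by (auto simp: doubleton_eq_iff)
  have E: "{?vs ! i, ?vs ! j} \<in> edges G \<longleftrightarrow> j = Suc i mod 5 \<or> i = Suc j mod 5"
    if "i < 5" "j < 5" for i j
  proof -
    have "i = 0 \<or> i = 1 \<or> i = 2 \<or> i = 3 \<or> i = 4" "j = 0 \<or> j = 1 \<or> j = 2 \<or> j = 3 \<or> j = 4"
      using that by auto
    then show ?thesis
      by (elim disjE; simp only: edge_iff; simp add: a b c d e)
  qed
  show ?thesis
    by (rule not_perfect_if_induced_five_cycle[OF simple _ dist _ E]) (use a b c d e in auto)
qed

text \<open>
  The points that occur as singleton supports are pairwise disjoint and give a clique; each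
  of them serves as a colour for the vertices whose support contains it. The remaining
  vertices have supports of at least two points that avoid these colours. Inside four
  points, two such supports can only be disjoint if they are complementary pairs, and then
  there were no singletons and two colours suffice.
\<close>

lemma perfect:
  assumes n: "n \<le> 4"
  shows "perfect_graph G"
  unfolding perfect_graph_def
proof (intro conjI allI impI finite_verts)
  fix W assume W: "W \<subseteq> verts G"
  define H where "H = induced_subgraph G W"
  have vH: "verts H = W" by (simp add: H_def induced_subgraph_def)
  have H: "simple_graph H" "finite (verts H)"
    unfolding vH using simple_induced_subgraph[OF simple] finite_subset[OF W finite_verts]
    by (simp_all add: H_def)
  have eH: "{u, v} \<in> edges H \<longleftrightarrow> u \<in> W \<and> v \<in> W \<and> supp u \<inter> supp v = {}" for u v
    using W edge_iff[of u v] by (auto simp: H_def induced_subgraph_def)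
  have supp_n: "i < n" if "i \<in> supp u" for i u
    using that by (simp add: supp_def)
  define A where "A = {i. \<exists>u\<in>W. supp u = {i}}"
  have finA: "finite A" and A_n: "A \<subseteq> {..<n}"
    using supp_n by (auto simp: A_def intro!: finite_subset[of _ "{..<n}"])
  define B where "B = {w \<in> W. supp w \<inter> A = {}}"
  have B2: "card (supp w) \<ge> 2" if "w \<in> B" for w
  proof -
    have "supp w \<noteq> {}" using that W supp_nonempty by (auto simp: B_def)
    then have "card (supp w) \<noteq> 0" by simp
    moreover have "card (supp w) \<noteq> 1"
    proof
      assume "card (supp w) = 1"
      then obtain i where "supp w = {i}" by (rule card_1_singletonE)
      with that show False by (auto simp: A_def B_def)
    qed
    ultimately show ?thesis by linarith
  qed
  have "\<forall>i\<in>A. \<exists>u. u \<in> W \<and> supp u = {i}" by (auto simp: A_def)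
  from bchoice[OF this] obtain r where "\<forall>i\<in>A. r i \<in> W \<and> supp (r i) = {i}" by blast
  then have r: "r i \<in> W" "supp (r i) = {i}" if "i \<in> A" for i
    using that by simp_all
  have inj_r: "inj_on r A"
  proof (rule inj_onI)
    fix x y assume xy: "x \<in> A" "y \<in> A" "r x = r y"
    have "{x} = {y}"
      using r(2)[OF xy(1)] r(2)[OF xy(2)] xy(3) by argo
    then show "x = y" by simp
  qed
  obtain h where h: "bij_betw h A {0..<card A}"
    using ex_bij_betw_finite_nat[OF finA] by blast
  show "chromatic_number (induced_subgraph G W) = clique_number (induced_subgraph G W)"
    unfolding H_def[symmetric]
  proof (cases "\<forall>b\<in>B. \<forall>b'\<in>B. supp b \<inter> supp b' \<noteq> {}")
    case True
    define k where "k = card A + (if B = {} then 0 else 1)"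
    define c where "c u = (if supp u \<inter> A = {} then card A else h (Min (supp u \<inter> A)))" for u
    have Min: "Min (supp u \<inter> A) \<in> supp u \<inter> A" if "supp u \<inter> A \<noteq> {}" for u
      using that finA by (intro Min_in) auto
    have h_less: "h i < card A" if "i \<in> A" for i
      using h that by (auto simp: bij_betw_def)
    have "vertex_coloring H k c"
      unfolding vertex_coloring_def vH
    proof (intro conjI allI impI)
      show "c \<in> W \<rightarrow> {..<k}"
      proof
        fix u assume u: "u \<in> W"
        show "c u \<in> {..<k}"
        proof (cases "supp u \<inter> A = {}")
          case True
          with u have "B \<noteq> {}" by (auto simp: B_def)
          with True show ?thesis by (simp add: c_def k_def)
        next
          case False
          with Min have "h (Min (supp u \<inter> A)) < card A" by (intro h_less) blast
          with False show ?thesis by (simp add: c_def k_def)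
        qed
      qed
      fix u v assume uv: "{u, v} \<in> edges H"
      then have uv': "u \<in> W" "v \<in> W" "supp u \<inter> supp v = {}" by (auto simp: eH)
      show "c u \<noteq> c v"
      proof (cases "supp u \<inter> A = {}"; cases "supp v \<inter> A = {}")
        assume "supp u \<inter> A = {}" "supp v \<inter> A = {}"
        then have "u \<in> B" "v \<in> B" using uv' by (auto simp: B_def)
        with True uv' show ?thesis by blast
      next
        assume A: "supp u \<inter> A = {}" "supp v \<inter> A \<noteq> {}"
        then have "h (Min (supp v \<inter> A)) < card A" using Min h_less by blast
        with A show ?thesis by (simp add: c_def)
      next
        assume A: "supp u \<inter> A \<noteq> {}" "supp v \<inter> A = {}"
        then have "h (Min (supp u \<inter> A)) < card A" using Min h_less by blast
        with A show ?thesis by (simp add: c_def)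
      next
        assume A: "supp u \<inter> A \<noteq> {}" "supp v \<inter> A \<noteq> {}"
        then have "Min (supp u \<inter> A) \<noteq> Min (supp v \<inter> A)"
          using Min[of u] Min[of v] uv'(3) by (metis IntD1 IntI empty_iff)
        then have "h (Min (supp u \<inter> A)) \<noteq> h (Min (supp v \<inter> A))"
          using Min[OF A(1)] Min[OF A(2)] h unfolding bij_betw_def inj_on_def by blast
        with A show ?thesis by (simp add: c_def)
      qed
    qed
    moreover have "\<exists>Q\<subseteq>W. clique Q (edges H) \<and> card Q = k"
    proof (cases "B = {}")
      case True
      show ?thesis
        by (rule exI[of _ "r ` A"])
          (use True r inj_r in \<open>auto simp: clique_def eH k_def card_image\<close>)
    next
      case False
      then obtain b where b: "b \<in> B" by blast
      then have bA: "supp b \<inter> A = {}" and bW: "b \<in> W" by (auto simp: B_def)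
      have new: "b \<notin> r ` A"
        using bA r by auto
      have disj: "supp b \<inter> supp (r i) = {}" "supp (r i) \<inter> supp b = {}" if "i \<in> A" for i
        using r[OF that] bA that by auto
      show ?thesis
      proof (intro exI[of _ "insert b (r ` A)"] conjI)
        show "clique (insert b (r ` A)) (edges H)"
          using r disj bW by (auto simp: clique_def eH)
        show "card (insert b (r ` A)) = k"
          using new finA False inj_r by (simp add: k_def card_image)
      qed (use r bW in auto)
    qed
    ultimately show "chromatic_number H = clique_number H"
      using chromatic_eq_clique_numberI[OF H] vH by blast
  next
    case False
    then obtain b b' where b: "b \<in> B" "b' \<in> B" "supp b \<inter> supp b' = {}" by blast
    have all: "supp x \<union> supp y = {..<n}" and noA: "A = {}"
      if xy: "x \<in> B" "y \<in> B" "supp x \<inter> supp y = {}" for x y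
    proof -
      have U: "card (supp x \<union> supp y) = card (supp x) + card (supp y)"
        using xy(3) by (simp add: card_Un_disjoint)
      have "(supp x \<union> supp y) \<inter> A = {}" using xy by (auto simp: B_def)
      then have "card (supp x \<union> supp y \<union> A) = card (supp x \<union> supp y) + card A"
        using finA by (simp add: card_Un_disjoint)
      moreover have "card (supp x \<union> supp y \<union> A) \<le> card {..<n}"
        using A_n supp_subset by (intro card_mono) auto
      ultimately have "card A = 0" "n = 4" "card (supp x \<union> supp y) = card {..<n}"
        using U B2[OF xy(1)] B2[OF xy(2)] n by auto
      then show "A = {}" "supp x \<union> supp y = {..<n}"
        using finA card_subset_eq[of "{..<n}" "supp x \<union> supp y"] supp_subset by auto
    qed
    have WB: "W = B" using noA[OF b] by (auto simp: B_def)
    have "vertex_coloring H 2 (\<lambda>u. if 0 \<in> supp u then 0 else 1)"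
      unfolding vertex_coloring_def
    proof (intro conjI allI impI)
      fix u v assume "{u, v} \<in> edges H"
      then have uv: "u \<in> B" "v \<in> B" "supp u \<inter> supp v = {}" by (auto simp: eH WB)
      have "0 \<in> supp u \<union> supp v" using all[OF uv] n_pos by auto
      with uv(3) show "(if 0 \<in> supp u then 0 else 1) \<noteq> (if 0 \<in> supp v then 0 else (1::nat))"
        by auto
    qed auto
    moreover have "b \<noteq> b'" using b B2[of b] by auto
    then have "clique {b, b'} (edges H)" "card {b, b'} = 2" "{b, b'} \<subseteq> verts H"
      using b by (auto simp: clique_def eH vH WB Int_commute)
    ultimately show "chromatic_number H = clique_number H"
      using chromatic_eq_clique_numberI[OF H] by blast
  qed
qed

lemma perfect_iff: "perfect_graph G \<longleftrightarrow> n \<le> 4"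
proof
  assume "perfect_graph G"
  with not_perfect show "n \<le> 4" by linarith
qed (rule perfect)


subsection \<open>Degrees\<close>

text \<open>
  The neighbours of \<open>u\<close> are the nonzero vectors supported off \<open>supp u\<close>; the vector \<open>f\<close> is never
  one of them, and the zero vector accounts for the difference of one.
\<close>

lemma vertex_degree_plus_one:
  assumes u: "u \<in> verts G"
  shows "vertex_degree G u + 1 = (\<Prod>j\<in>{..<n} - supp u. K j + 1)"
proof -
  define T where "T = {..<n} - supp u"
  let ?P = "\<Pi>\<^sub>E j\<in>T. {..K j}" and ?z = "\<lambda>j\<in>T. 0 :: nat"
  have nbr: "v \<in> neighbours G u \<longleftrightarrow> v \<in> verts G \<and> supp v \<subseteq> T" for v
    using u supp_subset[of v] by (auto simp: neighbours_def edge_iff T_def)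
  have "bij_betw (\<lambda>v. restrict (\<phi> v) T) (neighbours G u) (?P - {?z})"
    unfolding bij_betw_def
  proof (intro conjI inj_onI equalityI subsetI)
    fix v w assume vw: "v \<in> neighbours G u" "w \<in> neighbours G u"
      "restrict (\<phi> v) T = restrict (\<phi> w) T"
    have "\<phi> v i = \<phi> w i" if "i < n" for i
    proof (cases "i \<in> T")
      case True
      with vw(3) show ?thesis by (metis restrict_apply')
    next
      case False
      then have "i \<notin> supp v" "i \<notin> supp w" using vw nbr by auto
      with that show ?thesis by (simp add: supp_def)
    qed
    with vw nbr show "v = w" by (intro vertex_eqI) auto
  next
    fix y assume "y \<in> (\<lambda>v. restrict (\<phi> v) T) ` neighbours G u"
    then obtain v where v: "v \<in> verts G" "supp v \<subseteq> T" "y = restrict (\<phi> v) T"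
      using nbr by auto
    obtain i where i: "i \<in> supp v" using supp_nonempty[OF v(1)] by blast
    with v have "y i \<noteq> ?z i" by (auto simp: supp_def)
    then have "y \<noteq> ?z" by auto
    moreover have "y \<in> ?P" using v coord_le[OF v(1)] by (auto simp: T_def)
    ultimately show "y \<in> ?P - {?z}" by blast
  next
    fix y assume y: "y \<in> ?P - {?z}"
    have "\<exists>i\<in>T. y i \<noteq> 0"
    proof (rule ccontr)
      assume "\<not> ?thesis"
      then have "y = ?z" using y by (intro PiE_ext[of y T _ ?z]) auto
      with y show False by simp
    qed
    then have pos: "\<exists>i<n. (if i \<in> T then y i else 0) \<noteq> 0" by (auto simp: T_def)
    obtain k where "k \<in> supp u" using supp_nonempty[OF u] by blast
    then have "k < n" "k \<notin> T" by (auto simp: supp_def T_def)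
    then have ne: "\<exists>i<n. (if i \<in> T then y i else 0) \<noteq> f i"
      using f_nonzero by fastforce
    have le: "(if i \<in> T then y i else 0) \<le> K i" if "i < n" for i
      using y by (auto simp: PiE_iff)
    obtain v where v: "v \<in> verts G" "\<forall>i<n. \<phi> v i = (if i \<in> T then y i else 0)"
      "supp v = {i. i < n \<and> (if i \<in> T then y i else 0) \<noteq> 0}"
      by (rule vertex_exists[OF le pos ne])
    have "y = restrict (\<phi> v) T"
      by (rule PiE_ext[of _ T "\<lambda>j. {..K j}"])
        (use y v coord_le[OF v(1)] in \<open>auto simp: T_def\<close>)
    moreover have "supp v \<subseteq> T" using v(3) by (auto split: if_splits)
    ultimately show "y \<in> (\<lambda>v. restrict (\<phi> v) T) ` neighbours G u"
      using nbr v(1) by blast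
  qed
  then have "vertex_degree G u = card (?P - {?z})"
    unfolding vertex_degree_eq_card_neighbours[OF simple] by (rule bij_betw_same_card)
  moreover have finT: "finite T" by (simp add: T_def)
  then have P: "finite ?P" "card ?P = (\<Prod>j\<in>T. K j + 1)" "?z \<in> ?P"
    by (auto simp: finite_PiE card_PiE)
  moreover have "card ?P > 0" using P card_gt_0_iff by blast
  ultimately show ?thesis
    unfolding T_def by (simp add: card_Diff_singleton)
qed


subsection \<open>Total colouring of the complement\<close>

text \<open>
  Unless all \<open>K i\<close> are \<open>1\<close>, some vertex has full support and dominates the complement graph.
  Otherwise complementary supports match the vertices in pairs, and these pairs are
  non-edges of the complement graph. If partners are labelled \<open>i\<close> and \<open>i + h\<close> modulo the
  number \<open>2 h\<close> of vertices, then doubling only identifies partners.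
\<close>

lemma total_coloring_complement: "total_coloring_conjecture (graph_complement G)"
proof (cases "\<exists>i<n. K i \<ge> 2")
  case True
  then obtain i where i: "i < n" "K i \<ge> 2" by blast
  define x where "x = f(i := (if f i = 1 then 2 else 1))"
  have f_le: "f j \<le> K j" if "j < n" for j
    using PiE_mem[OF f, of j] that by auto
  obtain u where u: "u \<in> verts G" "supp u = {j. j < n \<and> x j \<noteq> 0}"
    by (rule vertex_exists[of x]) (use i f_le f_nonzero in \<open>auto simp: x_def\<close>)
  then have full: "supp u = {..<n}"
    using f_nonzero by (auto simp: x_def)
  have "vertex_degree G u = 0"
    using vertex_degree_plus_one[OF u(1)] by (simp add: full)
  then have "vertex_degree (graph_complement G) u = card (verts G) - 1"
    using vertex_degree_complement[OF simple finite_verts u(1)] by simp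
  then have "card (verts (graph_complement G)) \<le> max_degree (graph_complement G) + 1"
    using vertex_degree_le_max_degree[of "graph_complement G" u] u(1) finite_verts
    by (simp add: graph_complement_def)
  then show ?thesis
    by (intro total_coloring_conjecture_if_dominating simple_graph_complement)
      (simp_all add: graph_complement_def finite_verts)
next
  case False
  then have K1: "K i = 1" if "i < n" for i
    using K_pos[OF that] that by fastforce
  have f1: "f i = 1" if "i < n" for i
    using PiE_mem[OF f, of i] that K1 by auto
  have bit: "\<phi> u i = 0 \<or> \<phi> u i = 1" if "u \<in> verts G" "i < n" for u i
    using coord_le[OF that] K1[OF that(2)] by linarith
  have f_PiE: "f \<in> (\<Pi>\<^sub>E i\<in>{..<n}. {..K i})"
    using f by (auto simp: PiE_iff)
  have supp_inj: "u = v" if uv: "u \<in> verts G" "v \<in> verts G" "supp u = supp v" for u v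
  proof (rule vertex_eqI[OF uv(1,2)])
    fix i assume i: "i < n"
    have "i \<in> supp u \<longleftrightarrow> i \<in> supp v" using uv(3) by simp
    with i bit[OF uv(1) i] bit[OF uv(2) i] show "\<phi> u i = \<phi> v i" by (auto simp: supp_def)
  qed
  have "\<exists>v. v \<in> verts G \<and> supp v = {..<n} - supp u" if u: "u \<in> verts G" for u
  proof -
    have "supp u \<noteq> {..<n}"
    proof
      assume eq: "supp u = {..<n}"
      have "\<phi> u = f"
      proof (rule PiE_ext[of _ "{..<n}" "\<lambda>i. {..K i}"])
        fix i assume "i \<in> {..<n}"
        then have "i < n" "i \<in> supp u" using eq by auto
        with bit[OF u, of i] f1[of i] show "\<phi> u i = f i" by (simp add: supp_def)
      qed (use bij_betwE[OF \<phi>] u f_PiE in auto)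
      with bij_betwE[OF \<phi>] u show False by blast
    qed
    then have ne: "{..<n} - supp u \<noteq> {}" using supp_subset[of u] by blast
    obtain k where k: "k \<in> supp u" using supp_nonempty[OF u] by blast
    then have "k < n" "k \<notin> {..<n} - supp u" using supp_subset[of u] by auto
    from vertex_of_supp[OF Diff_subset ne this] show ?thesis by blast
  qed
  then have "\<forall>u\<in>verts G. \<exists>v. v \<in> verts G \<and> supp v = {..<n} - supp u" by blast
  from bchoice[OF this] obtain opp
    where "\<forall>u\<in>verts G. opp u \<in> verts G \<and> supp (opp u) = {..<n} - supp u" by blast
  then have opp: "opp u \<in> verts G" "supp (opp u) = {..<n} - supp u" if "u \<in> verts G" for u
    using that by simp_all
  have opp_opp: "opp (opp u) = u" if u: "u \<in> verts G" for u
    using opp[OF u] opp[OF opp(1)[OF u]] supp_subset[of u] u by (intro supp_inj) auto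
  define V0 where "V0 = {u \<in> verts G. 0 \<in> supp u}"
  define h where "h = card V0"
  have finV0: "finite V0" using finite_verts by (simp add: V0_def)
  have opp0: "opp u \<in> V0 \<longleftrightarrow> u \<notin> V0" if "u \<in> verts G" for u
    using opp[OF that] that n_pos by (auto simp: V0_def)
  have "bij_betw opp V0 (verts G - V0)"
    by (rule bij_betwI[of _ _ _ opp]) (use opp opp0 opp_opp in \<open>auto simp: V0_def\<close>)
  then have "card (verts G - V0) = h"
    using bij_betw_same_card h_def by metis
  then have N: "card (verts G) = 2 * h"
    using card_Diff_subset[OF finV0, of "verts G"] card_mono[OF finite_verts, of V0]
    by (auto simp: h_def V0_def)
  obtain \<theta> where "bij_betw \<theta> V0 {0..<h}"
    using ex_bij_betw_finite_nat[OF finV0] h_def by blast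
  then have \<theta>: "\<theta> u < h" "\<theta> u = \<theta> v \<longleftrightarrow> u = v" if "u \<in> V0" "v \<in> V0" for u v
    using that by (auto simp: bij_betw_def inj_on_def)
  define \<psi> where "\<psi> u = (if u \<in> V0 then \<theta> u else \<theta> (opp u) + h)" for u
  have \<psi>_less: "\<psi> u < 2 * h" if "u \<in> verts G" for u
  proof (cases "u \<in> V0")
    case True
    with \<theta>(1)[OF True True] show ?thesis by (simp add: \<psi>_def)
  next
    case False
    then have "opp u \<in> V0" using opp0[OF that] by blast
    with False \<theta>(1)[of "opp u" "opp u"] show ?thesis by (simp add: \<psi>_def)
  qed
  have same: "u = v \<or> v = opp u"
    if uv: "u \<in> verts G" "v \<in> verts G" and eq: "(2 * \<psi> u) mod (2 * h) = (2 * \<psi> v) mod (2 * h)" for u v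
  proof -
    have eq': "\<psi> u mod h = \<psi> v mod h"
      using eq by (simp add: mod_mult_mult1)
    show ?thesis
    proof (cases "u \<in> V0"; cases "v \<in> V0")
      assume "u \<in> V0" "v \<in> V0"
      with eq' \<theta>[of u v] \<theta>[of v u] show ?thesis by (simp add: \<psi>_def)
    next
      assume A: "u \<in> V0" "v \<notin> V0"
      then have "opp v \<in> V0" using opp0 uv by blast
      with A eq' \<theta>[of u "opp v"] \<theta>[of "opp v" u] have "u = opp v" by (simp add: \<psi>_def)
      then show ?thesis using opp_opp uv by simp
    next
      assume A: "u \<notin> V0" "v \<in> V0"
      then have "opp u \<in> V0" using opp0 uv by blast
      with A eq' \<theta>[of v "opp u"] \<theta>[of "opp u" v] show ?thesis by (simp add: \<psi>_def)
    next
      assume A: "u \<notin> V0" "v \<notin> V0"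
      then have o: "opp u \<in> V0" "opp v \<in> V0" using opp0 uv by auto
      with A eq' \<theta>[of "opp u" "opp v"] \<theta>[of "opp v" "opp u"] have "opp u = opp v"
        by (simp add: \<psi>_def)
      then show ?thesis using opp_opp uv by metis
    qed
  qed
  show ?thesis
  proof (cases "n \<ge> 2")
    case n2: True
    then have "1 \<in> {..<n} - {0}" by simp
    then have ne: "{..<n} - {0} \<noteq> {}" by (metis empty_iff)
    have "0 \<notin> {..<n} - {0}" by blast
    with n2 have k: "0 < n" "0 \<notin> {..<n} - {0}" by linarith+
    obtain u where u: "u \<in> verts G" "supp u = {..<n} - {0}"
      by (rule vertex_of_supp[OF Diff_subset ne k])
    have "{0} \<subseteq> {..<n}" using n_pos by simp
    then have "{..<n} - supp u = {0}" unfolding u(2) by (rule double_diff) (rule order_refl)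
    then have "vertex_degree G u = 1"
      using vertex_degree_plus_one[OF u(1)] K1[of 0] n_pos by simp
    then have "2 * h \<le> vertex_degree (graph_complement G) u + 2"
      using vertex_degree_complement[OF simple finite_verts u(1)] N by simp
    also have "vertex_degree (graph_complement G) u \<le> max_degree (graph_complement G)"
      using u(1) finite_verts by (intro vertex_degree_le_max_degree) (auto simp: graph_complement_def)
    finally have m: "2 * h \<le> max_degree (graph_complement G) + 2" by simp
    show ?thesis
    proof (rule total_coloring_conjecture_by_sums[OF simple_graph_complement _ m])
      show "inj_on \<psi> (verts (graph_complement G))"
      proof (rule inj_onI)
        fix u v assume uv: "u \<in> verts (graph_complement G)" "v \<in> verts (graph_complement G)" "\<psi> u = \<psi> v"
        then have V: "u \<in> verts G" "v \<in> verts G" by (auto simp: graph_complement_def)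
        show "u = v"
        proof (rule ccontr)
          assume "u \<noteq> v"
          with same[OF V] uv(3) have "v = opp u" by auto
          show False
          proof (cases "u \<in> V0")
            case True
            then have "v \<notin> V0" using opp0[OF V(1)] \<open>v = opp u\<close> by blast
            with True uv(3) have "\<theta> u = \<theta> (opp v) + h" by (simp add: \<psi>_def)
            with \<theta>(1)[OF True True] show False by simp
          next
            case False
            then have v: "v \<in> V0" using opp0[OF V(1)] \<open>v = opp u\<close> by blast
            with False uv(3) have "\<theta> (opp u) + h = \<theta> v" by (simp add: \<psi>_def)
            with \<theta>(1)[OF v v] show False by simp
          qed
        qed
      qed
      fix u v assume "{u, v} \<in> edges (graph_complement G)"
      then have uv: "u \<in> verts G" "v \<in> verts G" "u \<noteq> v" "supp u \<inter> supp v \<noteq> {}"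
        by (auto simp: complement_edge_iff)
      with opp[OF uv(1)] have "v \<noteq> opp u" by auto
      with same[OF uv(1,2)] uv(3) show "(2 * \<psi> u) mod (2 * h) \<noteq> (2 * \<psi> v) mod (2 * h)" by blast
    qed (use finite_verts \<psi>_less in \<open>auto simp: graph_complement_def\<close>)
  next
    case False
    have "verts G = {}"
    proof (rule ccontr)
      assume "verts G \<noteq> {}"
      then obtain u where u: "u \<in> verts G" by blast
      obtain i j where "i \<in> supp u" "j \<in> supp (opp u)"
        using supp_nonempty[OF u] supp_nonempty[OF opp(1)[OF u]] by blast
      then have "i < n" "j < n" "i \<noteq> j"
        using opp(2)[OF u] supp_subset[of u] by auto
      with False show False by linarith
    qed
    then show ?thesis
      by (simp add: total_coloring_conjecture_def graph_complement_def)
  qed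
qed

end


subsection \<open>Colouring edges by differences\<close>

lemma prod_ge_factor:
  fixes g :: "'i \<Rightarrow> nat"
  assumes "finite T" "\<And>j. j \<in> T \<Longrightarrow> 1 \<le> g j" "a \<in> T"
  shows "g a \<le> prod g T"
proof -
  have "1 \<le> prod g (T - {a})"
    using assms by (intro prod_ge_1) auto
  then have "g a * 1 \<le> g a * prod g (T - {a})" by (rule mult_le_mono2)
  then show ?thesis
    using prod.remove[OF assms(1,3), of g] by simp
qed

lemma prod_ge_two_factors:
  fixes g :: "'i \<Rightarrow> nat"
  assumes "finite T" "\<And>j. j \<in> T \<Longrightarrow> 1 \<le> g j" "a \<in> T" "b \<in> T" "a \<noteq> b"
  shows "g a * g b \<le> prod g T"
proof -
  have "g b \<le> prod g (T - {a})"
    using assms by (intro prod_ge_factor) auto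
  then have "g a * g b \<le> g a * prod g (T - {a})" by (rule mult_le_mono2)
  then show ?thesis
    using prod.remove[OF assms(1,3), of g] by simp
qed

lemma mod_shift:
  fixes x a m :: nat
  assumes "x < m" "a < m"
  shows "(x + m - a) mod m = (if a \<le> x then x - a else x + m - a)"
proof (cases "a \<le> x")
  case True
  then have "x + m - a = (x - a) + m" by simp
  then have "(x + m - a) mod m = (x - a) mod m" by (simp only: mod_add_self2)
  with True assms show ?thesis by simp
qed (use assms in simp)


locale minimal_coordinate = disjointness_graph G n K \<phi> f
  for G :: "'v ugraph" and n :: nat and K :: "nat \<Rightarrow> nat" and \<phi> :: "'v \<Rightarrow> nat \<Rightarrow> nat" and f :: "nat \<Rightarrow> nat" +
  fixes p :: nat
  assumes p: "p < n" and K_min: "j < n \<Longrightarrow> K p \<le> K j"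
begin

definition J :: "nat set" where "J = {..<n} - {p}"

definition palette :: "(nat \<Rightarrow> nat) set" where
  "palette = (\<Pi>\<^sub>E j\<in>J. {..K j})"

text \<open>
  Coordinate \<open>p\<close> is eliminated by subtracting it from every other coordinate, modulo the
  size of the latter. Since \<open>K p\<close> is minimal, a difference still determines \<open>x p\<close> once a
  single other coordinate of \<open>x\<close> is known.
\<close>

definition col :: "(nat \<Rightarrow> nat) \<Rightarrow> nat \<Rightarrow> nat" where
  "col x = (\<lambda>j\<in>J. (x j + (K j + 1) - x p) mod (K j + 1))"

lemma finite_palette: "finite palette" and card_palette: "card palette = (\<Prod>j\<in>J. K j + 1)"
  by (simp_all add: palette_def J_def finite_PiE card_PiE)

lemma col_in_palette: "col x \<in> palette"
  by (auto simp: col_def palette_def simp flip: less_Suc_eq_le)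

lemma col_nth:
  assumes "\<And>i. i < n \<Longrightarrow> x i \<le> K i" "j \<in> J"
  shows "col x j = (if x p \<le> x j then x j - x p else x j + (K j + 1) - x p)"
proof -
  have "j < n" using assms(2) by (simp add: J_def)
  then have "x j < K j + 1" "x p < K j + 1"
    using assms(1)[of j] assms(1)[of p] p K_min[of j] by auto
  then show ?thesis
    using assms(2) mod_shift[of "x j" "K j + 1" "x p"] by (simp add: col_def)
qed

lemma col_cancel:
  assumes x: "\<And>i. i < n \<Longrightarrow> x i \<le> K i" and y: "\<And>i. i < n \<Longrightarrow> y i \<le> K i"
    and eq: "col x = col y" and k: "k < n" "x k = y k" and i: "i < n"
  shows "x i = y i"
proof -
  have le: "x j \<le> K j" "y j \<le> K j" "x p \<le> K j" "y p \<le> K j" if "j \<in> J" for j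
    using that x[of j] y[of j] x[OF p] y[OF p] K_min[of j] by (auto simp: J_def)
  have E: "(if x p \<le> x j then x j - x p else x j + (K j + 1) - x p) =
      (if y p \<le> y j then y j - y p else y j + (K j + 1) - y p)" if "j \<in> J" for j
    using col_nth[OF x that] col_nth[OF y that] eq by simp
  have xp: "x p = y p"
  proof (cases "k = p")
    case False
    then have "k \<in> J" using k(1) by (simp add: J_def)
    from E[OF this] le[OF this] k(2) show ?thesis by (auto split: if_splits)
  qed (use k in simp)
  show ?thesis
  proof (cases "i = p")
    case False
    then have "i \<in> J" using i by (simp add: J_def)
    from E[OF this] le[OF this] xp show ?thesis by (auto split: if_splits)
  qed (use xp in simp)
qed

definition edge_sum :: "'v set \<Rightarrow> nat \<Rightarrow> nat" where
  "edge_sum e i = (\<Sum>u\<in>e. \<phi> u i)"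

lemma edge_disjoint:
  assumes "{u, v} \<in> edges G" "i < n"
  shows "\<phi> u i = 0 \<or> \<phi> v i = 0"
proof (rule ccontr)
  assume "\<not> ?thesis"
  then have "i \<in> supp u \<inter> supp v" using assms(2) by (simp add: supp_def)
  with assms(1) edge_iff show False by blast
qed

lemma edge_sum_pair:
  assumes "{u, v} \<in> edges G"
  shows "edge_sum {u, v} i = \<phi> u i + \<phi> v i"
  using simple_graph_edgeD(3)[OF simple assms] by (simp add: edge_sum_def)

lemma edge_sum_le:
  assumes "{u, v} \<in> edges G" "i < n"
  shows "edge_sum {u, v} i \<le> K i"
proof -
  have "u \<in> verts G" "v \<in> verts G"
    using assms(1) by (simp_all add: edge_iff)
  with edge_disjoint[OF assms] coord_le[of u i] coord_le[of v i] assms(2)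
  show ?thesis by (auto simp: edge_sum_pair[OF assms(1)])
qed

text \<open>Edges at \<open>u\<close> agree on the support of \<open>u\<close>, so that their colours can be cancelled.\<close>

lemma col_edges_at:
  assumes e: "{u, v} \<in> edges G" and g: "{u, w} \<in> edges G"
    and eq: "col (edge_sum {u, v}) = col (edge_sum {u, w})"
  shows "v = w"
proof -
  have V: "u \<in> verts G" "v \<in> verts G" "w \<in> verts G" using e g by (auto simp: edge_iff)
  obtain k where "k \<in> supp u" using supp_nonempty[OF V(1)] by blast
  then have k: "k < n" "\<phi> u k \<noteq> 0" by (simp_all add: supp_def)
  have "\<phi> v k = 0" "\<phi> w k = 0"
    using edge_disjoint[OF e k(1)] edge_disjoint[OF g k(1)] k(2) by auto
  then have "edge_sum {u, v} k = edge_sum {u, w} k"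
    by (simp add: edge_sum_pair[OF e] edge_sum_pair[OF g])
  from col_cancel[OF edge_sum_le[OF e] edge_sum_le[OF g] eq k(1) this]
  show "v = w"
    by (intro vertex_eqI[OF V(2,3)]) (simp add: edge_sum_pair[OF e] edge_sum_pair[OF g])
qed

lemma col_vertex_edge:
  assumes e: "{u, v} \<in> edges G"
  shows "col (\<phi> u) \<noteq> col (edge_sum {u, v})"
proof
  assume eq: "col (\<phi> u) = col (edge_sum {u, v})"
  have V: "u \<in> verts G" "v \<in> verts G" using e by (auto simp: edge_iff)
  obtain k where "k \<in> supp u" using supp_nonempty[OF V(1)] by blast
  then have k: "k < n" "\<phi> u k \<noteq> 0" by (simp_all add: supp_def)
  then have "\<phi> u k = edge_sum {u, v} k"
    using edge_disjoint[OF e k(1)] by (simp add: edge_sum_pair[OF e])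
  note col_cancel[OF coord_le[OF V(1)] edge_sum_le[OF e] eq k(1) this]
  then have "\<phi> v i = 0" if "i < n" for i
    using that by (simp add: edge_sum_pair[OF e])
  then have "supp v = {}" by (simp add: supp_def)
  with supp_nonempty[OF V(2)] show False by simp
qed

lemma col_vertex_vertex:
  assumes "u \<in> verts G" "v \<in> verts G" "\<phi> u p = 0" "\<phi> v p = 0" "col (\<phi> u) = col (\<phi> v)"
  shows "u = v"
  using col_cancel[OF coord_le[OF assms(1)] coord_le[OF assms(2)] assms(5) p] assms(3,4)
  by (intro vertex_eqI[OF assms(1,2)]) simp

lemma edges_sharing_vertexE:
  assumes "e \<in> edges G" "g \<in> edges G" "e \<inter> g \<noteq> {}"
  obtains u v w where "e = {u, v}" "g = {u, w}"
proof -
  obtain u where u: "u \<in> e" "u \<in> g" using assms(3) by auto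
  obtain v where "e = {u, v}" by (rule simple_graph_edgeE[OF simple assms(1) u(1)])
  moreover obtain w where "g = {u, w}" by (rule simple_graph_edgeE[OF simple assms(2) u(2)])
  ultimately show thesis by (rule that)
qed

lemma proper_col: "proper_edge_labelling (edges G) palette (\<lambda>e. col (edge_sum e))"
  unfolding proper_edge_labelling_def
proof (intro conjI ballI impI)
  fix e g assume eg: "e \<in> edges G" "g \<in> edges G" "e \<noteq> g \<and> e \<inter> g \<noteq> {}"
  then obtain u v w where "e = {u, v}" "g = {u, w}"
    by (meson edges_sharing_vertexE)
  with eg col_edges_at[of u v w] show "col (edge_sum e) \<noteq> col (edge_sum g)" by auto
qed (use col_in_palette in auto)

text \<open>A vertex supported in \<open>p\<close> alone has degree \<open>card palette - 1\<close>.\<close>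

lemma card_palette_le: "card palette \<le> max_degree G + 1"
proof (cases "J = {}")
  case False
  have "{..<n} - {p} \<noteq> {}" using False by (simp add: J_def)
  then obtain k where "k < n" "k \<notin> {p}" by blast
  then obtain u where u: "u \<in> verts G" "supp u = {p}"
    using vertex_of_supp[of "{p}" k] p by auto
  have "vertex_degree G u + 1 = card palette"
    using vertex_degree_plus_one[OF u(1)] by (simp add: u(2) card_palette J_def)
  then show ?thesis
    using vertex_degree_le_max_degree[OF finite_verts u(1)] by simp
qed (simp add: card_palette)

text \<open>
  An edge at \<open>u\<close> never has the colour of \<open>u\<close> itself, but adjacent vertices may clash. The
  vertices with \<open>p\<close> in their support are independent and share one additional colour. All
  others agree in the coordinate \<open>p\<close>, so that their colours are different.
\<close>

lemma total_coloring: "total_coloring_conjecture G"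
proof (rule total_coloring_conjectureI[OF simple finite_verts])
  let ?c = "\<lambda>u. if \<phi> u p = 0 then Some (col (\<phi> u)) else None"
  let ?d = "\<lambda>e. Some (col (edge_sum e))"
  show "finite (insert None (Some ` palette))"
    by (simp add: finite_palette)
  show "card (insert None (Some ` palette)) \<le> max_degree G + 2"
    using card_palette_le by (simp add: card_insert_if finite_palette card_image)
  show "?c \<in> verts G \<rightarrow> insert None (Some ` palette)"
    using col_in_palette by auto
  show "?c u \<noteq> ?c v" if e: "{u, v} \<in> edges G" for u v
    using col_vertex_vertex[of u v] edge_disjoint[OF e p] simple_graph_edgeD[OF simple e] by auto
  show "proper_edge_labelling (edges G) (insert None (Some ` palette)) ?d"
    using proper_col by (auto simp: proper_edge_labelling_def Pi_iff)
  show "?c u \<noteq> ?d e" if e: "e \<in> edges G" "u \<in> e" for u e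
  proof -
    obtain v where v: "e = {u, v}" by (rule simple_graph_edgeE[OF simple e])
    with col_vertex_edge[of u v] e(1) show ?thesis by simp
  qed
qed


subsection \<open>Saving one edge colour\<close>

definition zero_col :: "nat \<Rightarrow> nat" where "zero_col = (\<lambda>j\<in>J. 0)"

lemma zero_col_in_palette: "zero_col \<in> palette"
  by (simp add: zero_col_def palette_def)

text \<open>
  The vector labelling an edge of colour zero is constant and nonzero, so that the supports
  of the two ends cover all coordinates.
\<close>

lemma zero_edge_supp:
  assumes e: "{u, v} \<in> edges G" and z: "col (edge_sum {u, v}) = zero_col"
  shows "supp v = {..<n} - supp u"
proof -
  let ?x = "edge_sum {u, v}"
  have V: "u \<in> verts G" "v \<in> verts G" using e by (auto simp: edge_iff)
  have const: "?x i = ?x p" if "i < n" for i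
  proof (cases "i = p")
    case False
    then have iJ: "i \<in> J" using that by (simp add: J_def)
    have "?x p \<le> K i" using edge_sum_le[OF e p] K_min[OF that] by simp
    moreover have "(if ?x p \<le> ?x i then ?x i - ?x p else ?x i + (K i + 1) - ?x p) = 0"
      using col_nth[OF edge_sum_le[OF e] iJ] iJ by (simp add: z zero_col_def)
    ultimately show ?thesis by (auto split: if_splits)
  qed simp
  obtain k where "k \<in> supp u" using supp_nonempty[OF V(1)] by blast
  then have "k < n" "?x k \<noteq> 0" by (simp_all add: supp_def edge_sum_pair[OF e])
  then have nz: "?x i \<noteq> 0" if "i < n" for i using const[OF that] const[of k] by simp
  show ?thesis
  proof (intro equalityI subsetI)
    fix i assume "i \<in> supp v"
    then show "i \<in> {..<n} - supp u" using edge_disjoint[OF e, of i] by (auto simp: supp_def)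
  next
    fix i assume "i \<in> {..<n} - supp u"
    then show "i \<in> supp v" using nz[of i] by (auto simp: supp_def edge_sum_pair[OF e])
  qed
qed

definition nonzero_edges :: "'v set set" where
  "nonzero_edges = {e \<in> edges G. col (edge_sum e) \<noteq> zero_col}"

definition Col :: "(nat \<Rightarrow> nat) set" where "Col = palette - {zero_col}"

lemma finite_Col: "finite Col" and card_Col: "card Col + 1 = card palette"
proof -
  show "finite Col" by (simp add: Col_def finite_palette)
  have "card palette > 0" using zero_col_in_palette finite_palette by (auto simp: card_gt_0_iff)
  then show "card Col + 1 = card palette"
    using zero_col_in_palette by (simp add: Col_def card_Diff_singleton)
qed

text \<open>
  Here \<open>u\<close> may have maximal degree, and a free colour common to both ends need not exist; a fan
  is used instead. The vertices whose support is complementary to that of \<open>u\<close>, among them \<open>v\<close>,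
  only have neighbours with the same support as \<open>u\<close>. There are at most \<open>K p\<close> of the latter, but
  at least \<open>K p * K p\<close> of the former, as there are two other coordinates.
\<close>

lemma extend_at_minimal_vertex:
  assumes n: "n \<ge> 3" and E: "nonzero_edges \<subseteq> E" "E \<subseteq> edges G" and d: "proper_edge_labelling E Col d"
    and e: "{u, v} \<in> edges G" "{u, v} \<notin> E" and i: "supp u = {i}" "K i = K p"
  shows "\<exists>d'. proper_edge_labelling (insert {u, v} E) Col d'"
proof -
  have V: "u \<in> verts G" "v \<in> verts G" "u \<noteq> v" using simple_graph_edgeD[OF simple e(1)] by auto
  have i_n: "i < n" using i(1) supp_subset[of u] by simp
  have zero: "col (edge_sum {u, v}) = zero_col"
    using e E by (auto simp: nonzero_edges_def)
  define T where "T = {..<n} - {i}"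
  define X where "X = {w \<in> verts G. supp w = {i}}"
  define Y where "Y = {w \<in> verts G. supp w = T}"
  have finE: "finite E" by (rule finite_subset[OF E(2) finite_edges[OF simple finite_verts]])
  have finXY: "finite X" "finite Y" using finite_verts by (simp_all add: X_def Y_def)
  have X_le: "card X \<le> K p"
  proof -
    have "inj_on (\<lambda>w. \<phi> w i) X"
    proof (rule inj_onI)
      fix w w' assume w: "w \<in> X" "w' \<in> X" "\<phi> w i = \<phi> w' i"
      have "\<phi> w j = \<phi> w' j" if "j < n" for j
      proof (cases "j = i")
        case False
        then have "j \<notin> supp w" "j \<notin> supp w'" using w(1,2) by (simp_all add: X_def)
        with that show ?thesis by (simp add: supp_def)
      qed (use w in simp)
      with w show "w = w'" by (intro vertex_eqI) (simp_all add: X_def)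
    qed
    moreover have "\<phi> w i \<in> {1..K i}" if "w \<in> X" for w
    proof -
      have "i \<in> supp w" using that by (simp add: X_def)
      then have "\<phi> w i \<noteq> 0" by (simp add: supp_def)
      with coord_le[of w i] i_n that show ?thesis by (simp add: X_def)
    qed
    ultimately have "card X \<le> card {1..K i}"
      by (intro card_inj_on_le[of "\<lambda>w. \<phi> w i"]) auto
    with i(2) show ?thesis by simp
  qed
  have Y_ge: "K p * K p \<le> card Y"
  proof -
    have "card T = n - 1" using i_n by (simp add: T_def)
    then have "2 \<le> card T" using n by simp
    then obtain S where "S \<subseteq> T" "card S = 2" by (meson obtain_subset_with_card_n)
    then obtain a b where ab: "a \<in> T" "b \<in> T" "a \<noteq> b" by (auto simp: card_2_iff)
    have "K p * K p \<le> K a * K b"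
      using ab K_min by (intro mult_le_mono) (auto simp: T_def)
    also have "\<dots> \<le> prod K T"
      using ab K_pos by (intro prod_ge_two_factors) (auto simp: T_def)
    also have "prod K T = card (\<Pi>\<^sub>E j\<in>T. {1..K j})"
      by (simp add: card_PiE T_def)
    also have "\<dots> \<le> card Y"
    proof (rule surj_card_le[OF finXY(2)])
      show "(\<Pi>\<^sub>E j\<in>T. {1..K j}) \<subseteq> (\<lambda>w. restrict (\<phi> w) T) ` Y"
      proof
        fix y assume y: "y \<in> (\<Pi>\<^sub>E j\<in>T. {1..K j})"
        have "1 \<le> y j \<and> y j \<le> K j" if "j \<in> T" for j
          using PiE_mem[OF y that] by simp
        moreover have "T \<noteq> {..<n}" using i_n by (auto simp: T_def)
        moreover have "T \<subseteq> {..<n}" "T \<noteq> {}" using ab by (auto simp: T_def)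
        ultimately obtain w where w: "w \<in> verts G" "supp w = T" "\<And>j. j \<in> T \<Longrightarrow> \<phi> w j = y j"
          using vertex_of_type[of T y] by blast
        have "y = restrict (\<phi> w) T"
        proof
          fix j show "y j = restrict (\<phi> w) T j"
            using w(3)[of j] PiE_arb[OF y, of j] by (cases "j \<in> T") auto
        qed
        with w show "y \<in> (\<lambda>w. restrict (\<phi> w) T) ` Y" by (auto simp: Y_def)
      qed
    qed
    finally show ?thesis .
  qed
  have supp_v: "supp v = T"
    using zero_edge_supp[OF e(1) zero] i(1) by (simp add: T_def)
  show ?thesis
  proof (rule extend_edge_labelling_by_fan[OF d finite_Col finE finXY])
    have "vertex_degree G u + 1 = (\<Prod>j\<in>T. K j + 1)"
      using vertex_degree_plus_one[OF V(1)] by (simp add: i(1) T_def)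
    also have "(\<Prod>j\<in>T. K j + 1) = card palette"
    proof -
      have "(K i + 1) * (\<Prod>j\<in>T. K j + 1) = (\<Prod>j\<in>{..<n}. K j + 1)"
        unfolding T_def using i_n by (intro prod.remove[symmetric]) auto
      also have "\<dots> = (K p + 1) * card palette"
        unfolding card_palette J_def using p by (intro prod.remove) auto
      finally show ?thesis
        unfolding i(2) by (subst (asm) nat_mult_eq_cancel1) simp_all
    qed
    finally have deg: "vertex_degree G u = card Col" using card_Col by simp
    have "{e \<in> E. u \<in> e} \<subset> {e \<in> edges G. u \<in> e}"
      using e E(2) by blast
    then have "card {e \<in> E. u \<in> e} < card {e \<in> edges G. u \<in> e}"
      using finite_edges[OF simple finite_verts] by (intro psubset_card_mono) auto
    then show "card {e \<in> E. u \<in> e} < card Col"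
      using deg by (simp add: vertex_degree_def)
    show "u \<in> X" "v \<in> Y" "u \<noteq> v" "{u, v} \<notin> E"
      using V e i(1) supp_v by (auto simp: X_def Y_def)
    show "\<exists>x\<in>X. g = {x, y}" if g: "y \<in> Y" "g \<in> E" "y \<in> g" for y g
    proof -
      have gG: "g \<in> edges G" using g E(2) by blast
      obtain x where x: "g = {y, x}" "y \<in> verts G" "x \<in> verts G"
        by (rule simple_graph_edgeE[OF simple gG g(3)])
      with gG have "supp y \<inter> supp x = {}" by (simp add: edge_iff)
      moreover have "supp y = {..<n} - {i}" using g(1) by (simp add: Y_def T_def)
      ultimately have "supp x \<subseteq> {i}" using supp_subset[of x] by blast
      with supp_nonempty[OF x(3)] have "supp x = {i}" by blast
      with x show ?thesis by (auto simp: X_def insert_commute)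
    qed
    show "{u, y} \<in> E" if y: "y \<in> Y" "y \<noteq> v" for y
    proof -
      have uy: "{u, y} \<in> edges G"
        using y V i(1) by (simp add: edge_iff Y_def T_def)
      have "col (edge_sum {u, y}) \<noteq> zero_col"
        using col_edges_at[OF uy e(1)] zero y(2) by auto
      with uy E(1) show ?thesis by (auto simp: nonzero_edges_def)
    qed
    have "2 * K p \<le> K p * K p + 1"
    proof -
      have "(0::int) \<le> (int (K p) - 1)\<^sup>2" by simp
      then have "2 * int (K p) \<le> int (K p) * int (K p) + 1"
        by (simp add: power2_eq_square algebra_simps)
      then show ?thesis by (simp flip: of_nat_mult of_nat_add)
    qed
    with X_le Y_ge show "2 * card X \<le> card Y + 1" by linarith
  qed
qed

text \<open>
  If neither end is supported in a single coordinate \<open>i\<close> with \<open>K i = K p\<close>, then the degrees are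
  so small that some colour is free at both ends.
\<close>

lemma extend_at_edge:
  assumes n: "n \<ge> 3" and E: "nonzero_edges \<subseteq> E" "E \<subseteq> edges G" and d: "proper_edge_labelling E Col d"
    and e: "{u, v} \<in> edges G" "{u, v} \<notin> E" and pu: "p \<in> supp u"
  shows "\<exists>d'. proper_edge_labelling (insert {u, v} E) Col d'"
proof -
  have V: "u \<in> verts G" "v \<in> verts G" "u \<noteq> v" using simple_graph_edgeD[OF simple e(1)] by auto
  have zero: "col (edge_sum {u, v}) = zero_col"
    using e E by (auto simp: nonzero_edges_def)
  have supp_v: "supp v = {..<n} - supp u" by (rule zero_edge_supp[OF e(1) zero])
  then have supp_v': "{..<n} - supp v = supp u" using supp_subset[of u] by blast
  have finE: "finite E" by (rule finite_subset[OF E(2) finite_edges[OF simple finite_verts]])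
  define q x y where "q = K p + 1" and "x = (\<Prod>j\<in>supp v. K j + 1)" and "y = (\<Prod>j\<in>supp u - {p}. K j + 1)"
  \<comment> \<open>The degrees of the ends are \<open>x - 1\<close> and \<open>q * y - 1\<close>, and the whole palette has \<open>x * y\<close> colours.\<close>
  have deg: "card {e \<in> E. w \<in> e} < vertex_degree G w" if "w \<in> {u, v}" for w
  proof -
    have "{e \<in> E. w \<in> e} \<subset> {e \<in> edges G. w \<in> e}"
      using e E(2) that by blast
    then show ?thesis
      unfolding vertex_degree_def
      using finite_edges[OF simple finite_verts] by (intro psubset_card_mono) auto
  qed
  have "card {e \<in> E. u \<in> e} + 2 \<le> x"
    using deg[of u] vertex_degree_plus_one[OF V(1)] supp_v by (simp add: x_def)
  moreover have "card {e \<in> E. v \<in> e} + 2 \<le> q * y"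
  proof -
    have "(\<Prod>j\<in>supp u. K j + 1) = q * y"
      unfolding q_def y_def using pu by (intro prod.remove) auto
    then show ?thesis
      using deg[of v] vertex_degree_plus_one[OF V(2)] supp_v' by simp
  qed
  moreover have "card Col + 1 = x * y"
  proof -
    have "J = supp v \<union> (supp u - {p})"
      using supp_v supp_subset[of u] pu by (auto simp: J_def)
    moreover have "supp v \<inter> (supp u - {p}) = {}" using supp_v by blast
    ultimately have "card palette = x * y"
      unfolding card_palette x_def y_def by (simp add: prod.union_disjoint)
    with card_Col show ?thesis by simp
  qed
  moreover have "q \<ge> 2" using K_pos[OF p] by (simp add: q_def)
  ultimately have bounds: "card {e \<in> E. u \<in> e} + 2 \<le> x" "card {e \<in> E. v \<in> e} + 2 \<le> q * y"
    "card Col + 1 = x * y" "q \<ge> 2" .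
  have greedy: ?thesis if large: "q + 1 \<le> x" "q \<le> y"
  proof -
    obtain t where t: "x = q + 1 + t" using large(1) le_Suc_ex by blast
    have "y \<noteq> 0" using large(2) bounds(4) by linarith
    then have "t * 1 \<le> t * y" by (intro mult_le_mono2) simp
    moreover have "x * y = q * y + y + t * y" by (simp add: t algebra_simps)
    ultimately have "card {e \<in> E. u \<in> e} + card {e \<in> E. v \<in> e} < card Col"
      using bounds large(2) t by linarith
    then show ?thesis
      by (rule extend_edge_labelling_greedily[OF d finite_Col finE])
  qed
  have n_supp: "j < n" if "j \<in> supp w" for j w using that by (simp add: supp_def)
  show ?thesis
  proof (cases "supp u = {p}")
    case True
    then show ?thesis by (rule extend_at_minimal_vertex[OF n E d e]) simp
  next
    case False
    then obtain j where j: "j \<in> supp u - {p}" using pu by blast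
    have "q \<le> K j + 1" using K_min[of j] j n_supp by (auto simp: q_def)
    also have "\<dots> \<le> y" unfolding y_def using j by (intro prod_ge_factor) auto
    finally have y: "q \<le> y" .
    show ?thesis
    proof (cases "q + 1 \<le> x")
      case True
      with y greedy show ?thesis by blast
    next
      case x: False
      obtain i where i: "i \<in> supp v" using supp_nonempty[OF V(2)] by blast
      have "K i + 1 \<le> x" unfolding x_def using i by (intro prod_ge_factor) auto
      then have Ki: "K i = K p" using x K_min[of i] i n_supp by (auto simp: q_def)
      have "supp v = {i}"
      proof (rule ccontr)
        assume "supp v \<noteq> {i}"
        then obtain k where k: "k \<in> supp v" "k \<noteq> i" using i by blast
        have "(K i + 1) * (K k + 1) \<le> x"
          unfolding x_def using i k by (intro prod_ge_two_factors) auto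
        moreover have "(K i + 1) * 2 \<le> (K i + 1) * (K k + 1)"
          using K_pos[of k] k n_supp by (intro mult_le_mono2) auto
        ultimately show False using x Ki by (simp add: q_def)
      qed
      moreover have "{v, u} \<in> edges G" "{v, u} \<notin> E" using e by (simp_all add: insert_commute)
      ultimately show ?thesis
        using extend_at_minimal_vertex[OF n E d _ _ _ Ki, of v u] by (simp add: insert_commute)
    qed
  qed
qed

text \<open>
  Differences colour all edges but those of colour zero with \<open>card palette - 1\<close> colours; the
  remaining edges are restored one at a time, recolouring as needed.
\<close>

lemma edge_chromatic_number_large:
  assumes n: "n \<ge> 3"
  shows "edge_chromatic_number G = max_degree G"
proof -
  have finE: "finite (edges G)" by (rule finite_edges[OF simple finite_verts])
  define M where "M = edges G - nonzero_edges"
  have "\<exists>d. proper_edge_labelling (nonzero_edges \<union> F) Col d" if "finite F" "F \<subseteq> M" for F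
    using that
  proof (induction F rule: finite_subset_induct')
    case empty
    have "proper_edge_labelling nonzero_edges Col (\<lambda>e. col (edge_sum e))"
      using proper_col unfolding proper_edge_labelling_def nonzero_edges_def Col_def by blast
    then show ?case by auto
  next
    case (insert e F)
    then obtain d where d: "proper_edge_labelling (nonzero_edges \<union> F) Col d" by blast
    have sub: "nonzero_edges \<subseteq> nonzero_edges \<union> F" "nonzero_edges \<union> F \<subseteq> edges G"
      using insert by (auto simp: M_def nonzero_edges_def)
    have e: "e \<in> edges G" "e \<notin> nonzero_edges \<union> F" using insert by (auto simp: M_def)
    have "e \<noteq> {}" using e(1) simple by (auto simp: simple_graph_def nsets_def)
    then obtain a where "a \<in> e" by blast
    then obtain b where b: "e = {a, b}" by (rule simple_graph_edgeE[OF simple e(1)])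
    have "col (edge_sum {a, b}) = zero_col" using e b by (auto simp: nonzero_edges_def)
    then have "supp b = {..<n} - supp a" using zero_edge_supp e(1) b by blast
    then have "p \<in> supp a \<or> p \<in> supp b" using p by blast
    then obtain u v where uv: "e = {u, v}" "p \<in> supp u" using b by (auto simp: insert_commute)
    with extend_at_edge[OF n sub d, of u v] e show ?case by (simp add: Un_insert_right)
  qed
  from this[of M] have "\<exists>d. proper_edge_labelling (nonzero_edges \<union> M) Col d"
    using finE by (simp add: M_def)
  moreover have "nonzero_edges \<union> M = edges G"
    by (auto simp: M_def nonzero_edges_def)
  ultimately obtain d where "proper_edge_labelling (edges G) Col d" by auto
  then show ?thesis
    by (rule edge_chromatic_number_eq_max_degreeI[OF finite_verts finite_Col])
      (use card_Col card_palette_le in linarith)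
qed

text \<open>
  With two coordinates the graph is a complete bipartite graph together with isolated
  vertices, and sums modulo the size of the larger part colour it.
\<close>

lemma edge_chromatic_number_two:
  assumes n: "n = 2"
  shows "edge_chromatic_number G = max_degree G"
proof -
  define q where "q = 1 - p"
  have q: "q < 2" "q \<noteq> p" using p n unfolding q_def by presburger+
  have "{..<n} = {p, q}" using p n q by auto
  then have Jq: "J = {q}" using q(2) by (auto simp: J_def)
  have K_le: "K j \<le> K q" if "j < 2" for j
  proof -
    have "j = p \<or> j = q" using that p n q by linarith
    then show ?thesis using K_min[of q] q n by auto
  qed
  have Kq: "K q \<ge> 1" using K_pos[of q] q n by simp
  define d where "d e = (\<Sum>u\<in>e. \<phi> u 0 + \<phi> u 1) mod K q" for e
  have pair: "\<exists>i j. i < 2 \<and> j < 2 \<and> i \<noteq> j \<and> supp u = {i} \<and> supp v = {j}" if "{u, v} \<in> edges G" for u v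
  proof -
    have d: "supp u \<noteq> {}" "supp v \<noteq> {}" "supp u \<inter> supp v = {}"
      using that supp_nonempty by (simp_all add: edge_iff)
    have two: "{..<n} = {0, 1}" using n by auto
    have "supp u \<subseteq> {0, 1}" "supp v \<subseteq> {0, 1}" using supp_subset two by blast+
    with d have "supp u = {0} \<and> supp v = {1} \<or> supp u = {1} \<and> supp v = {0}" by blast
    then show ?thesis by (elim disjE) (intro exI[of _ 0] exI[of _ 1], simp, intro exI[of _ 1] exI[of _ 0], simp)
  qed
  have total: "\<phi> w 0 + \<phi> w 1 = \<phi> w i" if "supp w = {i}" "i < 2" for w i
  proof -
    have "\<phi> w j = 0" if "j < 2" "j \<noteq> i" for j
    proof -
      have "j \<notin> supp w" using \<open>supp w = {i}\<close> that by simp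
      moreover have "j < n" using that n by simp
      ultimately show ?thesis by (simp add: supp_def)
    qed
    moreover have "i = 0 \<or> i = 1" using that(2) by linarith
    ultimately show ?thesis by auto
  qed
  have "proper_edge_labelling (edges G) {..<K q} d"
    unfolding proper_edge_labelling_def
  proof (intro conjI ballI impI)
    fix e g assume eg: "e \<in> edges G" "g \<in> edges G" "e \<noteq> g \<and> e \<inter> g \<noteq> {}"
    then obtain u v w where e: "e = {u, v}" and g: "g = {u, w}"
      by (meson edges_sharing_vertexE)
    obtain i j where ij: "i < 2" "j < 2" "i \<noteq> j" "supp u = {i}" "supp v = {j}"
      using pair[of u v] eg(1) e by blast
    obtain i' j' where ij': "i' < 2" "j' < 2" "i' \<noteq> j'" "supp u = {i'}" "supp w = {j'}"
      using pair[of u w] eg(2) g by blast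
    have w: "supp w = {j}"
    proof -
      have "i' = i" using ij(4) ij'(4) by simp
      then have "j' = j" using ij ij' by linarith
      with ij'(5) show ?thesis by simp
    qed
    have V: "v \<in> verts G" "w \<in> verts G" using eg e g by (auto simp: edge_iff)
    have de: "d e = (\<phi> u i + \<phi> v j) mod K q" "d g = (\<phi> u i + \<phi> w j) mod K q"
      using simple_graph_edgeD(3)[OF simple, of u v] simple_graph_edgeD(3)[OF simple, of u w] eg e g
        total[OF ij(4,1)] total[OF ij(5,2)] total[OF w ij(2)] by (simp_all add: d_def)
    show "d e \<noteq> d g"
    proof
      assume "d e = d g"
      then have "[\<phi> u i + \<phi> v j = \<phi> u i + \<phi> w j] (mod K q)"
        using de by (simp add: cong_def)
      then have cong: "\<phi> v j mod K q = \<phi> w j mod K q"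
        by (simp only: cong_add_lcancel_nat) (simp add: cong_def)
      have range: "1 \<le> \<phi> x j \<and> \<phi> x j \<le> K q" if "supp x = {j}" "x \<in> verts G" for x
      proof -
        have "j \<in> supp x" using that by simp
        then have "\<phi> x j \<noteq> 0" by (simp add: supp_def)
        with coord_le[OF that(2), of j] K_le[OF ij(2)] ij(2) n show ?thesis by simp
      qed
      have "a = b" if "1 \<le> a \<and> a \<le> m" "1 \<le> b \<and> b \<le> m" "a mod m = b mod m" for a b m :: nat
        using that by (cases "a = m"; cases "b = m") auto
      from this[OF range[OF ij(5) V(1)] range[OF w V(2)] cong]
      have eq: "\<phi> v j = \<phi> w j" .
      have "\<phi> v k = \<phi> w k" if "k < n" for k
      proof (cases "k = j")
        case False
        then have "k \<notin> supp v" "k \<notin> supp w" using ij(5) w by simp_all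
        with that show ?thesis by (simp add: supp_def)
      qed (use eq in simp)
      with V have "v = w" by (intro vertex_eqI) auto
      with eg(3) e g show False by simp
    qed
  qed (use Kq in \<open>auto simp: d_def\<close>)
  then show ?thesis
  proof (rule edge_chromatic_number_eq_max_degreeI[OF finite_verts finite_lessThan])
    show "card {..<K q} \<le> max_degree G"
      using card_palette_le by (simp add: card_palette Jq)
  qed
qed

lemma edge_chromatic_number_one:
  assumes n: "n = 1"
  shows "edge_chromatic_number G = max_degree G"
proof -
  have "edges G = {}"
  proof (rule ccontr)
    assume "edges G \<noteq> {}"
    then obtain u v where "{u, v} \<in> edges G" unfolding edges_eq by blast
    then have d: "supp u \<noteq> {}" "supp v \<noteq> {}" "supp u \<inter> supp v = {}"
      using supp_nonempty by (simp_all add: edge_iff)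
    have "{..<n} = {0}" using n by auto
    then have "supp u \<subseteq> {0}" "supp v \<subseteq> {0}" using supp_subset by blast+
    with d show False by blast
  qed
  then have "proper_edge_labelling (edges G) ({} :: nat set) (\<lambda>_. 0)"
    by (simp add: proper_edge_labelling_def)
  then show ?thesis
    by (rule edge_chromatic_number_eq_max_degreeI[OF finite_verts finite.emptyI]) simp
qed

end

context disjointness_graph
begin

theorem edge_and_total_colorings:
  "edge_chromatic_number G = max_degree G" "total_coloring_conjecture G"
proof -
  have "Min (K ` {..<n}) \<in> K ` {..<n}"
    using n_pos lessThan_empty_iff[of n] by (intro Min_in) auto
  then obtain p where p: "p < n" "Min (K ` {..<n}) = K p" by auto
  interpret minimal_coordinate G n K \<phi> f p
  proof
    fix j assume "j < n"
    then show "K p \<le> K j" unfolding p(2)[symmetric] by (intro Min_le) auto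
  qed (rule p(1))
  show "total_coloring_conjecture G" by (rule total_coloring)
  consider "n = 1" | "n = 2" | "n \<ge> 3" using n_pos by linarith
  then show "edge_chromatic_number G = max_degree G"
    by cases (simp_all add: edge_chromatic_number_one edge_chromatic_number_two edge_chromatic_number_large)
qed

end


section \<open>Local rings with finitely many ideals\<close>

lemma (in cring) idealI_comm:
  assumes "I \<subseteq> carrier R" "\<zero> \<in> I" and add: "\<And>x y. x \<in> I \<Longrightarrow> y \<in> I \<Longrightarrow> x \<oplus> y \<in> I"
    and mult: "\<And>r x. r \<in> carrier R \<Longrightarrow> x \<in> I \<Longrightarrow> r \<otimes> x \<in> I"
  shows "ideal I R"
proof (rule idealI[OF ring_axioms])
  show "subgroup I (add_monoid R)"
  proof
    fix x assume x: "x \<in> I"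
    then have "\<ominus> x = \<ominus> \<one> \<otimes> x" using assms(1) by (simp add: l_minus subsetD)
    then have "\<ominus> x \<in> I" using mult[OF _ x] by simp
    then show "inv\<^bsub>add_monoid R\<^esub> x \<in> I" by (simp add: a_inv_def)
  qed (use assms in auto)
  show "x \<otimes> a \<in> I" "a \<otimes> x \<in> I" if "a \<in> I" "x \<in> carrier R" for a x
    using mult[OF that(2,1)] assms(1) that by (simp_all add: m_comm subsetD)
qed

lemma (in cring) minimal_nonzero_ideal:
  assumes fin: "finite {I. ideal I R}" and I: "ideal I R" "I \<noteq> {\<zero>}"
  obtains J where "ideal J R" "J \<noteq> {\<zero>}" "J \<subseteq> I"
    "\<forall>J'. ideal J' R \<and> J' \<noteq> {\<zero>} \<and> J' \<subseteq> J \<longrightarrow> J' = J"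
proof -
  let ?S = "{J. ideal J R \<and> J \<noteq> {\<zero>}}"
  have "finite ?S" "I \<in> ?S"
    using I by (auto intro: finite_subset[OF _ fin])
  from finite_has_minimal2[OF this] obtain J
    where "J \<in> ?S" "J \<subseteq> I" "\<forall>J'\<in>?S. J' \<subseteq> J \<longrightarrow> J = J'" by blast
  then show thesis by (intro that) auto
qed

lemma (in local_ring) zero_ideal_proper: "carrier R \<noteq> {\<zero>}"
proof
  assume triv: "carrier R = {\<zero>}"
  obtain M where "maximalideal M R" using ex1_maximalideal by blast
  then interpret M: maximalideal M R .
  have "\<zero> \<in> M" by (rule M.zero_closed)
  moreover have "M \<subseteq> {\<zero>}" unfolding triv[symmetric] by (rule M.a_subset)
  ultimately have "M = {\<zero>}" by blast
  with triv M.I_notcarr show False by simp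
qed

lemma (in local_ring) proper_ideal_subset_maximal:
  assumes fin: "finite {I. ideal I R}" and M: "maximalideal M R"
    and I: "ideal I R" "I \<noteq> carrier R"
  shows "I \<subseteq> M"
proof -
  let ?S = "{J. ideal J R \<and> J \<noteq> carrier R}"
  have "finite ?S" "I \<in> ?S"
    using I by (auto intro: finite_subset[OF _ fin])
  from finite_has_maximal2[OF this] obtain N
    where N: "N \<in> ?S" "I \<subseteq> N" "\<forall>J\<in>?S. N \<subseteq> J \<longrightarrow> N = J" by blast
  have "maximalideal N R"
  proof (rule maximalidealI)
    fix J assume J: "ideal J R" "N \<subseteq> J"
    show "J = N \<or> J = carrier R"
    proof (cases "J = carrier R")
      case False
      with J N(3) have "N = J" by simp
      then show ?thesis by simp
    qed simp
  qed (use N(1) in auto)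
  with M ex1_maximalideal have "N = M" by blast
  with N(2) show ?thesis by simp
qed

text \<open>
  If \<open>m r\<close> were nonzero, it would generate the minimal ideal containing \<open>r\<close>, so that
  \<open>r = s m r\<close> for some \<open>s\<close>; but \<open>1 - s m\<close> is a unit, as it lies outside the maximal ideal.
\<close>

lemma (in local_ring) maximal_kills_minimal:
  assumes fin: "finite {I. ideal I R}" and M: "maximalideal M R"
    and J: "ideal J R" and min: "\<forall>J'. ideal J' R \<and> J' \<noteq> {\<zero>} \<and> J' \<subseteq> J \<longrightarrow> J' = J"
    and m: "m \<in> M" and r: "r \<in> J"
  shows "m \<otimes> r = \<zero>"
proof (rule ccontr)
  assume nz: "m \<otimes> r \<noteq> \<zero>"
  interpret M: maximalideal M R by (rule M)
  interpret J: ideal J R by (rule J)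
  have car [simp]: "m \<in> carrier R" "r \<in> carrier R"
    using m r M.Icarr J.Icarr by auto
  have mr: "m \<otimes> r \<in> J" using J.I_l_closed[OF r] by simp
  have "PIdl (m \<otimes> r) = J"
  proof (rule min[rule_format], intro conjI)
    show "ideal (PIdl (m \<otimes> r)) R" by (rule cgenideal_ideal) simp
    show "PIdl (m \<otimes> r) \<noteq> {\<zero>}" using cgenideal_self[of "m \<otimes> r"] nz by auto
    show "PIdl (m \<otimes> r) \<subseteq> J" by (rule cgenideal_minimal[OF J mr])
  qed
  with r obtain s where s [simp]: "s \<in> carrier R" and eq: "r = s \<otimes> (m \<otimes> r)"
    unfolding cgenideal_def by blast
  define a where "a = \<one> \<ominus> s \<otimes> m"
  have a [simp]: "a \<in> carrier R" by (simp add: a_def)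
  have "a \<otimes> r = r \<ominus> s \<otimes> (m \<otimes> r)"
    unfolding a_def by (simp add: minus_eq l_distr l_minus m_assoc)
  then have ar: "a \<otimes> r = \<zero>" using eq by (simp add: minus_eq r_neg)
  have "PIdl a = carrier R"
  proof (rule ccontr)
    assume "PIdl a \<noteq> carrier R"
    then have "PIdl a \<subseteq> M"
      by (intro proper_ideal_subset_maximal[OF fin M] cgenideal_ideal) simp
    then have "a \<in> M" using cgenideal_self[OF a] by blast
    moreover have "s \<otimes> m \<in> M" using m by (rule M.I_l_closed) simp
    ultimately have "a \<oplus> s \<otimes> m \<in> M" by (rule M.a_closed)
    moreover have "a \<oplus> s \<otimes> m = \<one>"
      unfolding a_def by (simp add: minus_eq a_assoc l_neg)
    ultimately have "M = carrier R" by (intro M.one_imp_carrier) simp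
    with M.I_notcarr show False by simp
  qed
  then have "\<one> \<in> PIdl a" by simp
  then obtain t where [simp]: "t \<in> carrier R" and t: "\<one> = t \<otimes> a"
    unfolding cgenideal_def by blast
  have "r = \<one> \<otimes> r" by simp
  also have "\<dots> = t \<otimes> (a \<otimes> r)" unfolding t by (rule m_assoc) simp_all
  also have "\<dots> = \<zero>" by (simp add: ar)
  finally have "r = \<zero>" .
  with nz show False by simp
qed

text \<open>Any nonzero element of a minimal nonzero ideal will do.\<close>

lemma (in local_ring) common_annihilator_of_proper_ideals:
  assumes fin: "finite {I. ideal I R}"
  obtains r where "r \<in> carrier R" "r \<noteq> \<zero>"
    "\<forall>I. ideal I R \<and> I \<noteq> carrier R \<longrightarrow> (\<forall>x\<in>I. r \<otimes> x = \<zero>)"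
proof -
  obtain M where M: "maximalideal M R" using ex1_maximalideal by blast
  obtain J where J: "ideal J R" "J \<noteq> {\<zero>}" "J \<subseteq> carrier R"
      "\<forall>J'. ideal J' R \<and> J' \<noteq> {\<zero>} \<and> J' \<subseteq> J \<longrightarrow> J' = J"
    by (rule minimal_nonzero_ideal[OF fin oneideal zero_ideal_proper])
  interpret J: ideal J R by (rule J(1))
  obtain r where r: "r \<in> J" "r \<noteq> \<zero>" using J(2) J.zero_closed by blast
  show thesis
  proof (rule that[OF J.Icarr[OF r(1)] r(2)], intro allI impI ballI)
    fix I x assume I: "ideal I R \<and> I \<noteq> carrier R" and x: "x \<in> I"
    then have "x \<in> M" using proper_ideal_subset_maximal[OF fin M] by blast
    then have "x \<otimes> r = \<zero>" using maximal_kills_minimal[OF fin M J(1,4) _ r(1)] by blast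
    moreover have "x \<in> carrier R" using I x ideal.Icarr by fastforce
    ultimately show "r \<otimes> x = \<zero>" using J.Icarr[OF r(1)] by (simp add: m_comm)
  qed
qed

text \<open>
  Minimal nonzero ideals below \<open>I\<close> and \<open>J\<close> generate a principal ideal that is killed by the
  maximal ideal. Thus every nonzero element of it is a unit multiple of its generator, which
  therefore lies in \<open>I\<close> and in \<open>J\<close>.
\<close>

lemma (in local_ring) intersection_zero_iff:
  assumes fin: "finite {I. ideal I R}" and prin: "principal_ideal_ring R"
    and I: "ideal I R" and J: "ideal J R"
  shows "I \<inter> J = {\<zero>} \<longleftrightarrow> I = {\<zero>} \<or> J = {\<zero>}"
proof
  assume IJ: "I \<inter> J = {\<zero>}"
  obtain M where M: "maximalideal M R" using ex1_maximalideal by blast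
  show "I = {\<zero>} \<or> J = {\<zero>}"
  proof (rule ccontr)
    assume "\<not> ?thesis"
    then have nz: "I \<noteq> {\<zero>}" "J \<noteq> {\<zero>}" by auto
    obtain A where A: "ideal A R" "A \<noteq> {\<zero>}" "A \<subseteq> I"
        "\<forall>J'. ideal J' R \<and> J' \<noteq> {\<zero>} \<and> J' \<subseteq> A \<longrightarrow> J' = A"
      by (rule minimal_nonzero_ideal[OF fin I nz(1)])
    obtain B where B: "ideal B R" "B \<noteq> {\<zero>}" "B \<subseteq> J"
        "\<forall>J'. ideal J' R \<and> J' \<noteq> {\<zero>} \<and> J' \<subseteq> B \<longrightarrow> J' = B"
      by (rule minimal_nonzero_ideal[OF fin J nz(2)])
    define S where "S = A <+>\<^bsub>R\<^esub> B"
    have AB: "ideal S R" unfolding S_def by (rule add_ideals[OF A(1) B(1)])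
    have "principalideal S R"
      by (rule principal_ideal_ring.principal[OF prin AB])
    then obtain t where t: "t \<in> carrier R" "S = PIdl t"
      using principalideal.generate[OF \<open>principalideal S R\<close>] cgenideal_eq_genideal by auto
    have killed: "m \<otimes> t = \<zero>" if m: "m \<in> M" for m
    proof -
      have "t \<in> S" using cgenideal_self[OF t(1)] t(2) by simp
      then obtain x y where xy: "x \<in> A" "y \<in> B" "t = x \<oplus> y"
        unfolding S_def set_add_def' by blast
      have "m \<otimes> x = \<zero>" "m \<otimes> y = \<zero>"
        using maximal_kills_minimal[OF fin M A(1,4) m xy(1)]
          maximal_kills_minimal[OF fin M B(1,4) m xy(2)] by auto
      moreover have "m \<in> carrier R" "x \<in> carrier R" "y \<in> carrier R"
        using ideal.Icarr[OF maximalideal.axioms(1)[OF M] m]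
          ideal.Icarr[OF A(1) xy(1)] ideal.Icarr[OF B(1) xy(2)] by blast+
      ultimately show ?thesis using xy(3) by (simp add: r_distr)
    qed
    have generator: "t \<in> C" if C: "ideal C R" "C \<noteq> {\<zero>}" "C \<subseteq> S" for C
    proof -
      interpret C: ideal C R by (rule C(1))
      obtain c where c: "c \<in> C" "c \<noteq> \<zero>" using C(2) C.zero_closed by blast
      then have "c \<in> PIdl t" using C(3) t(2) by auto
      then obtain a where a: "a \<in> carrier R" "c = a \<otimes> t" unfolding cgenideal_def by blast
      have "a \<notin> M" using killed[of a] a(2) c(2) by auto
      have "PIdl a = carrier R"
      proof (rule ccontr)
        assume "PIdl a \<noteq> carrier R"
        then have "PIdl a \<subseteq> M"
          by (intro proper_ideal_subset_maximal[OF fin M] cgenideal_ideal a(1))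
        with \<open>a \<notin> M\<close> cgenideal_self[OF a(1)] show False by blast
      qed
      then have "\<one> \<in> PIdl a" by simp
      then obtain b where b: "b \<in> carrier R" "\<one> = b \<otimes> a" unfolding cgenideal_def by blast
      have "b \<otimes> c = b \<otimes> a \<otimes> t" unfolding a(2) using a(1) b(1) t(1) by (simp add: m_assoc)
      also have "\<dots> = t" unfolding b(2)[symmetric] using t(1) by simp
      finally have "b \<otimes> c = t" .
      with C.I_l_closed[OF c(1) b(1)] show ?thesis by simp
    qed
    interpret A: ideal A R by (rule A(1))
    interpret B: ideal B R by (rule B(1))
    have "A \<subseteq> S"
    proof
      fix x assume x: "x \<in> A"
      then have "x = x \<oplus> \<zero>" using A.Icarr by simp
      then show "x \<in> S" using x B.zero_closed unfolding S_def set_add_def' by blast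
    qed
    moreover have "B \<subseteq> S"
    proof
      fix x assume x: "x \<in> B"
      then have "x = \<zero> \<oplus> x" using B.Icarr by simp
      then show "x \<in> S" using x A.zero_closed unfolding S_def set_add_def' by blast
    qed
    ultimately have "t \<in> A" "t \<in> B" using generator A B by blast+
    then have "t = \<zero>" using A(3) B(3) IJ by blast
    then have "PIdl t \<subseteq> {\<zero>}" by (auto simp: cgenideal_def)
    with \<open>A \<subseteq> S\<close> t(2) A(2) A.zero_closed show False by blast
  qed
next
  have "\<zero> \<in> I" "\<zero> \<in> J"
    using I J by (simp_all add: additive_subgroup.zero_closed ideal.axioms(1))
  then show "I \<inter> J = {\<zero>}" if "I = {\<zero>} \<or> J = {\<zero>}" using that by blast
qed


section \<open>Ideals of finite products\<close>

lemma RDirProd_list_Cons_hom: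
  assumes "a # as \<in> carrier (RDirProd_list (S # Ss))" "b # bs \<in> carrier (RDirProd_list (S # Ss))"
  shows "(a # as) \<otimes>\<^bsub>RDirProd_list (S # Ss)\<^esub> (b # bs) =
      (a \<otimes>\<^bsub>S\<^esub> b) # (as \<otimes>\<^bsub>RDirProd_list Ss\<^esub> bs)"
    and "(a # as) \<oplus>\<^bsub>RDirProd_list (S # Ss)\<^esub> (b # bs) =
      (a \<oplus>\<^bsub>S\<^esub> b) # (as \<oplus>\<^bsub>RDirProd_list Ss\<^esub> bs)"
proof -
  have car: "(a, as) \<in> carrier (RDirProd S (RDirProd_list Ss))"
      "(b, bs) \<in> carrier (RDirProd S (RDirProd_list Ss))"
    using assms by (auto simp: RDirProd_list_carrier RDirProd_carrier)
  show "(a # as) \<otimes>\<^bsub>RDirProd_list (S # Ss)\<^esub> (b # bs) =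
      (a \<otimes>\<^bsub>S\<^esub> b) # (as \<otimes>\<^bsub>RDirProd_list Ss\<^esub> bs)"
    using ring_hom_mult[OF RDirProd_list_hom1 car] by (simp add: RDirProd_def DirProd_def monoid.defs)
  show "(a # as) \<oplus>\<^bsub>RDirProd_list (S # Ss)\<^esub> (b # bs) =
      (a \<oplus>\<^bsub>S\<^esub> b) # (as \<oplus>\<^bsub>RDirProd_list Ss\<^esub> bs)"
    using ring_hom_add[OF RDirProd_list_hom1 car] by (simp add: RDirProd_def DirProd_def monoid.defs)
qed

lemma RDirProd_list_nth:
  assumes "x \<in> carrier (RDirProd_list Ss)" "y \<in> carrier (RDirProd_list Ss)" "i < length Ss"
  shows "(x \<otimes>\<^bsub>RDirProd_list Ss\<^esub> y) ! i = x ! i \<otimes>\<^bsub>Ss ! i\<^esub> y ! i"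
    and "(x \<oplus>\<^bsub>RDirProd_list Ss\<^esub> y) ! i = x ! i \<oplus>\<^bsub>Ss ! i\<^esub> y ! i"
proof -
  have "(x \<otimes>\<^bsub>RDirProd_list Ss\<^esub> y) ! i = x ! i \<otimes>\<^bsub>Ss ! i\<^esub> y ! i \<and>
    (x \<oplus>\<^bsub>RDirProd_list Ss\<^esub> y) ! i = x ! i \<oplus>\<^bsub>Ss ! i\<^esub> y ! i"
    using assms
  proof (induction Ss arbitrary: x y i)
    case (Cons S Ss)
    obtain a as b bs where xy: "x = a # as" "y = b # bs"
      and car: "as \<in> carrier (RDirProd_list Ss)" "bs \<in> carrier (RDirProd_list Ss)"
      using Cons.prems(1,2) by (auto simp: RDirProd_list_carrier)
    show ?case
      using RDirProd_list_Cons_hom[of a as S Ss b bs] Cons.prems Cons.IH[OF car] xy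
      by (cases i) auto
  qed simp
  then show "(x \<otimes>\<^bsub>RDirProd_list Ss\<^esub> y) ! i = x ! i \<otimes>\<^bsub>Ss ! i\<^esub> y ! i"
    "(x \<oplus>\<^bsub>RDirProd_list Ss\<^esub> y) ! i = x ! i \<oplus>\<^bsub>Ss ! i\<^esub> y ! i" by auto
qed

lemma RDirProd_list_nth_const:
  assumes "i < length Ss"
  shows "\<zero>\<^bsub>RDirProd_list Ss\<^esub> ! i = \<zero>\<^bsub>Ss ! i\<^esub>" "\<one>\<^bsub>RDirProd_list Ss\<^esub> ! i = \<one>\<^bsub>Ss ! i\<^esub>"
proof -
  have "foldr (\<lambda>S. (#) (c S)) Ss [] = map c Ss" for c :: "('a, 'b) ring_scheme \<Rightarrow> 'a"
    by (induction Ss) auto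
  then show "\<zero>\<^bsub>RDirProd_list Ss\<^esub> ! i = \<zero>\<^bsub>Ss ! i\<^esub>" "\<one>\<^bsub>RDirProd_list Ss\<^esub> ! i = \<one>\<^bsub>Ss ! i\<^esub>"
    using assms by (simp_all add: RDirProd_list_zero RDirProd_list_one)
qed

locale ring_product =
  fixes Rs :: "('a, 'm) ring_scheme list" and R :: "'a list ring" and n :: nat
  assumes len: "length Rs = n" and R_eq: "R = RDirProd_list Rs"
    and cring_factor: "i < n \<Longrightarrow> cring (Rs ! i)"
begin

lemma carrier_iff: "x \<in> carrier R \<longleftrightarrow> length x = n \<and> (\<forall>i<n. x ! i \<in> carrier (Rs ! i))"
  using RDirProd_list_carrier_mem[of x Rs] RDirProd_list_carrier_memI[of x Rs] len
  by (auto simp: R_eq)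

lemma nth_mult: "x \<in> carrier R \<Longrightarrow> y \<in> carrier R \<Longrightarrow> i < n \<Longrightarrow> (x \<otimes>\<^bsub>R\<^esub> y) ! i = x ! i \<otimes>\<^bsub>Rs ! i\<^esub> y ! i"
  and nth_add: "x \<in> carrier R \<Longrightarrow> y \<in> carrier R \<Longrightarrow> i < n \<Longrightarrow> (x \<oplus>\<^bsub>R\<^esub> y) ! i = x ! i \<oplus>\<^bsub>Rs ! i\<^esub> y ! i"
  and nth_zero: "i < n \<Longrightarrow> \<zero>\<^bsub>R\<^esub> ! i = \<zero>\<^bsub>Rs ! i\<^esub>"
  and nth_one: "i < n \<Longrightarrow> \<one>\<^bsub>R\<^esub> ! i = \<one>\<^bsub>Rs ! i\<^esub>"
  using RDirProd_list_nth[of x Rs y i] RDirProd_list_nth_const[of i Rs] len by (simp_all add: R_eq)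

lemma eqI:
  assumes "x \<in> carrier R" "y \<in> carrier R" "\<And>i. i < n \<Longrightarrow> x ! i = y ! i"
  shows "x = y"
  using assms by (intro nth_equalityI) (auto simp: carrier_iff)

lemma ring_R: "ring R"
  unfolding R_eq by (rule RDirProd_list_is_ring) (use cring_factor len cring.axioms(1) in auto)

lemma cring_R: "cring R"
proof -
  interpret ring R by (rule ring_R)
  show ?thesis
  proof unfold_locales
    fix x y assume xy: "x \<in> carrier R" "y \<in> carrier R"
    show "x \<otimes>\<^bsub>R\<^esub> y = y \<otimes>\<^bsub>R\<^esub> x"
    proof (rule eqI)
      fix i assume i: "i < n"
      interpret Ri: cring "Rs ! i" by (rule cring_factor[OF i])
      show "(x \<otimes>\<^bsub>R\<^esub> y) ! i = (y \<otimes>\<^bsub>R\<^esub> x) ! i"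
        using xy i by (simp add: nth_mult carrier_iff Ri.m_comm)
    qed (use xy in auto)
  qed
qed

sublocale R: cring R by (rule cring_R)

definition single :: "nat \<Rightarrow> 'a \<Rightarrow> 'a list" where
  "single i a = map (\<lambda>j. if j = i then a else \<zero>\<^bsub>Rs ! j\<^esub>) [0..<n]"

lemma single_nth: "j < n \<Longrightarrow> single i a ! j = (if j = i then a else \<zero>\<^bsub>Rs ! j\<^esub>)"
  by (simp add: single_def)

lemma single_closed: "i < n \<Longrightarrow> a \<in> carrier (Rs ! i) \<Longrightarrow> single i a \<in> carrier R"
  using cring_factor by (auto simp: carrier_iff single_nth cring.cring_simprules) (simp add: single_def)

lemma single_mult:
  assumes "i < n" "a \<in> carrier (Rs ! i)" "x \<in> carrier R"
  shows "single i a \<otimes>\<^bsub>R\<^esub> x = single i (a \<otimes>\<^bsub>Rs ! i\<^esub> x ! i)"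
proof (rule eqI)
  interpret Ri: cring "Rs ! i" by (rule cring_factor[OF assms(1)])
  show "single i (a \<otimes>\<^bsub>Rs ! i\<^esub> x ! i) \<in> carrier R"
    using assms by (intro single_closed) (auto simp: carrier_iff)
  fix j assume j: "j < n"
  interpret Rj: cring "Rs ! j" by (rule cring_factor[OF j])
  show "(single i a \<otimes>\<^bsub>R\<^esub> x) ! j = single i (a \<otimes>\<^bsub>Rs ! i\<^esub> x ! i) ! j"
    using assms j single_closed[OF assms(1,2)] by (simp add: nth_mult single_nth carrier_iff)
qed (use assms single_closed in auto)

definition proj :: "nat \<Rightarrow> 'a list set \<Rightarrow> 'a set" where
  "proj i I = (\<lambda>x. x ! i) ` I"

definition box :: "(nat \<Rightarrow> 'a set) \<Rightarrow> 'a list set" where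
  "box A = {x \<in> carrier R. \<forall>i<n. x ! i \<in> A i}"

lemma ideal_proj:
  assumes I: "ideal I R" and i: "i < n"
  shows "ideal (proj i I) (Rs ! i)"
proof -
  interpret I: ideal I R by (rule I)
  interpret Ri: cring "Rs ! i" by (rule cring_factor[OF i])
  show ?thesis
  proof (rule Ri.idealI_comm)
    show "proj i I \<subseteq> carrier (Rs ! i)"
      using I.Icarr i by (auto simp: proj_def carrier_iff)
    have "\<zero>\<^bsub>R\<^esub> ! i \<in> proj i I"
      unfolding proj_def using I.zero_closed by (rule imageI)
    then show "\<zero>\<^bsub>Rs ! i\<^esub> \<in> proj i I" by (simp add: nth_zero[OF i])
    show "x \<oplus>\<^bsub>Rs ! i\<^esub> y \<in> proj i I" if x: "x \<in> proj i I" and y: "y \<in> proj i I" for x y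
    proof -
      obtain x' where x': "x' \<in> I" "x = x' ! i" using x by (auto simp: proj_def)
      obtain y' where y': "y' \<in> I" "y = y' ! i" using y by (auto simp: proj_def)
      note xy = x' y'
      then have "x \<oplus>\<^bsub>Rs ! i\<^esub> y = (x' \<oplus>\<^bsub>R\<^esub> y') ! i"
        using nth_add[OF I.Icarr I.Icarr i] by simp
      with I.a_closed[OF x'(1) y'(1)] show ?thesis by (simp add: proj_def)
    qed
    show "r \<otimes>\<^bsub>Rs ! i\<^esub> y \<in> proj i I" if r: "r \<in> carrier (Rs ! i)" and y: "y \<in> proj i I" for r y
    proof -
      obtain x where x: "x \<in> I" "y = x ! i" using y by (auto simp: proj_def)
      have "single i r \<otimes>\<^bsub>R\<^esub> x \<in> I"
        by (rule I.I_l_closed[OF x(1) single_closed[OF i r]])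
      then have "(single i r \<otimes>\<^bsub>R\<^esub> x) ! i \<in> proj i I"
        unfolding proj_def by (rule imageI)
      then show ?thesis
        using x i by (simp add: single_mult[OF i r I.Icarr] single_nth)
    qed
  qed
qed

text \<open>
  A vector whose entries are entries of elements of \<open>I\<close> is built up from its initial
  segments, adding one entry at a time.
\<close>

lemma ideal_eq_box:
  assumes I: "ideal I R"
  shows "I = box (\<lambda>i. proj i I)"
proof
  interpret I: ideal I R by (rule I)
  show "I \<subseteq> box (\<lambda>i. proj i I)"
    using I.Icarr by (auto simp: box_def proj_def)
  show "box (\<lambda>i. proj i I) \<subseteq> I"
  proof
    fix x assume x: "x \<in> box (\<lambda>i. proj i I)"
    then have xR: "x \<in> carrier R" by (simp add: box_def)
    then have xi: "x ! i \<in> carrier (Rs ! i)" if "i < n" for i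
      using that by (simp add: carrier_iff)
    have single: "single i (x ! i) \<in> I" if i: "i < n" for i
    proof -
      interpret Ri: cring "Rs ! i" by (rule cring_factor[OF i])
      obtain y where y: "y \<in> I" "y ! i = x ! i"
        using x i by (auto simp: box_def proj_def)
      have "single i \<one>\<^bsub>Rs ! i\<^esub> \<otimes>\<^bsub>R\<^esub> y \<in> I"
        using y(1) i by (intro I.I_l_closed single_closed) auto
      then show ?thesis
        using single_mult[OF i Ri.one_closed I.Icarr[OF y(1)]] xi[OF i] y(2) by simp
    qed
    define prefix where "prefix k = map (\<lambda>j. if j < k then x ! j else \<zero>\<^bsub>Rs ! j\<^esub>) [0..<n]" for k
    have nth: "prefix k ! j = (if j < k then x ! j else \<zero>\<^bsub>Rs ! j\<^esub>)" if "j < n" for j k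
      using that by (simp add: prefix_def)
    have carr: "prefix k \<in> carrier R" for k
      using cring_factor xi by (auto simp: carrier_iff nth cring.cring_simprules) (simp add: prefix_def)
    have "prefix k \<in> I" if "k \<le> n" for k
      using that
    proof (induction k)
      case 0
      have "prefix 0 = \<zero>\<^bsub>R\<^esub>"
        by (rule eqI) (auto simp: carr nth nth_zero)
      then show ?case by (simp add: I.zero_closed)
    next
      case (Suc k)
      then have k: "k < n" by simp
      have "prefix (Suc k) = prefix k \<oplus>\<^bsub>R\<^esub> single k (x ! k)"
      proof (rule eqI)
        fix j assume j: "j < n"
        interpret Rj: cring "Rs ! j" by (rule cring_factor[OF j])
        show "prefix (Suc k) ! j = (prefix k \<oplus>\<^bsub>R\<^esub> single k (x ! k)) ! j"
          using Rj.l_zero[OF xi[OF j]] Rj.r_zero[OF xi[OF j]] single_closed[OF k xi[OF k]] j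
          by (auto simp: nth_add carr nth single_nth)
      qed (use carr single_closed[OF k xi[OF k]] in auto)
      with Suc single[OF k] I.a_closed show ?case by simp
    qed
    then have "prefix n \<in> I" by simp
    moreover have "prefix n = x"
      by (rule eqI) (auto simp: carr xR nth)
    ultimately show "x \<in> I" by simp
  qed
qed

lemma
  assumes A: "\<And>i. i < n \<Longrightarrow> ideal (A i) (Rs ! i)"
  shows ideal_box: "ideal (box A) R" and proj_box: "i < n \<Longrightarrow> proj i (box A) = A i"
proof -
  have zero: "\<zero>\<^bsub>Rs ! i\<^esub> \<in> A i" if "i < n" for i
    using A[OF that] by (simp add: additive_subgroup.zero_closed ideal.axioms(1))
  show "ideal (box A) R"
  proof (rule R.idealI_comm)
    show "x \<oplus>\<^bsub>R\<^esub> y \<in> box A" if "x \<in> box A" "y \<in> box A" for x y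
      using that A by (auto simp: box_def nth_add additive_subgroup.a_closed ideal.axioms(1))
    show "r \<otimes>\<^bsub>R\<^esub> x \<in> box A" if "r \<in> carrier R" "x \<in> box A" for r x
      using that A by (auto simp: box_def nth_mult carrier_iff[of r] ideal.I_l_closed)
  qed (use zero in \<open>auto simp: box_def nth_zero\<close>)
  show "proj i (box A) = A i" if i: "i < n"
  proof
    show "proj i (box A) \<subseteq> A i" using i by (auto simp: proj_def box_def)
    show "A i \<subseteq> proj i (box A)"
    proof
      fix a assume a: "a \<in> A i"
      then have "a \<in> carrier (Rs ! i)" using ideal.Icarr[OF A[OF i]] by blast
      then have "single i a \<in> box A"
        using single_closed[OF i] a zero by (auto simp: box_def single_nth)
      then show "a \<in> proj i (box A)"
        unfolding proj_def using single_nth[OF i, of i a] by (metis (full_types) imageI)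
    qed
  qed
qed

lemma ideal_eqI:
  assumes "ideal I R" "ideal J R" "\<And>i. i < n \<Longrightarrow> proj i I = proj i J"
  shows "I = J"
proof -
  have "I = box (\<lambda>i. proj i I)" by (rule ideal_eq_box[OF assms(1)])
  also have "\<dots> = box (\<lambda>i. proj i J)" using assms(3) by (auto simp: box_def)
  also have "\<dots> = J" by (rule ideal_eq_box[OF assms(2), symmetric])
  finally show ?thesis .
qed

lemma proj_carrier: "i < n \<Longrightarrow> proj i (carrier R) = carrier (Rs ! i)"
proof -
  assume i: "i < n"
  have "box (\<lambda>i. carrier (Rs ! i)) = carrier R" by (auto simp: box_def carrier_iff)
  moreover have "ideal (carrier (Rs ! j)) (Rs ! j)" if "j < n" for j
    using cring.axioms(1)[OF cring_factor[OF that]] by (rule ring.oneideal)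
  ultimately show ?thesis
    using proj_box[of "\<lambda>i. carrier (Rs ! i)" i] i by simp
qed

lemma proj_zero: "i < n \<Longrightarrow> proj i {\<zero>\<^bsub>R\<^esub>} = {\<zero>\<^bsub>Rs ! i\<^esub>}"
  by (simp add: proj_def nth_zero)

end


section \<open>Ideal graphs as disjointness graphs\<close>

lemma bij_betw_nat_sending_to_zero:
  assumes "finite A" "a \<in> A"
  obtains h where "bij_betw h A {..card A - 1}" "h a = (0::nat)"
proof -
  obtain g where g: "bij_betw g (A - {a}) {0..<card (A - {a})}"
    using ex_bij_betw_finite_nat[of "A - {a}"] assms(1) by blast
  define h where "h x = (if x = a then 0 else Suc (g x))" for x
  have "bij_betw h (insert a (A - {a})) (insert 0 (Suc ` {0..<card (A - {a})}))"
    unfolding bij_betw_def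
  proof
    show "inj_on h (insert a (A - {a}))"
      using g by (auto simp: h_def inj_on_def bij_betw_def)
    have "h ` (A - {a}) = Suc ` g ` (A - {a})" by (auto simp: h_def image_iff)
    also have "g ` (A - {a}) = {0..<card (A - {a})}" by (rule bij_betw_imp_surj_on[OF g])
    finally have "h ` (A - {a}) = Suc ` {0..<card (A - {a})}" .
    moreover have "h a = 0" by (simp add: h_def)
    ultimately show "h ` insert a (A - {a}) = insert 0 (Suc ` {0..<card (A - {a})})"
      by (simp only: image_insert)
  qed
  moreover have "insert 0 (Suc ` {0..<k}) = {..k}" for k
    by (auto simp: image_Suc_atLeastLessThan)
  ultimately have "bij_betw h A {..card A - 1}"
    using assms by (simp add: insert_absorb card_Diff_singleton)
  then show thesis by (rule that) (simp add: h_def)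
qed

text \<open>
  Ideals of the product correspond to vectors of ideals of the factors. Marking in every
  factor one ideal as the origin turns these into vectors of numbers, where the support of
  an ideal consists of the factors in which its component is not the marked one. The two
  trivial ideals are excluded as vertices; one of them is the origin and the other one
  has full support.
\<close>

lemma (in ring_product) disjointness_ideal_graph:
  assumes n_pos: "n \<ge> 1" and fin: "\<And>i. i < n \<Longrightarrow> finite {I. ideal I (Rs ! i)}"
    and oe: "\<And>i. i < n \<Longrightarrow> ideal (a i) (Rs ! i)" "\<And>i. i < n \<Longrightarrow> ideal (b i) (Rs ! i)"
      "\<And>i. i < n \<Longrightarrow> a i \<noteq> b i"
    and trivial: "{box a, box b} = {{\<zero>\<^bsub>R\<^esub>}, carrier R}"
    and adj: "\<And>I J. I \<in> nontrivial_ideals R \<Longrightarrow> J \<in> nontrivial_ideals R \<Longrightarrow>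
      adj I J \<longleftrightarrow> (\<forall>i<n. proj i I = a i \<or> proj i J = a i)"
  shows "\<exists>\<phi> f. disjointness_graph (ideal_graph R adj) n (\<lambda>i. card {I. ideal I (Rs ! i)} - 1) \<phi> f"
proof -
  define A where "A i = {I. ideal I (Rs ! i)}" for i
  define K where "K i = card (A i) - 1" for i
  have finA: "finite (A i)" if "i < n" for i using fin[OF that] by (simp add: A_def)
  have "\<forall>i\<in>{..<n}. \<exists>h. bij_betw h (A i) {..K i} \<and> h (a i) = 0"
  proof
    fix i assume "i \<in> {..<n}"
    then have "finite (A i)" "a i \<in> A i" using finA oe(1) by (simp_all add: A_def)
    then obtain h where "bij_betw h (A i) {..K i}" "h (a i) = 0"
      unfolding K_def by (rule bij_betw_nat_sending_to_zero)
    then show "\<exists>h. bij_betw h (A i) {..K i} \<and> h (a i) = 0" by blast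
  qed
  from bchoice[OF this] obtain h where
    "\<forall>i\<in>{..<n}. bij_betw (h i) (A i) {..K i} \<and> h i (a i) = 0" by blast
  then have h: "bij_betw (h i) (A i) {..K i}" and h0: "h i (a i) = 0" if "i < n" for i
    using that by simp_all
  have h_eq: "h i I = h i J \<longleftrightarrow> I = J" if "i < n" "I \<in> A i" "J \<in> A i" for i I J
    using h[OF that(1)] that by (auto simp: bij_betw_def inj_on_def)
  have h_le: "h i I \<le> K i" if "i < n" "I \<in> A i" for i I
    using bij_betwE[OF h[OF that(1)]] that(2) by auto
  define \<phi> where "\<phi> I = (\<lambda>i\<in>{..<n}. h i (proj i I))" for I
  define f where "f = (\<lambda>i\<in>{..<n}. h i (b i))"
  have projA: "proj i I \<in> A i" if "ideal I R" "i < n" for i I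
    using ideal_proj[OF that] by (simp add: A_def)
  have oA: "a i \<in> A i" and eA: "b i \<in> A i" if "i < n" for i
    using oe[OF that] by (simp_all add: A_def)
  have \<phi>_0: "\<phi> I i = 0 \<longleftrightarrow> proj i I = a i" if "ideal I R" "i < n" for I i
    using h_eq[OF that(2) projA[OF that] oA[OF that(2)]] h0[OF that(2)] that by (simp add: \<phi>_def)
  have e_pos: "1 \<le> h i (b i)" if "i < n" for i
    using h_eq[OF that eA[OF that] oA[OF that]] h0[OF that] oe(3)[OF that] by fastforce
  have \<phi>_inj: "I = J" if "ideal I R" "ideal J R" "\<phi> I = \<phi> J" for I J
  proof (rule ideal_eqI[OF that(1,2)])
    fix i assume i: "i < n"
    have "\<phi> I i = \<phi> J i" using that(3) by simp
    with i show "proj i I = proj i J"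
      using h_eq[OF i projA[OF that(1) i] projA[OF that(2) i]] by (simp add: \<phi>_def)
  qed
  have proj_oe: "proj i (box a) = a i" "proj i (box b) = b i" if "i < n" for i
    using proj_box[of a i] proj_box[of b i] oe that by blast+
  have \<phi>_oe: "\<phi> (box a) = (\<lambda>i\<in>{..<n}. 0)" "\<phi> (box b) = f"
    unfolding \<phi>_def f_def by (rule restrict_ext; simp add: proj_oe h0)+
  have ideal_oe: "ideal (box a) R" "ideal (box b) R"
    by (rule ideal_box, simp add: oe)+
  have V: "I \<in> nontrivial_ideals R \<longleftrightarrow> ideal I R \<and> I \<noteq> box a \<and> I \<noteq> box b" for I
  proof -
    have "I \<in> {box a, box b} \<longleftrightarrow> I \<in> {{\<zero>\<^bsub>R\<^esub>}, carrier R}" by (simp only: trivial)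
    then show ?thesis by (auto simp: nontrivial_ideals_def)
  qed
  have "disjointness_graph (ideal_graph R adj) n K \<phi> f"
  proof
    show "n \<ge> 1" by (rule n_pos)
    show "K i \<ge> 1" if "i < n" for i
      using e_pos[OF that] h_le[OF that eA[OF that]] by linarith
    show "f \<in> (\<Pi>\<^sub>E i\<in>{..<n}. {1..K i})"
      using e_pos h_le eA by (auto simp: f_def)
    show "bij_betw \<phi> (verts (ideal_graph R adj)) ((\<Pi>\<^sub>E i\<in>{..<n}. {..K i}) - {\<lambda>i\<in>{..<n}. 0, f})"
    proof (intro bij_betw_imageI equalityI subsetI)
      show "inj_on \<phi> (verts (ideal_graph R adj))"
        using \<phi>_inj by (auto simp: inj_on_def ideal_graph_def V)
    next
      fix y assume "y \<in> \<phi> ` verts (ideal_graph R adj)"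
      then obtain I where IV: "y = \<phi> I" "I \<in> verts (ideal_graph R adj)" by (rule imageE)
      then have I: "ideal I R" "I \<noteq> box a" "I \<noteq> box b" "y = \<phi> I"
        by (simp_all add: ideal_graph_def V)
      have "y \<noteq> (\<lambda>i\<in>{..<n}. 0)" "y \<noteq> f"
        using \<phi>_inj[OF I(1) ideal_oe(1)] \<phi>_inj[OF I(1) ideal_oe(2)] I \<phi>_oe by auto
      moreover have "y \<in> (\<Pi>\<^sub>E i\<in>{..<n}. {..K i})"
        using h_le projA[OF I(1)] by (auto simp: I(4) \<phi>_def)
      ultimately show "y \<in> (\<Pi>\<^sub>E i\<in>{..<n}. {..K i}) - {\<lambda>i\<in>{..<n}. 0, f}" by blast
    next
      fix y assume y: "y \<in> (\<Pi>\<^sub>E i\<in>{..<n}. {..K i}) - {\<lambda>i\<in>{..<n}. 0, f}"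
      then have yP: "y \<in> (\<Pi>\<^sub>E i\<in>{..<n}. {..K i})" by blast
      define B where "B i = inv_into (A i) (h i) (y i)" for i
      have B: "B i \<in> A i" "h i (B i) = y i" if "i < n" for i
      proof -
        have "y i \<in> h i ` A i"
          using PiE_mem[OF yP, of i] that bij_betw_imp_surj_on[OF h[OF that]] by simp
        then show "B i \<in> A i" "h i (B i) = y i"
          unfolding B_def by (rule inv_into_into, rule f_inv_into_f)
      qed
      then have idB: "\<And>i. i < n \<Longrightarrow> ideal (B i) (Rs ! i)" by (simp add: A_def)
      have "\<phi> (box B) = y"
      proof
        fix i show "\<phi> (box B) i = y i"
          using B(2)[of i] proj_box[OF idB, of i] PiE_arb[OF yP, of i] by (cases "i < n") (auto simp: \<phi>_def)
      qed
      moreover have "box B \<noteq> box a" "box B \<noteq> box b"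
        using calculation y \<phi>_oe by auto
      then have "box B \<in> verts (ideal_graph R adj)"
        using ideal_box[OF idB] by (simp add: ideal_graph_def V)
      ultimately show "y \<in> \<phi> ` verts (ideal_graph R adj)"
        by blast
    qed
    have D: "(\<forall>i<n. \<phi> I i = 0 \<or> \<phi> J i = 0) \<longleftrightarrow> (\<forall>i<n. proj i I = a i \<or> proj i J = a i)"
      if "I \<in> nontrivial_ideals R" "J \<in> nontrivial_ideals R" for I J
      using \<phi>_0 that V by simp
    have ne: "I \<noteq> J" if IJ: "I \<in> nontrivial_ideals R" "\<forall>i<n. proj i I = a i \<or> proj i J = a i" for I J
    proof
      assume "I = J"
      with IJ(2) have "I = box a"
        using IJ(1) proj_oe(1) by (intro ideal_eqI[OF _ ideal_oe(1)]) (auto simp: V)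
      with IJ(1) V show False by blast
    qed
    have edge: "I \<noteq> J \<and> adj I J \<longleftrightarrow> (\<forall>i<n. \<phi> I i = 0 \<or> \<phi> J i = 0)"
      if "I \<in> nontrivial_ideals R" "J \<in> nontrivial_ideals R" for I J
      using adj[OF that] ne[OF that(1), of J] unfolding D[OF that] by argo
    show "edges (ideal_graph R adj) = {{I, J} |I J. I \<in> verts (ideal_graph R adj) \<and>
        J \<in> verts (ideal_graph R adj) \<and> (\<forall>i<n. \<phi> I i = 0 \<or> \<phi> J i = 0)}"
      unfolding ideal_graph_def ugraph.simps
      by (intro Collect_cong ex_cong1 conj_cong refl) (rule edge)
  qed
  then show ?thesis unfolding K_def A_def by blast
qed

lemma ideal_graph_cong:
  assumes "\<And>I J. I \<in> nontrivial_ideals R \<Longrightarrow> J \<in> nontrivial_ideals R \<Longrightarrow> adj I J \<longleftrightarrow> adj' I J"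
  shows "ideal_graph R adj = ideal_graph R adj'"
proof -
  have "{{I, J} |I J. I \<in> nontrivial_ideals R \<and> J \<in> nontrivial_ideals R \<and> I \<noteq> J \<and> adj I J} =
    {{I, J} |I J. I \<in> nontrivial_ideals R \<and> J \<in> nontrivial_ideals R \<and> I \<noteq> J \<and> adj' I J}"
    using assms by (metis (no_types, opaque_lifting))
  then show ?thesis by (simp add: ideal_graph_def)
qed

lemma graph_complement_ideal_graph:
  assumes sym: "\<And>I J. I \<in> nontrivial_ideals R \<Longrightarrow> J \<in> nontrivial_ideals R \<Longrightarrow> adj I J \<Longrightarrow> adj J I"
  shows "graph_complement (ideal_graph R adj) = ideal_graph R (\<lambda>I J. \<not> adj I J)"
proof -
  let ?V = "nontrivial_ideals R"
  have edge: "{I, J} \<in> edges (ideal_graph R P) \<longleftrightarrow> P I J"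
    if V: "I \<in> ?V" "J \<in> ?V" "I \<noteq> J"
      and P: "\<And>I J. I \<in> ?V \<Longrightarrow> J \<in> ?V \<Longrightarrow> P I J \<Longrightarrow> P J I" for I J P
    using V P by (auto simp: ideal_graph_def doubleton_eq_iff)
  have "nsets ?V 2 - edges (ideal_graph R adj) = edges (ideal_graph R (\<lambda>I J. \<not> adj I J))"
  proof (intro equalityI subsetI)
    fix x assume x: "x \<in> nsets ?V 2 - edges (ideal_graph R adj)"
    then have "x \<in> nsets ?V 2" by simp
    then obtain I J where IJ: "x = {I, J}" "I \<in> ?V" "J \<in> ?V" "I \<noteq> J" by (rule nsets2_E)
    have "{I, J} \<in> edges (ideal_graph R adj) \<longleftrightarrow> adj I J"
      by (rule edge[OF IJ(2-4)]) (rule sym)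
    with x IJ(1) have "\<not> adj I J" by blast
    with IJ show "x \<in> edges (ideal_graph R (\<lambda>I J. \<not> adj I J))"
      by (auto simp: ideal_graph_def)
  next
    fix x assume "x \<in> edges (ideal_graph R (\<lambda>I J. \<not> adj I J))"
    then obtain I J where IJ: "x = {I, J}" "I \<in> ?V" "J \<in> ?V" "I \<noteq> J" "\<not> adj I J"
      by (auto simp: ideal_graph_def)
    have "{I, J} \<in> edges (ideal_graph R adj) \<longleftrightarrow> adj I J"
      by (rule edge[OF IJ(2-4)]) (rule sym)
    with IJ have "x \<notin> edges (ideal_graph R adj)" by blast
    with IJ show "x \<in> nsets ?V 2 - edges (ideal_graph R adj)" by simp
  qed
  then show ?thesis by (simp add: graph_complement_def ideal_graph_def)
qed

locale local_product = ring_product Rs R n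
  for Rs :: "('a, 'm) ring_scheme list" and R :: "'a list ring" and n :: nat +
  assumes local_factor: "i < n \<Longrightarrow> local_ring (Rs ! i)"
    and finite_ideals: "i < n \<Longrightarrow> finite {I. ideal I (Rs ! i)}"
begin

lemma add_subset:
  assumes "ideal I R" "ideal J R"
  shows "I \<subseteq> I <+>\<^bsub>R\<^esub> J" "J \<subseteq> I <+>\<^bsub>R\<^esub> J"
proof -
  interpret I: ideal I R by (rule assms)
  interpret J: ideal J R by (rule assms)
  show "I \<subseteq> I <+>\<^bsub>R\<^esub> J"
  proof
    fix x assume x: "x \<in> I"
    then have "x = x \<oplus>\<^bsub>R\<^esub> \<zero>\<^bsub>R\<^esub>" using I.Icarr by simp
    then show "x \<in> I <+>\<^bsub>R\<^esub> J" using x J.zero_closed unfolding set_add_def' by blast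
  qed
  show "J \<subseteq> I <+>\<^bsub>R\<^esub> J"
  proof
    fix x assume x: "x \<in> J"
    then have "x = \<zero>\<^bsub>R\<^esub> \<oplus>\<^bsub>R\<^esub> x" using J.Icarr by simp
    then show "x \<in> I <+>\<^bsub>R\<^esub> J" using x I.zero_closed unfolding set_add_def' by blast
  qed
qed

lemma kills_add_iff:
  assumes "ideal I R" "ideal J R" "r \<in> carrier R"
  shows "(\<forall>x\<in>I <+>\<^bsub>R\<^esub> J. r \<otimes>\<^bsub>R\<^esub> x = \<zero>\<^bsub>R\<^esub>) \<longleftrightarrow>
    (\<forall>x\<in>I. r \<otimes>\<^bsub>R\<^esub> x = \<zero>\<^bsub>R\<^esub>) \<and> (\<forall>x\<in>J. r \<otimes>\<^bsub>R\<^esub> x = \<zero>\<^bsub>R\<^esub>)"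
proof
  assume K: "(\<forall>x\<in>I. r \<otimes>\<^bsub>R\<^esub> x = \<zero>\<^bsub>R\<^esub>) \<and> (\<forall>x\<in>J. r \<otimes>\<^bsub>R\<^esub> x = \<zero>\<^bsub>R\<^esub>)"
  show "\<forall>x\<in>I <+>\<^bsub>R\<^esub> J. r \<otimes>\<^bsub>R\<^esub> x = \<zero>\<^bsub>R\<^esub>"
  proof
    fix x assume "x \<in> I <+>\<^bsub>R\<^esub> J"
    then obtain a b where ab: "a \<in> I" "b \<in> J" "x = a \<oplus>\<^bsub>R\<^esub> b" unfolding set_add_def' by blast
    then show "r \<otimes>\<^bsub>R\<^esub> x = \<zero>\<^bsub>R\<^esub>"
      using K assms(3) ideal.Icarr[OF assms(1) ab(1)] ideal.Icarr[OF assms(2) ab(2)]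
      by (simp add: R.r_distr)
  qed
qed (use add_subset[OF assms(1,2)] in blast)

text \<open>
  If \<open>I + J\<close> contains \<open>1\<close>, only \<open>0\<close> kills it. If both components at some \<open>i\<close> are proper, they have
  a common nonzero annihilator in the local factor, and the vector that has it as its only
  nonzero entry kills \<open>I + J\<close>.
\<close>

lemma comaximal_iff:
  assumes I: "ideal I R" and J: "ideal J R"
  shows "I <+>\<^bsub>R\<^esub> J = carrier R \<longleftrightarrow>
      (\<forall>i<n. proj i I = carrier (Rs ! i) \<or> proj i J = carrier (Rs ! i))" (is "?C \<longleftrightarrow> ?D")
    and "(\<exists>r\<in>carrier R. r \<noteq> \<zero>\<^bsub>R\<^esub> \<and> (\<forall>x\<in>I <+>\<^bsub>R\<^esub> J. r \<otimes>\<^bsub>R\<^esub> x = \<zero>\<^bsub>R\<^esub>)) \<longleftrightarrow>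
      \<not> (\<forall>i<n. proj i I = carrier (Rs ! i) \<or> proj i J = carrier (Rs ! i))" (is "?A \<longleftrightarrow> _")
proof -
  have S: "ideal (I <+>\<^bsub>R\<^esub> J) R" by (rule R.add_ideals[OF I J])
  have DC: ?C if D: ?D
  proof (rule ideal_eqI[OF S R.oneideal])
    fix i assume i: "i < n"
    have "proj i I \<subseteq> proj i (I <+>\<^bsub>R\<^esub> J)" "proj i J \<subseteq> proj i (I <+>\<^bsub>R\<^esub> J)"
      unfolding proj_def using add_subset[OF I J] by (auto intro: image_mono)
    moreover have "proj i (I <+>\<^bsub>R\<^esub> J) \<subseteq> carrier (Rs ! i)"
      using ideal.Icarr[OF ideal_proj[OF S i]] by blast
    ultimately show "proj i (I <+>\<^bsub>R\<^esub> J) = proj i (carrier R)"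
      using D i proj_carrier[OF i] by blast
  qed
  have CA: "\<not> ?A" if C: ?C
  proof
    assume ?A
    then obtain r where r: "r \<in> carrier R" "r \<noteq> \<zero>\<^bsub>R\<^esub>" "\<forall>x\<in>I <+>\<^bsub>R\<^esub> J. r \<otimes>\<^bsub>R\<^esub> x = \<zero>\<^bsub>R\<^esub>" by blast
    then have "\<forall>x\<in>carrier R. r \<otimes>\<^bsub>R\<^esub> x = \<zero>\<^bsub>R\<^esub>" using C by simp
    then have "r \<otimes>\<^bsub>R\<^esub> \<one>\<^bsub>R\<^esub> = \<zero>\<^bsub>R\<^esub>" using R.one_closed by blast
    with r(1,2) show False by simp
  qed
  have AD: ?A if nD: "\<not> ?D"
  proof -
    obtain i where i: "i < n" "proj i I \<noteq> carrier (Rs ! i)" "proj i J \<noteq> carrier (Rs ! i)"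
      using nD by blast
    interpret Ri: local_ring "Rs ! i" by (rule local_factor[OF i(1)])
    obtain a where a: "a \<in> carrier (Rs ! i)" "a \<noteq> \<zero>\<^bsub>Rs ! i\<^esub>"
      and kill: "\<forall>L. ideal L (Rs ! i) \<and> L \<noteq> carrier (Rs ! i) \<longrightarrow> (\<forall>x\<in>L. a \<otimes>\<^bsub>Rs ! i\<^esub> x = \<zero>\<^bsub>Rs ! i\<^esub>)"
      by (rule Ri.common_annihilator_of_proper_ideals[OF finite_ideals[OF i(1)]])
    have sR: "single i a \<in> carrier R" by (rule single_closed[OF i(1) a(1)])
    have s0: "single i \<zero>\<^bsub>Rs ! i\<^esub> = \<zero>\<^bsub>R\<^esub>"
      by (rule eqI) (auto simp: single_closed[OF i(1)] single_nth nth_zero)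
    have k: "single i a \<otimes>\<^bsub>R\<^esub> x = \<zero>\<^bsub>R\<^esub>"
      if "ideal L R" "proj i L \<noteq> carrier (Rs ! i)" "x \<in> L" for L x
    proof -
      have "x ! i \<in> proj i L" using that(3) by (simp add: proj_def)
      then have "a \<otimes>\<^bsub>Rs ! i\<^esub> x ! i = \<zero>\<^bsub>Rs ! i\<^esub>" using kill ideal_proj[OF that(1) i(1)] that(2) by blast
      then show ?thesis
        using single_mult[OF i(1) a(1) ideal.Icarr[OF that(1,3)]] s0 by simp
    qed
    have "single i a \<noteq> \<zero>\<^bsub>R\<^esub>"
    proof
      assume "single i a = \<zero>\<^bsub>R\<^esub>"
      then have "single i a ! i = \<zero>\<^bsub>Rs ! i\<^esub>" using nth_zero[OF i(1)] by simp
      with a(2) i(1) show False by (simp add: single_nth)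
    qed
    moreover have "\<forall>x\<in>I <+>\<^bsub>R\<^esub> J. single i a \<otimes>\<^bsub>R\<^esub> x = \<zero>\<^bsub>R\<^esub>"
      unfolding kills_add_iff[OF I J sR] using k[OF I i(2)] k[OF J i(3)] by blast
    ultimately show ?A using sR by blast
  qed
  show "?C \<longleftrightarrow> ?D" "?A \<longleftrightarrow> \<not> ?D" using DC CA AD by blast+
qed

lemma nontrivialD: "I \<in> nontrivial_ideals R \<Longrightarrow> ideal I R"
  by (simp add: nontrivial_ideals_def)

lemma comaximal_eq_coannihilating: "comaximal_graph R = coannihilating_ideal_graph R"
  unfolding comaximal_graph_def coannihilating_ideal_graph_def
proof (rule ideal_graph_cong)
  fix I J assume "I \<in> nontrivial_ideals R" "J \<in> nontrivial_ideals R"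
  then have IJ: "ideal I R" "ideal J R" by (simp_all add: nontrivialD)
  have "\<zero>\<^bsub>R\<^esub> \<in> annihilator R I \<inter> annihilator R J"
    using ideal.Icarr[OF IJ(1)] ideal.Icarr[OF IJ(2)] by (auto simp: annihilator_def)
  then have "annihilator R I \<inter> annihilator R J = {\<zero>\<^bsub>R\<^esub>} \<longleftrightarrow>
      \<not> (\<exists>r\<in>carrier R. r \<noteq> \<zero>\<^bsub>R\<^esub> \<and> r \<in> annihilator R I \<inter> annihilator R J)"
    by (auto simp: annihilator_def)
  also have "\<dots> \<longleftrightarrow> \<not> (\<exists>r\<in>carrier R. r \<noteq> \<zero>\<^bsub>R\<^esub> \<and> (\<forall>x\<in>I <+>\<^bsub>R\<^esub> J. r \<otimes>\<^bsub>R\<^esub> x = \<zero>\<^bsub>R\<^esub>))"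
    using kills_add_iff[OF IJ] by (simp add: annihilator_def cong: bex_cong)
  finally show "I <+>\<^bsub>R\<^esub> J = carrier R \<longleftrightarrow> annihilator R I \<inter> annihilator R J = {\<zero>\<^bsub>R\<^esub>}"
    by (simp only: comaximal_iff[OF IJ] not_not)
qed

lemma comaximal_eq_complement_annihilating:
  "comaximal_graph R = graph_complement (annihilating_ideal_graph R)"
proof -
  have "graph_complement (annihilating_ideal_graph R) = ideal_graph R
      (\<lambda>I J. \<not> (\<exists>r\<in>carrier R. r \<noteq> \<zero>\<^bsub>R\<^esub> \<and> (\<forall>x\<in>I <+>\<^bsub>R\<^esub> J. r \<otimes>\<^bsub>R\<^esub> x = \<zero>\<^bsub>R\<^esub>)))"
    unfolding annihilating_ideal_graph_def
  proof (rule graph_complement_ideal_graph)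
    fix I J assume IJ: "I \<in> nontrivial_ideals R" "J \<in> nontrivial_ideals R"
      and "\<exists>r\<in>carrier R. r \<noteq> \<zero>\<^bsub>R\<^esub> \<and> (\<forall>x\<in>I <+>\<^bsub>R\<^esub> J. r \<otimes>\<^bsub>R\<^esub> x = \<zero>\<^bsub>R\<^esub>)"
    then show "\<exists>r\<in>carrier R. r \<noteq> \<zero>\<^bsub>R\<^esub> \<and> (\<forall>x\<in>J <+>\<^bsub>R\<^esub> I. r \<otimes>\<^bsub>R\<^esub> x = \<zero>\<^bsub>R\<^esub>)"
      by (simp only: comaximal_iff(2) nontrivialD disj_commute not_False_eq_True)
  qed
  also have "\<dots> = comaximal_graph R"
    unfolding comaximal_graph_def
    by (rule ideal_graph_cong) (simp only: comaximal_iff nontrivialD not_not)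
  finally show ?thesis by simp
qed

lemma trivial_ideals_factor:
  assumes "i < n"
  shows "ideal (carrier (Rs ! i)) (Rs ! i)" "ideal {\<zero>\<^bsub>Rs ! i\<^esub>} (Rs ! i)"
    "carrier (Rs ! i) \<noteq> {\<zero>\<^bsub>Rs ! i\<^esub>}"
proof -
  interpret Ri: local_ring "Rs ! i" by (rule local_factor[OF assms])
  show "ideal (carrier (Rs ! i)) (Rs ! i)" "ideal {\<zero>\<^bsub>Rs ! i\<^esub>} (Rs ! i)"
    "carrier (Rs ! i) \<noteq> {\<zero>\<^bsub>Rs ! i\<^esub>}"
    by (rule Ri.oneideal Ri.zeroideal Ri.zero_ideal_proper)+
qed

lemma box_trivial: "box (\<lambda>i. carrier (Rs ! i)) = carrier R" "box (\<lambda>i. {\<zero>\<^bsub>Rs ! i\<^esub>}) = {\<zero>\<^bsub>R\<^esub>}"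
proof -
  show "box (\<lambda>i. carrier (Rs ! i)) = carrier R" by (auto simp: box_def carrier_iff)
  show "box (\<lambda>i. {\<zero>\<^bsub>Rs ! i\<^esub>}) = {\<zero>\<^bsub>R\<^esub>}"
    by (auto simp: box_def nth_zero intro: eqI)
qed

lemma field_iff:
  assumes i: "i < n"
  shows "field (Rs ! i) \<longleftrightarrow> card {I. ideal I (Rs ! i)} - 1 = 1"
proof -
  interpret Ri: local_ring "Rs ! i" by (rule local_factor[OF i])
  let ?A = "{I. ideal I (Rs ! i)}" and ?T = "{{\<zero>\<^bsub>Rs ! i\<^esub>}, carrier (Rs ! i)}"
  have T: "?T \<subseteq> ?A" "card ?T = 2" using trivial_ideals_factor[OF i] by auto
  have "field (Rs ! i) \<longleftrightarrow> ?A = ?T"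
    using Ri.trivialideals_eq_field[OF Ri.zero_ideal_proper] by simp
  also have "\<dots> \<longleftrightarrow> card ?A = 2"
    using card_subset_eq[OF finite_ideals[OF i] T(1)] T(2) by auto
  also have "\<dots> \<longleftrightarrow> card ?A - 1 = 1" by linarith
  finally show ?thesis .
qed

lemma comaximal_disjointness_graph:
  assumes "n \<ge> 1"
  shows "\<exists>\<phi> f. disjointness_graph (comaximal_graph R) n (\<lambda>i. card {I. ideal I (Rs ! i)} - 1) \<phi> f"
  unfolding comaximal_graph_def
proof (rule disjointness_ideal_graph[OF assms finite_ideals])
  show "{box (\<lambda>i. carrier (Rs ! i)), box (\<lambda>i. {\<zero>\<^bsub>Rs ! i\<^esub>})} = {{\<zero>\<^bsub>R\<^esub>}, carrier R}"
    by (simp add: box_trivial insert_commute)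
qed (use trivial_ideals_factor comaximal_iff(1) nontrivialD in auto)

lemma intersection_zero_iff:
  assumes prin: "\<And>i. i < n \<Longrightarrow> principal_ideal_ring (Rs ! i)" and I: "ideal I R" and J: "ideal J R"
  shows "I \<inter> J = {\<zero>\<^bsub>R\<^esub>} \<longleftrightarrow> (\<forall>i<n. proj i I = {\<zero>\<^bsub>Rs ! i\<^esub>} \<or> proj i J = {\<zero>\<^bsub>Rs ! i\<^esub>})"
proof -
  have cap: "ideal (I \<inter> J) R" by (rule R.i_intersect[OF I J])
  have "I \<inter> J = box (\<lambda>i. proj i I \<inter> proj i J)"
  proof -
    have "I \<inter> J = box (\<lambda>i. proj i I) \<inter> box (\<lambda>i. proj i J)"
      using ideal_eq_box[OF I] ideal_eq_box[OF J] by argo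
    also have "\<dots> = box (\<lambda>i. proj i I \<inter> proj i J)" by (auto simp: box_def)
    finally show ?thesis .
  qed
  moreover have "ideal (proj i I \<inter> proj i J) (Rs ! i)" if "i < n" for i
    using ring.i_intersect[OF cring.axioms(1)[OF cring_factor[OF that]]]
      ideal_proj[OF I that] ideal_proj[OF J that] by blast
  ultimately have proj_cap: "proj i (I \<inter> J) = proj i I \<inter> proj i J" if "i < n" for i
    using proj_box[of "\<lambda>i. proj i I \<inter> proj i J" i] that by simp
  have "I \<inter> J = {\<zero>\<^bsub>R\<^esub>} \<longleftrightarrow> (\<forall>i<n. proj i (I \<inter> J) = {\<zero>\<^bsub>Rs ! i\<^esub>})"
    using ideal_eqI[OF cap R.zeroideal] proj_zero by auto
  also have "\<dots> \<longleftrightarrow> (\<forall>i<n. proj i I = {\<zero>\<^bsub>Rs ! i\<^esub>} \<or> proj i J = {\<zero>\<^bsub>Rs ! i\<^esub>})"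
    using local_ring.intersection_zero_iff[OF local_factor finite_ideals prin] ideal_proj I J proj_cap
    by simp
  finally show ?thesis .
qed

lemma intersection_disjointness_graph:
  assumes "n \<ge> 1" and prin: "\<And>i. i < n \<Longrightarrow> principal_ideal_ring (Rs ! i)"
  shows "\<exists>\<phi> f. disjointness_graph (graph_complement (intersection_graph R)) n
    (\<lambda>i. card {I. ideal I (Rs ! i)} - 1) \<phi> f"
proof -
  have "graph_complement (intersection_graph R) = ideal_graph R (\<lambda>I J. \<not> I \<inter> J \<noteq> {\<zero>\<^bsub>R\<^esub>})"
    unfolding intersection_graph_def by (rule graph_complement_ideal_graph) (simp add: Int_commute)
  moreover have "\<exists>\<phi> f. disjointness_graph (ideal_graph R (\<lambda>I J. \<not> I \<inter> J \<noteq> {\<zero>\<^bsub>R\<^esub>})) n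
    (\<lambda>i. card {I. ideal I (Rs ! i)} - 1) \<phi> f"
  proof (rule disjointness_ideal_graph[OF assms(1) finite_ideals])
    show "{box (\<lambda>i. {\<zero>\<^bsub>Rs ! i\<^esub>}), box (\<lambda>i. carrier (Rs ! i))} = {{\<zero>\<^bsub>R\<^esub>}, carrier R}"
      by (simp add: box_trivial)
  qed (use trivial_ideals_factor trivial_ideals_factor(3)[symmetric] intersection_zero_iff[OF prin]
      nontrivialD in auto)
  ultimately show ?thesis by simp
qed

end

lemma disjointness_graph_properties:
  assumes "\<exists>\<phi> f. disjointness_graph G n K \<phi> f"
  shows "chordal G \<longleftrightarrow> n = 1 \<or> n = 2 \<and> (\<exists>i<n. K i = 1) \<or> n = 3 \<and> (\<forall>i<n. K i = 1)"
    and "chordal (graph_complement G) \<longleftrightarrow> n \<le> 3" and "perfect_graph G \<longleftrightarrow> n \<le> 4"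
    and "total_coloring_conjecture G" and "total_coloring_conjecture (graph_complement G)"
    and "edge_chromatic_number G = max_degree G"
proof -
  obtain \<phi> f where "disjointness_graph G n K \<phi> f" using assms by blast
  then interpret disjointness_graph G n K \<phi> f .
  show "chordal G \<longleftrightarrow> n = 1 \<or> n = 2 \<and> (\<exists>i<n. K i = 1) \<or> n = 3 \<and> (\<forall>i<n. K i = 1)"
    by (rule chordal_iff)
  show "chordal (graph_complement G) \<longleftrightarrow> n \<le> 3" by (rule chordal_complement_iff)
  show "perfect_graph G \<longleftrightarrow> n \<le> 4" by (rule perfect_iff)
  show "total_coloring_conjecture G" "edge_chromatic_number G = max_degree G"
    by (rule edge_and_total_colorings)+
  show "total_coloring_conjecture (graph_complement G)" by (rule total_coloring_complement)
qed

theorem corollary1p3: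
  fixes Rs :: "('a, 'm) ring_scheme list"
    and R :: "'a list ring"
    and n :: nat
  assumes n: "length Rs = n" "n \<ge> 1"
    and R: "R = RDirProd_list Rs"
    and local: "\<And>i. i < n \<Longrightarrow> local_ring (Rs ! i)"
    and finite_ideals: "\<And>i. i < n \<Longrightarrow> finite {I. ideal I (Rs ! i)}"
  shows
    \<comment> \<open>(A)\<close>
    "(comaximal_graph R = coannihilating_ideal_graph R \<and>
      coannihilating_ideal_graph R = graph_complement (annihilating_ideal_graph R)) \<and>
    \<comment> \<open>(B)\<close>
     (chordal (comaximal_graph R) \<longleftrightarrow>
        n = 1 \<or>
        (n = 2 \<and> (\<exists>i<n. field (Rs ! i))) \<or>
        (n = 3 \<and> (\<forall>i<n. field (Rs ! i)))) \<and>
    \<comment> \<open>(C)\<close>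
     (graph_complement (comaximal_graph R) = graph_complement (coannihilating_ideal_graph R) \<and>
      graph_complement (coannihilating_ideal_graph R) = annihilating_ideal_graph R \<and>
      (chordal (graph_complement (comaximal_graph R)) \<longleftrightarrow> n \<le> 3)) \<and>
    \<comment> \<open>(D)\<close>
     (perfect_graph (comaximal_graph R) \<longleftrightarrow> n \<le> 4) \<and>
    \<comment> \<open>(E)\<close>
     (total_coloring_conjecture (comaximal_graph R) \<and>
      total_coloring_conjecture (graph_complement (comaximal_graph R)) \<and>
      edge_chromatic_number (comaximal_graph R) = max_degree (comaximal_graph R)) \<and>
    \<comment> \<open>(F)\<close>
     ((\<forall>i<n. artinian_ring (Rs ! i) \<and> principal_ideal_ring (Rs ! i)) \<longrightarrow>
       (chordal (graph_complement (intersection_graph R)) \<longleftrightarrow>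
          n = 1 \<or>
          (n = 2 \<and> (\<exists>i<n. field (Rs ! i))) \<or>
          (n = 3 \<and> (\<forall>i<n. field (Rs ! i)))) \<and>
       (chordal (intersection_graph R) \<longleftrightarrow> n \<le> 3) \<and>
       (perfect_graph (graph_complement (intersection_graph R)) \<longleftrightarrow> n \<le> 4) \<and>
       total_coloring_conjecture (graph_complement (intersection_graph R)) \<and>
       total_coloring_conjecture (intersection_graph R) \<and>
       edge_chromatic_number (graph_complement (intersection_graph R)) =
         max_degree (graph_complement (intersection_graph R)))"
proof -
  have "ring_product Rs R n"
    by (rule ring_product.intro[OF n(1) R]) (rule local_ring.axioms(1)[OF local])
  then interpret local_product Rs R n
    by (rule local_product.intro) (rule local_product_axioms.intro[OF local finite_ideals])
  let ?CG = "comaximal_graph R" and ?IG = "intersection_graph R"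
  let ?K = "\<lambda>i. card {I. ideal I (Rs ! i)} - 1"
  let ?cases = "n = 1 \<or> (n = 2 \<and> (\<exists>i<n. field (Rs ! i))) \<or> (n = 3 \<and> (\<forall>i<n. field (Rs ! i)))"
  have K: "(n = 1 \<or> n = 2 \<and> (\<exists>i<n. ?K i = 1) \<or> n = 3 \<and> (\<forall>i<n. ?K i = 1)) \<longleftrightarrow> ?cases"
    using field_iff by meson
  have A: "?CG = coannihilating_ideal_graph R"
    "coannihilating_ideal_graph R = graph_complement (annihilating_ideal_graph R)"
    using comaximal_eq_coannihilating comaximal_eq_complement_annihilating by simp_all
  have C: "graph_complement ?CG = graph_complement (coannihilating_ideal_graph R)"
    "graph_complement (coannihilating_ideal_graph R) = annihilating_ideal_graph R"
    using A graph_complement_complement[OF simple_ideal_graph]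
    by (simp_all add: annihilating_ideal_graph_def)
  note CG = disjointness_graph_properties[OF comaximal_disjointness_graph[OF n(2)]]
  have IG: "graph_complement (graph_complement ?IG) = ?IG"
    unfolding intersection_graph_def by (rule graph_complement_complement[OF simple_ideal_graph])
  have F: "(chordal (graph_complement ?IG) \<longleftrightarrow> ?cases) \<and> (chordal ?IG \<longleftrightarrow> n \<le> 3) \<and>
      (perfect_graph (graph_complement ?IG) \<longleftrightarrow> n \<le> 4) \<and>
      total_coloring_conjecture (graph_complement ?IG) \<and> total_coloring_conjecture ?IG \<and>
      edge_chromatic_number (graph_complement ?IG) = max_degree (graph_complement ?IG)"
    if "\<forall>i<n. artinian_ring (Rs ! i) \<and> principal_ideal_ring (Rs ! i)"
  proof -
    have "\<And>i. i < n \<Longrightarrow> principal_ideal_ring (Rs ! i)" using that by blast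
    note P = disjointness_graph_properties[OF intersection_disjointness_graph[OF n(2) this]]
    show ?thesis
      using P(1) P(2)[unfolded IG] P(3,4) P(5)[unfolded IG] P(6) unfolding K by blast
  qed
  show ?thesis
    using A C F CG unfolding K by blast
qed

end
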